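(* Let $\Omega_0=\Omega_{\mathcal{T}_0}$ be the Jeandel-Rao Wang shift. There exist sets of Wang tiles $\{\mathcal{T}_i\}_{1\le i\le 12}$, with associated Wang shifts $\Omega_i=\Omega_{\mathcal{T}_i}$, such that: (i) there exist $2$-dimensional morphisms $\omega_i:\Omega_{i+1}\to\Omega_i$ for $i\in\{0,1,2,3\}$, $$\Omega_0\xleftarrow{\omega_0}\Omega_1\xleftarrow{\omega_1}\Omega_2\xleftarrow{\omega_2}\Omega_3\xleftarrow{\omega_3}\Omega_4,$$ each recognizable (in $\Omega_{i+1}$) and onto up to a shift, i.e. $\overline{\omega_i(\Omega_{i+1})}^{\sigma}=\Omega_i$; (ii) there exists an embedding $\jmath:\Omega_5\to\Omega_4$ which is a topological conjugacy onto its image; (iii) there exists a shear conjugacy $\eta:\Omega_6\to\Omega_5$ which shears Wang tilings by the action of the matrix $M=\begin{pmatrix}1&1\\0&1\end{pmatrix}$, i.e. $\eta\circ\sigma^{\mathbf n}=\sigma^{M\mathbf n}\circ\eta$ for all $\mathbf n\in\mathbb{Z}^2$; (iv) there exist $2$-dimensional morphisms $\omega_i:\Omega_{i+1}\to\Omega_i$ for $i\in\{6,7,8,9,10,11\}$, $$\Omega_6\xleftarrow{\omega_6}\Omega_7\xleftarrow{\omega_7}\Omega_8\xleftarrow{\omega_8}\Omega_9\xleftarrow{\omega_9}\Omega_{10}\xleftarrow{\omega_{10}}\Omega_{11}\xleftarrow{\omega_{11}}\Omega_{12},$$ each recognizable and onto up to a shift, i.e. $\overline{\omega_i(\Omega_{i+1})}^{\sigma}=\Omega_i$;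 (v) the Wang shift $\Omega_{12}$ is equivalent to $\Omega_{\mathcal U}$ (the sets of Wang tiles $\mathcal{T}_{12}$ and $\mathcal{U}$ are equivalent), and thus $\Omega_{12}$ is self-similar, aperiodic and minimal.
   Context: A Wang tile is a tuple $(a,b,c,d)$ giving the colors of the right, top, left and bottom edges of a unit square, in this order. For a finite set $\mathcal{T}$ of Wang tiles, the Wang shift $\Omega_{\mathcal T}$ is the set of all $x:\mathbb{Z}^2\to\mathcal{T}$ such that for every $\mathbf n$ the right color of $x(\mathbf n)$ equals the left color of $x(\mathbf n+\mathbf e_1)$ and the top color of $x(\mathbf n)$ equals the bottom color of $x(\mathbf n+\mathbf e_2)$. The shift is $(\sigma^{\mathbf n}x)_{\mathbf m}=x_{\mathbf m+\mathbf n}$. A subshift is a closed shift-invariant set (product topology); it is minimal if it contains no nonempty proper closed shift-invariant subset; aperiodic if it is nonempty and no element has a nonzero period. Two sets of Wang tiles $\mathcal{T},\mathcal{S}$ are equivalent if there are bijections $i$ of the vertical-edge (left/right) colors and $j$ of the horizontal-edge (top/bottom) colors with $\mathcal{S}=\{(i(a),j(b),i(c),j(d)):(a,b,c,d)\in\mathcal{T}\}$. The Jeandel-Rao set is $\mathcal{T}_0=\{(2,4,2,1),(2,2,2,0),(1,1,3,1),(1,2,3,2),(3,1,3,3),(0,1,3,1),(0,0,0,1),(3,1,0,2),(0,2,1,2),(1,2,1,4),(3,3,1,2)\}$. $\mathcal{U}$ consists of the 19 tiles $(F,O,J,O)$, $(F,O,H,L)$, $(J,M,F,P)$, $(D,M,F,K)$,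 $(H,P,J,P)$, $(H,P,H,N)$, $(H,K,F,P)$, $(H,K,D,P)$, $(B,O,I,O)$, $(G,L,E,O)$, $(G,L,C,L)$, $(A,L,I,O)$, $(E,P,G,P)$, $(E,P,I,P)$, $(I,P,G,K)$, $(I,P,I,K)$, $(I,K,B,M)$, $(I,K,A,K)$, $(C,N,I,P)$ (letters are distinct colors). Morphisms. A $2$-dimensional word of shape $\mathbf n=(n_1,n_2)$ over an alphabet $\mathcal{A}$ is a map $\{0,\dots,n_1-1\}\times\{0,\dots,n_2-1\}\to\mathcal{A}$; $\mathcal{A}^{*^2}$ is the set of all of them. For words $u,v$ whose shapes agree except possibly in coordinate $i$, $u\odot^i v$ is their concatenation in direction $\mathbf e_i$ ($v$ placed after $u$). If $L\subseteq\mathcal{A}^{*^2}$ is closed under taking subwords, a $2$-dimensional morphism $\omega:L\to\mathcal{B}^{*^2}$ is a map such that whenever $u,v,u\odot^iv\in L$, the concatenation $\omega(u)\odot^i\omega(v)$ is defined and equals $\omega(u\odot^iv)$. For a subshift $X$, a morphism defined on the language of $X$ (the finite words occurring in elements of $X$) extends to $\omega:X\to\mathcal{B}^{\mathbb{Z}^2}$, by juxtaposing the images of the letters, with the lower-left letter of $\omega(x_{\mathbf 0})$ placed at position $\mathbf 0$. We write $\overline{Y}^{\sigma}=\bigcup_{\mathbf k\in\mathbb{Z}^2}\sigma^{\mathbf k}(Y)$. The morphism $\omega$ is recognizable in $X$ if every $y\in\mathcal{B}^{\mathbb{Z}^2}$ has at most one representation $y=\sigma^{\mathbf k}\omega(x)$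 with $x\in X$ and $\mathbf 0\le\mathbf k<\mathrm{shape}(\omega(x_{\mathbf 0}))$ coordinatewise. A subshift $X\subseteq\mathcal{A}^{\mathbb{Z}^2}$ is self-similar if there is a $2$-dimensional morphism $\omega$ on its language with values in $\mathcal{A}^{*^2}$ which is expansive (for every letter $a$ and $K\in\mathbb{N}$ there is $m$ such that both coordinates of the shape of $\omega^m(a)$ exceed $K$) and satisfies $X=\overline{\omega(X)}^\sigma$. An embedding of subshifts is a one-to-one continuous map commuting with all $\sigma^{\mathbf k}$; a topological conjugacy is a bijective such map with continuous inverse. A shear conjugacy is a homeomorphism $\theta:X\to Y$ of subshifts with $\sigma^{M\mathbf k}\circ\theta=\theta\circ\sigma^{\mathbf k}$ for all $\mathbf k$, for some shear matrix $M\in\mathrm{GL}_2(\mathbb{Z})$. *)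

theory Defs
  imports "HOL-Analysis.Analysis"
begin

section \<open>Configurations and subshifts\<close>

type_synonym 'a config = "int \<times> int \<Rightarrow> 'a"

definition shift :: "int \<times> int \<Rightarrow> 'a config \<Rightarrow> 'a config" where
  "shift n x = (\<lambda>m. x (m + n))"

definition shift_closure :: "'a config set \<Rightarrow> 'a config set" where
  "shift_closure Y = (\<Union>k. shift k ` Y)"

text \<open>The alphabet is discrete. For a set of configurations over a subalphabet
  \<open>A\<close>, being closed here is the same as being closed in the product of copies of \<open>A\<close>,
  since that product is itself closed.\<close>

definition config_topology :: "'a config topology" where
  "config_topology = product_topology (\<lambda>_. discrete_topology UNIV) UNIV"

definition subshift :: "'a config set \<Rightarrow> bool" where
  "subshift X \<longleftrightarrow> closedin config_topology X \<and> (\<forall>n. shift n ` X = X)"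

definition minimal_subshift :: "'a config set \<Rightarrow> bool" where
  "minimal_subshift X \<longleftrightarrow> subshift X \<and> (\<forall>Y. subshift Y \<and> Y \<noteq> {} \<and> Y \<subseteq> X \<longrightarrow> Y = X)"

definition aperiodic :: "'a config set \<Rightarrow> bool" where
  "aperiodic X \<longleftrightarrow> X \<noteq> {} \<and> (\<forall>x\<in>X. \<forall>n. n \<noteq> 0 \<longrightarrow> shift n x \<noteq> x)"

definition embedding :: "'a config set \<Rightarrow> 'b config set \<Rightarrow> ('a config \<Rightarrow> 'b config) \<Rightarrow> bool" where
  "embedding X Y f \<longleftrightarrow>
     continuous_map (subtopology config_topology X) (subtopology config_topology Y) f \<and>
     inj_on f X \<and> (\<forall>k. \<forall>x\<in>X. f (shift k x) = shift k (f x))"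

definition topological_conjugacy ::
    "'a config set \<Rightarrow> 'b config set \<Rightarrow> ('a config \<Rightarrow> 'b config) \<Rightarrow> bool" where
  "topological_conjugacy X Y f \<longleftrightarrow>
     homeomorphic_map (subtopology config_topology X) (subtopology config_topology Y) f \<and>
     (\<forall>k. \<forall>x\<in>X. f (shift k x) = shift k (f x))"

definition mat_act :: "int^2^2 \<Rightarrow> int \<times> int \<Rightarrow> int \<times> int" where
  "mat_act M n = (M$1$1 * fst n + M$1$2 * snd n, M$2$1 * fst n + M$2$2 * snd n)"

definition shear_matrix :: "int^2^2 \<Rightarrow> bool" where
  "shear_matrix M \<longleftrightarrow> (M - mat 1) ** (M - mat 1) = 0"

definition shear_conjugacy ::
    "int^2^2 \<Rightarrow> 'a config set \<Rightarrow> 'b config set \<Rightarrow> ('a config \<Rightarrow> 'b config) \<Rightarrow> bool" where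
  "shear_conjugacy M X Y f \<longleftrightarrow> shear_matrix M \<and>
     homeomorphic_map (subtopology config_topology X) (subtopology config_topology Y) f \<and>
     (\<forall>k. \<forall>x\<in>X. f (shift k x) = shift (mat_act M k) (f x))"


section \<open>Two-dimensional words and morphisms\<close>

text \<open>A word is its shape together with its entries. Equality of words is meaningful because the
  entries are a function that is \<open>undefined\<close> outside the rectangle given by the shape.\<close>

type_synonym 'a word2 = "(nat \<times> nat) \<times> (nat \<times> nat \<Rightarrow> 'a)"

abbreviation width :: "'a word2 \<Rightarrow> nat" where "width w \<equiv> fst (fst w)"
abbreviation height :: "'a word2 \<Rightarrow> nat" where "height w \<equiv> snd (fst w)"
abbreviation entry :: "'a word2 \<Rightarrow> nat \<times> nat \<Rightarrow> 'a" where "entry w \<equiv> snd w"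

definition rect :: "nat \<times> nat \<Rightarrow> (nat \<times> nat) set" where
  "rect n = {..<fst n} \<times> {..<snd n}"

definition words :: "'a set \<Rightarrow> 'a word2 set" where
  "words A = {w. entry w \<in> rect (fst w) \<rightarrow>\<^sub>E A}"

definition mk_word :: "nat \<times> nat \<Rightarrow> (nat \<times> nat \<Rightarrow> 'a) \<Rightarrow> 'a word2" where
  "mk_word n f = (n, restrict f (rect n))"

definition letter :: "'a \<Rightarrow> 'a word2" where
  "letter a = mk_word (1, 1) (\<lambda>_. a)"

definition nonempty :: "'a word2 \<Rightarrow> bool" where
  "nonempty w \<longleftrightarrow> 0 < width w \<and> 0 < height w"

definition subword :: "'a word2 \<Rightarrow> 'a word2 \<Rightarrow> bool" where
  "subword u v \<longleftrightarrow> (\<exists>p q. p + width u \<le> width v \<and> q + height u \<le> height v \<and>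
     u = mk_word (fst u) (\<lambda>(i, j). entry v (p + i, q + j)))"

text \<open>\<open>hcat\<close> and \<open>vcat\<close> are the concatenations in directions \<open>e\<^sub>1\<close> and \<open>e\<^sub>2\<close>; they are only
  meaningful for words of equal height and of equal width, respectively.\<close>

definition hcat :: "'a word2 \<Rightarrow> 'a word2 \<Rightarrow> 'a word2" where
  "hcat u v = mk_word (width u + width v, height u)
     (\<lambda>(i, j). if i < width u then entry u (i, j) else entry v (i - width u, j))"

definition vcat :: "'a word2 \<Rightarrow> 'a word2 \<Rightarrow> 'a word2" where
  "vcat u v = mk_word (width u, height u + height v)
     (\<lambda>(i, j). if j < height u then entry u (i, j) else entry v (i, j - height u))"

text \<open>Languages consist of nonempty words: an empty word of shape \<open>(0, n)\<close> can be concatenated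
  with every word of height \<open>n\<close>, so admitting it would force the images of all words of
  height \<open>n\<close> under a morphism to have the same height.\<close>

definition subword_closed :: "'a word2 set \<Rightarrow> bool" where
  "subword_closed L \<longleftrightarrow> (\<forall>v\<in>L. \<forall>u. nonempty u \<and> subword u v \<longrightarrow> u \<in> L)"

definition language :: "'a config set \<Rightarrow> 'a word2 set" where
  "language X = {w. nonempty w \<and>
     (\<exists>x\<in>X. \<exists>p q. w = mk_word (fst w) (\<lambda>(i, j). x (p + int i, q + int j)))}"

definition morphism :: "'a word2 set \<Rightarrow> 'b set \<Rightarrow> ('a word2 \<Rightarrow> 'b word2) \<Rightarrow> bool" where
  "morphism L B \<omega> \<longleftrightarrow> subword_closed L \<and> \<omega> \<in> L \<rightarrow> words B \<and>
     (\<forall>u\<in>L. \<forall>v\<in>L. height u = height v \<and> hcat u v \<in> L \<longrightarrow>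
        height (\<omega> u) = height (\<omega> v) \<and> \<omega> (hcat u v) = hcat (\<omega> u) (\<omega> v)) \<and>
     (\<forall>u\<in>L. \<forall>v\<in>L. width u = width v \<and> vcat u v \<in> L \<longrightarrow>
        width (\<omega> u) = width (\<omega> v) \<and> \<omega> (vcat u v) = vcat (\<omega> u) (\<omega> v))"

text \<open>\<open>P m\<close> and \<open>Q n\<close> are the coordinates at which the images of the letters in column \<open>m\<close> and in
  row \<open>n\<close> start.\<close>

definition juxtaposition :: "('a word2 \<Rightarrow> 'b word2) \<Rightarrow> 'a config \<Rightarrow> 'b config \<Rightarrow> bool" where
  "juxtaposition \<omega> x y \<longleftrightarrow> (\<exists>P Q. P 0 = 0 \<and> Q 0 = 0 \<and>
     (\<forall>m n. let w = \<omega> (letter (x (m, n))) in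
        P (m + 1) = P m + int (width w) \<and> Q (n + 1) = Q n + int (height w) \<and>
        (\<forall>i<width w. \<forall>j<height w. y (P m + int i, Q n + int j) = entry w (i, j))))"

definition extend :: "('a word2 \<Rightarrow> 'b word2) \<Rightarrow> 'a config \<Rightarrow> 'b config" where
  "extend \<omega> x = (THE y. juxtaposition \<omega> x y)"

text \<open>The image of \<open>x\<close> has the lower-left letter of the image of \<open>x 0\<close> at the origin, so morphisms
  that are to be extended to configurations must not erase letters.\<close>

definition morphism_on :: "'a config set \<Rightarrow> 'b set \<Rightarrow> ('a word2 \<Rightarrow> 'b word2) \<Rightarrow> bool" where
  "morphism_on X B \<omega> \<longleftrightarrow> morphism (language X) B \<omega> \<and>
     (\<forall>a. letter a \<in> language X \<longrightarrow> nonempty (\<omega> (letter a)))"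

text \<open>The following facts show that \<open>extend\<close> is well defined on \<open>X\<close>, and that \<open>subword_closed\<close> is
  no restriction for languages.\<close>

lemma int_steps_cover:
  fixes P :: "int \<Rightarrow> int" and w :: "int \<Rightarrow> nat"
  assumes "P 0 = 0" "\<And>m. P (m + 1) = P m + int (w m)" "\<And>m. 0 < w m"
  shows "\<exists>m i. i < w m \<and> p = P m + int i"
proof (induction p rule: int_induct[where k = 0])
  case base
  then show ?case using assms(1,3) by (intro exI[of _ 0]) auto
next
  case (step1 p)
  then obtain m i where mi: "i < w m" "p = P m + int i" by blast
  show ?case
  proof (cases "i + 1 < w m")
    case True
    then show ?thesis using mi by (intro exI[of _ m] exI[of _ "i + 1"]) auto
  next
    case False
    then have "i + 1 = w m" using mi by simp
    then show ?thesis using mi assms(2)[of m] assms(3)[of "m + 1"]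
      by (intro exI[of _ "m + 1"] exI[of _ 0]) auto
  qed
next
  case (step2 p)
  then obtain m i where mi: "i < w m" "p = P m + int i" by blast
  show ?case
  proof (cases "i = 0")
    case True
    then show ?thesis using mi assms(2)[of "m - 1"] assms(3)[of "m - 1"]
      by (intro exI[of _ "m - 1"] exI[of _ "w (m - 1) - 1"]) auto
  next
    case False
    then show ?thesis using mi by (intro exI[of _ m] exI[of _ "i - 1"]) auto
  qed
qed

lemma int_steps_disjoint:
  fixes P :: "int \<Rightarrow> int" and w :: "int \<Rightarrow> nat"
  assumes "\<And>m. P (m + 1) = P m + int (w m)"
    and "i < w m" "i' < w m'" "P m + int i = P m' + int i'"
  shows "m = m' \<and> i = i'"
proof -
  have mono: "P a \<le> P b" if "a \<le> b" for a b
    using that by (induction rule: int_ge_induct) (auto simp: assms(1))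
  have "\<not> m < m'" "\<not> m' < m"
    using mono[of "m + 1" m'] mono[of "m' + 1" m] assms(1)[of m] assms(1)[of m'] assms(2-4)
    by auto
  then show ?thesis using assms(4) by auto
qed

lemma int_steps_unique:
  fixes P P' :: "int \<Rightarrow> int"
  assumes "P 0 = 0" "P' 0 = 0" "\<And>m. P (m + 1) = P m + w m" "\<And>m. P' (m + 1) = P' m + w m"
  shows "P m = P' m"
proof (induction m rule: int_induct[where k = 0])
  case (step2 m)
  then show ?case using assms(3)[of "m - 1"] assms(4)[of "m - 1"] by simp
qed (use assms in auto)

lemma int_steps_exist:
  fixes w :: "int \<Rightarrow> int"
  obtains P :: "int \<Rightarrow> int" where "P 0 = 0" "\<And>m. P (m + 1) = P m + w m"
proof -
  define P where "P m = sum w {0..<m} - sum w {m..<0}" for m :: int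
  have "P (m + 1) = P m + w m" for m
  proof (cases "0 \<le> m")
    case True
    then have "{0..<m + 1} = insert m {0..<m}" by auto
    then show ?thesis using True by (simp add: P_def)
  next
    case False
    then have "{m..<0} = insert m {m + 1..<0}" by auto
    then show ?thesis using False by (simp add: P_def)
  qed
  then show thesis by (intro that[of P]) (simp_all add: P_def)
qed

lemma subword_closed_language: "subword_closed (language X)"
  unfolding subword_closed_def
proof (intro ballI allI impI)
  fix v u :: "'a word2" assume v: "v \<in> language X" and u: "nonempty u \<and> subword u v"
  from v obtain x p q where x: "x \<in> X" "v = mk_word (fst v) (\<lambda>(i, j). x (p + int i, q + int j))"
    by (auto simp: language_def)
  from u obtain p' q' where le: "p' + width u \<le> width v" "q' + height u \<le> height v"
    and eq: "u = mk_word (fst u) (\<lambda>(i, j). entry v (p' + i, q' + j))"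
    by (auto simp: subword_def)
  have "entry v (p' + i, q' + j) = x (p + int p' + int i, q + int q' + int j)"
    if "i < width u" "j < height u" for i j
    using that le by (subst x(2)) (auto simp: mk_word_def rect_def add.assoc)
  then have "mk_word (fst u) (\<lambda>(i, j). entry v (p' + i, q' + j)) =
      mk_word (fst u) (\<lambda>(i, j). x (p + int p' + int i, q + int q' + int j))"
    by (auto simp: mk_word_def rect_def restrict_def fun_eq_iff)
  with eq have "u = mk_word (fst u) (\<lambda>(i, j). x (p + int p' + int i, q + int q' + int j))"
    by simp
  then show "u \<in> language X" using u x(1) unfolding language_def by blast
qed

lemma letter_in_language:
  assumes "x \<in> X" shows "letter (x (m, n)) \<in> language X"
proof -
  have "letter (x (m, n)) = mk_word (1, 1) (\<lambda>(i, j). x (m + int i, n + int j))"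
    by (auto simp: letter_def mk_word_def rect_def restrict_def fun_eq_iff)
  then show ?thesis using assms
    by (auto simp: language_def nonempty_def mk_word_def intro!: bexI[of _ x])
qed

lemma hcat_in_language:
  assumes "x \<in> X" shows "hcat (letter (x (m, n))) (letter (x (m + 1, n))) \<in> language X"
proof -
  have "hcat (letter (x (m, n))) (letter (x (m + 1, n))) =
      mk_word (2, 1) (\<lambda>(i, j). x (m + int i, n + int j))"
    by (auto simp: hcat_def letter_def mk_word_def rect_def restrict_def fun_eq_iff less_2_cases_iff)
  then show ?thesis using assms
    by (auto simp: language_def nonempty_def mk_word_def intro!: bexI[of _ x])
qed

lemma vcat_in_language:
  assumes "x \<in> X" shows "vcat (letter (x (m, n))) (letter (x (m, n + 1))) \<in> language X"
proof -
  have "vcat (letter (x (m, n))) (letter (x (m, n + 1))) =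
      mk_word (1, 2) (\<lambda>(i, j). x (m + int i, n + int j))"
    by (auto simp: vcat_def letter_def mk_word_def rect_def restrict_def fun_eq_iff less_2_cases_iff)
  then show ?thesis using assms
    by (auto simp: language_def nonempty_def mk_word_def intro!: bexI[of _ x])
qed

lemma int_const:
  fixes f :: "int \<Rightarrow> 'a" assumes "\<And>n. f (n + 1) = f n" shows "f n = f 0"
proof (induction n rule: int_induct[where k = 0])
  case (step2 n)
  then show ?case using assms[of "n - 1"] by simp
qed (use assms in auto)

lemma juxtaposition_ex1:
  assumes "morphism_on X B \<omega>" "x \<in> X"
  shows "\<exists>!y. juxtaposition \<omega> x y"
proof -
  let ?w = "\<lambda>m n. \<omega> (letter (x (m, n)))"
  define W where "W m = width (?w m 0)" for m
  define H where "H n = height (?w 0 n)" for n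
  have mor: "morphism (language X) B \<omega>" and
    ne: "\<And>m n. nonempty (?w m n)"
    using assms letter_in_language[OF assms(2)] by (auto simp: morphism_on_def)
  have "height (?w (m + 1) n) = height (?w m n)" for m n
    using mor letter_in_language[OF assms(2)] hcat_in_language[OF assms(2)]
    unfolding morphism_def by (metis (no_types, lifting) fst_conv letter_def mk_word_def)
  then have H: "height (?w m n) = H n" for m n
    using int_const[of "\<lambda>m. height (?w m n)" m] by (simp add: H_def)
  have "width (?w m (n + 1)) = width (?w m n)" for m n
    using mor letter_in_language[OF assms(2)] vcat_in_language[OF assms(2)]
    unfolding morphism_def by (metis (no_types, lifting) fst_conv letter_def mk_word_def)
  then have W: "width (?w m n) = W m" for m n
    using int_const[of "\<lambda>n. width (?w m n)" n] by (simp add: W_def)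
  have pos: "0 < W m" "0 < H m" for m
    using ne[of m 0] ne[of 0 m] by (auto simp: nonempty_def W_def H_def)
  obtain P where P: "P 0 = 0" "\<And>m. P (m + 1) = P m + int (W m)"
    using int_steps_exist[of "\<lambda>m. int (W m)"] by blast
  obtain Q where Q: "Q 0 = 0" "\<And>n. Q (n + 1) = Q n + int (H n)"
    using int_steps_exist[of "\<lambda>n. int (H n)"] by blast
  have jux: "juxtaposition \<omega> x y \<longleftrightarrow>
    (\<forall>m n. \<forall>i<W m. \<forall>j<H n. y (P m + int i, Q n + int j) = entry (?w m n) (i, j))" for y
  proof
    assume "juxtaposition \<omega> x y"
    then obtain P' Q' where *: "P' 0 = 0" "Q' 0 = 0"
      "\<And>m n. P' (m + 1) = P' m + int (W m)" "\<And>m n. Q' (n + 1) = Q' n + int (H n)"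
      "\<And>m n i j. i < W m \<Longrightarrow> j < H n \<Longrightarrow> y (P' m + int i, Q' n + int j) = entry (?w m n) (i, j)"
      unfolding juxtaposition_def Let_def W H by blast
    have "P' = P" "Q' = Q"
      using int_steps_unique[OF *(1) P(1) *(3) P(2)] int_steps_unique[OF *(2) Q(1) *(4) Q(2)]
      by auto
    then show "\<forall>m n. \<forall>i<W m. \<forall>j<H n. y (P m + int i, Q n + int j) = entry (?w m n) (i, j)"
      using *(5) by simp
  next
    assume "\<forall>m n. \<forall>i<W m. \<forall>j<H n. y (P m + int i, Q n + int j) = entry (?w m n) (i, j)"
    then show "juxtaposition \<omega> x y"
      unfolding juxtaposition_def Let_def W H using P Q by blast
  qed
  have "\<forall>p. \<exists>m i. i < W m \<and> p = P m + int i"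
    using int_steps_cover[of P W] P pos by blast
  then obtain cm ci where c: "\<And>p. ci p < W (cm p)" "\<And>p. p = P (cm p) + int (ci p)"
    by metis
  have "\<forall>q. \<exists>n j. j < H n \<and> q = Q n + int j"
    using int_steps_cover[of Q H] Q pos by blast
  then obtain rn rj where r: "\<And>q. rj q < H (rn q)" "\<And>q. q = Q (rn q) + int (rj q)"
    by metis
  let ?y = "\<lambda>(p, q). entry (?w (cm p) (rn q)) (ci p, rj q)"
  show ?thesis
  proof
    show "juxtaposition \<omega> x ?y"
      unfolding jux
    proof (intro allI impI)
      fix m n i j assume ij: "i < W m" "j < H n"
      have "cm (P m + int i) = m \<and> ci (P m + int i) = i"
        using int_steps_disjoint[of P W, OF P(2) c(1) ij(1)] c(2) by metis
      moreover have "rn (Q n + int j) = n \<and> rj (Q n + int j) = j"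
        using int_steps_disjoint[of Q H, OF Q(2) r(1) ij(2)] r(2) by metis
      ultimately show "?y (P m + int i, Q n + int j) = entry (?w m n) (i, j)" by simp
    qed
  next
    fix y assume y: "juxtaposition \<omega> x y"
    have "y (p, q) = ?y (p, q)" for p q
      using y[unfolded jux] c r by (metis case_prod_conv)
    then show "y = ?y" by auto
  qed
qed

definition recognizable :: "'a config set \<Rightarrow> ('a word2 \<Rightarrow> 'b word2) \<Rightarrow> bool" where
  "recognizable X \<omega> \<longleftrightarrow> (\<forall>y. Uniq (\<lambda>(k, x). x \<in> X \<and> y = shift k (extend \<omega> x) \<and>
     0 \<le> fst k \<and> fst k < int (width (\<omega> (letter (x 0)))) \<and>
     0 \<le> snd k \<and> snd k < int (height (\<omega> (letter (x 0))))))"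

definition onto_up_to_shift :: "'a config set \<Rightarrow> 'b config set \<Rightarrow> ('a word2 \<Rightarrow> 'b word2) \<Rightarrow> bool" where
  "onto_up_to_shift X Y \<omega> \<longleftrightarrow> shift_closure (extend \<omega> ` X) = Y"

definition expansive :: "'a config set \<Rightarrow> ('a word2 \<Rightarrow> 'a word2) \<Rightarrow> bool" where
  "expansive X \<omega> \<longleftrightarrow> (\<forall>a K. letter a \<in> language X \<longrightarrow>
     (\<exists>m. K < width ((\<omega> ^^ m) (letter a)) \<and> K < height ((\<omega> ^^ m) (letter a))))"

definition self_similar :: "'a set \<Rightarrow> 'a config set \<Rightarrow> bool" where
  "self_similar A X \<longleftrightarrow> subshift X \<and> (\<forall>x\<in>X. range x \<subseteq> A) \<and>
     (\<exists>\<omega>. morphism_on X A \<omega> \<and> expansive X \<omega> \<and> X = shift_closure (extend \<omega> ` X))"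


section \<open>Wang tiles\<close>

type_synonym 'c tile = "'c \<times> 'c \<times> 'c \<times> 'c"

fun right_color :: "'c tile \<Rightarrow> 'c" where "right_color (a, b, c, d) = a"
fun top_color :: "'c tile \<Rightarrow> 'c" where "top_color (a, b, c, d) = b"
fun left_color :: "'c tile \<Rightarrow> 'c" where "left_color (a, b, c, d) = c"
fun bottom_color :: "'c tile \<Rightarrow> 'c" where "bottom_color (a, b, c, d) = d"

definition wang_shift :: "'c tile set \<Rightarrow> 'c tile config set" where
  "wang_shift T = {x. range x \<subseteq> T \<and>
     (\<forall>n. right_color (x n) = left_color (x (n + (1, 0))) \<and>
          top_color (x n) = bottom_color (x (n + (0, 1))))}"

definition vertical_colors :: "'c tile set \<Rightarrow> 'c set" where
  "vertical_colors T = right_color ` T \<union> left_color ` T"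

definition horizontal_colors :: "'c tile set \<Rightarrow> 'c set" where
  "horizontal_colors T = top_color ` T \<union> bottom_color ` T"

definition equivalent_tiles :: "'c tile set \<Rightarrow> 'd tile set \<Rightarrow> bool" where
  "equivalent_tiles T S \<longleftrightarrow> (\<exists>i j.
     bij_betw i (vertical_colors T) (vertical_colors S) \<and>
     bij_betw j (horizontal_colors T) (horizontal_colors S) \<and>
     S = {(i a, j b, i c, j d) | a b c d. (a, b, c, d) \<in> T})"

definition jeandel_rao :: "nat tile set" where
  "jeandel_rao = {(2,4,2,1), (2,2,2,0), (1,1,3,1), (1,2,3,2), (3,1,3,3), (0,1,3,1),
     (0,0,0,1), (3,1,0,2), (0,2,1,2), (1,2,1,4), (3,3,1,2)}"

datatype ucolor = cA | cB | cC | cD | cE | cF | cG | cH | cI | cJ | cK | cL | cM | cN | cO | cP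

definition U_tiles :: "ucolor tile set" where
  "U_tiles = {
     (cF,cO,cJ,cO), (cF,cO,cH,cL), (cJ,cM,cF,cP), (cD,cM,cF,cK), (cH,cP,cJ,cP),
     (cH,cP,cH,cN), (cH,cK,cF,cP), (cH,cK,cD,cP), (cB,cO,cI,cO), (cG,cL,cE,cO),
     (cG,cL,cC,cL), (cA,cL,cI,cO), (cE,cP,cG,cP), (cE,cP,cI,cP), (cI,cP,cG,cK),
     (cI,cP,cI,cK), (cI,cK,cB,cM), (cI,cK,cA,cK), (cC,cN,cI,cP)}"

end

theory Submission
  imports Defs
begin

text \<open>
  Identities are recognizable morphisms, so each of the two chains of morphisms may consist of a single
  nontrivial one.

  In a tiling by the Jeandel-Rao tiles every row consists either of the two tiles with left color 2 or
  of the nine other tiles, and no five consecutive rows are of the second kind. Hence every such tiling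
  is cut in a unique way into columns of height at most 5, whose fusions are the tiles of
  \<open>\<T>\<^sub>1 = \<dots> = \<T>\<^sub>4\<close>.

  At the other end let \<open>\<T>\<^sub>7 = \<dots> = \<T>\<^sub>1\<^sub>2\<close> be a copy of \<open>\<U>\<close>, and obtain \<open>\<T>\<^sub>6\<close> by
  subdividing each of these tiles into 5 or 8 by 2 or 3 cells with private inner colors. A table
  assigns one of 28 columns to each cell, in such a way that horizontally adjacent cells receive
  horizontally adjacent columns, while the column of a cell fits below that of its upper left neighbor.
  Thus after a shear the table is a letter-to-letter map into the tilings by columns. It is injective
  because a window of eight columns in a row determines where the blocks of cells start.

  For \<open>\<U>\<close>, a local analysis of \<open>2 \<times> 2\<close> patches shows that every tiling is the image of a tiling
  under a substitution with \<open>1\<close> or \<open>2\<close> by \<open>1\<close> or \<open>2\<close> blocks. Periods shrink under desubstitution, whence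
  aperiodicity. The substitution acts primitively on the 50 patches that occur, so every patch occurs
  in every tiling, and going up through the levels the same holds for windows of any size.
\<close>

section \<open>Block substitutions\<close>

text \<open>An embedding commutes with the shift and so cannot change the scale. The difference in
  size between the tiles of \<U> and the Jeandel-Rao columns is therefore left to the morphism onto
  \<open>T 6\<close>, which may subdivide. The shear sends (-1, 1) to (0, 1): the upper left
  neighbor of a cell ends up directly above it. The private colors of \<open>T 6\<close> record
  where blocks begin, whereas columns carry no such mark, so injectivity amounts to recovering the
  grid from the columns alone.

  The two ends call for different evidence. The first morphism has to reach every Jeandel-Rao
  tiling, hence an exhaustive search through stacks of five rows. The embedding may miss tilings, so
  a single table suffices, provided that it fits along all seams that occur. The list of patches
  that serves minimality also lists these seams.

  All nontrivial morphisms are instances of the locale \<open>wang_substitution\<close>, whose core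
  is that the lines between blocks can be read off locally from the tiles.\<close>

definition offs :: "(nat \<Rightarrow> nat) \<Rightarrow> nat \<Rightarrow> nat" where
  "offs w n = (\<Sum>k<n. w k)"

definition slot :: "(nat \<Rightarrow> nat) \<Rightarrow> nat \<Rightarrow> nat \<times> nat" where
  "slot w p = (let i = LEAST i. p < offs w (Suc i) in (i, p - offs w i))"

lemma offs_Suc [simp]: "offs w (Suc n) = offs w n + w n"
  by (simp add: offs_def)

lemma offs_0 [simp]: "offs w 0 = 0"
  by (simp add: offs_def)

lemma offs_mono: "m \<le> n \<Longrightarrow> offs w m \<le> offs w n"
  unfolding offs_def by (intro sum_mono2) auto

lemma offs_cong: "(\<And>k. k < n \<Longrightarrow> w k = w' k) \<Longrightarrow> offs w n = offs w' n"
  unfolding offs_def by (intro sum.cong) auto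

lemma offs_add: "offs w (m + n) = offs w m + offs (\<lambda>k. w (m + k)) n"
  by (induction n) (auto simp: add.assoc)

lemma slot_eq: assumes "r < w i" shows "slot w (offs w i + r) = (i, r)"
proof -
  have "(LEAST i'. offs w i + r < offs w (Suc i')) = i"
  proof (rule Least_equality)
    fix j assume *: "offs w i + r < offs w (Suc j)"
    show "i \<le> j"
      using offs_mono[of "Suc j" i w] * by (cases "i \<le> j") auto
  qed (use assms in simp)
  then show ?thesis by (simp add: slot_def)
qed

lemma slot_cover: "p < offs w n \<Longrightarrow> \<exists>i r. i < n \<and> r < w i \<and> p = offs w i + r"
proof (induction n)
  case (Suc n)
  show ?case
  proof (cases "p < offs w n")
    case True
    then show ?thesis using Suc.IH less_SucI by blast
  next
    case False
    then show ?thesis using Suc.prems by (intro exI[of _ n] exI[of _ "p - offs w n"]) auto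
  qed
qed auto

text \<open>Widths are read off the bottom row and heights off the left column, which makes the
  function total on words. In words whose columns have constant widths and whose rows have constant
  heights, any other row and column would give the same result.\<close>

definition inflate ::
    "('a \<Rightarrow> nat) \<Rightarrow> ('a \<Rightarrow> nat) \<Rightarrow> ('a \<Rightarrow> nat \<Rightarrow> nat \<Rightarrow> 'b) \<Rightarrow> 'a word2 \<Rightarrow> 'b word2" where
  "inflate W H E u =
    (let w = \<lambda>i. W (entry u (i, 0)); h = \<lambda>j. H (entry u (0, j)) in
     mk_word (offs w (width u), offs h (height u))
       (\<lambda>(p, q). case slot w p of (i, r) \<Rightarrow> case slot h q of (j, s) \<Rightarrow> E (entry u (i, j)) r s))"

lemma shape_mk_word [simp]: "fst (mk_word n f) = n"
  by (simp add: mk_word_def)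

lemma entry_mk_word: "i < fst n \<Longrightarrow> j < snd n \<Longrightarrow> entry (mk_word n f) (i, j) = f (i, j)"
  by (simp add: mk_word_def rect_def)

lemma mk_word_eqI:
  assumes "n = n'" "\<And>i j. i < fst n \<Longrightarrow> j < snd n \<Longrightarrow> f (i, j) = f' (i, j)"
  shows "mk_word n f = mk_word n' f'"
  using assms by (auto simp: mk_word_def rect_def restrict_def fun_eq_iff)

lemma width_inflate: "width (inflate W H E u) = offs (\<lambda>i. W (entry u (i, 0))) (width u)"
  by (simp add: inflate_def Let_def)

lemma height_inflate: "height (inflate W H E u) = offs (\<lambda>j. H (entry u (0, j))) (height u)"
  by (simp add: inflate_def Let_def)

lemma entry_inflate:
  assumes "i < width u" "r < W (entry u (i, 0))" "j < height u" "s < H (entry u (0, j))"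
  shows "entry (inflate W H E u)
      (offs (\<lambda>i. W (entry u (i, 0))) i + r, offs (\<lambda>j. H (entry u (0, j))) j + s) =
    E (entry u (i, j)) r s"
proof -
  have "offs (\<lambda>i. W (entry u (i, 0))) i + r < offs (\<lambda>i. W (entry u (i, 0))) (width u)"
    using offs_mono[of "Suc i" "width u" "\<lambda>i. W (entry u (i, 0))"] assms by simp
  moreover have "offs (\<lambda>j. H (entry u (0, j))) j + s < offs (\<lambda>j. H (entry u (0, j))) (height u)"
    using offs_mono[of "Suc j" "height u" "\<lambda>j. H (entry u (0, j))"] assms by simp
  ultimately show ?thesis
    using assms by (simp add: inflate_def Let_def entry_mk_word slot_eq)
qed

lemma word_eqI:
  assumes "fst u = n" "u = mk_word (fst u) (snd u)"
    "\<And>p q. p < fst n \<Longrightarrow> q < snd n \<Longrightarrow> entry u (p, q) = f (p, q)"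
  shows "u = mk_word n f"
  using assms by (metis (no_types, lifting) mk_word_eqI surj_pair)

lemma inflate_mk: "inflate W H E u = mk_word (fst (inflate W H E u)) (snd (inflate W H E u))"
  by (simp add: inflate_def Let_def mk_word_def)

text \<open>Since \<open>u\<close> has positive width, the left column of the concatenation is that
  of \<open>u\<close>, so the heights used for the whole word are those of \<open>u\<close>. The
  assumption on \<open>H\<close> makes them the right heights for \<open>v\<close> as well.\<close>

lemma inflate_hcat:
  assumes ne: "0 < height u" and hh: "height u = height v"
    and H: "\<And>j. j < height u \<Longrightarrow> H (entry u (0, j)) = H (entry v (0, j))" and wu: "0 < width u"
  shows "height (inflate W H E u) = height (inflate W H E v)"
    and "inflate W H E (hcat u v) = hcat (inflate W H E u) (inflate W H E v)"
proof -
  let ?c = "hcat u v"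
  let ?wu = "\<lambda>i. W (entry u (i, 0))" and ?wv = "\<lambda>i. W (entry v (i, 0))" and ?wc = "\<lambda>i. W (entry ?c (i, 0))"
  let ?hu = "\<lambda>j. H (entry u (0, j))" and ?hv = "\<lambda>j. H (entry v (0, j))" and ?hc = "\<lambda>j. H (entry ?c (0, j))"
  have shape: "width ?c = width u + width v" "height ?c = height u"
    by (simp_all add: hcat_def)
  have ent: "entry ?c (i, j) = (if i < width u then entry u (i, j) else entry v (i - width u, j))"
    if "i < width u + width v" "j < height u" for i j
    using that by (simp add: hcat_def entry_mk_word)
  have hu: "offs ?hv j = offs ?hu j" if "j \<le> height u" for j
    using that H by (intro offs_cong) auto
  have hc: "offs ?hc j = offs ?hu j" if "j \<le> height u" for j
    using that wu by (intro offs_cong) (auto simp: ent)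
  have wcu: "offs ?wc i = offs ?wu i" if "i \<le> width u" for i
    using that ne by (intro offs_cong) (auto simp: ent)
  have wcv: "offs ?wc (width u + i) = offs ?wu (width u) + offs ?wv i" if "i \<le> width v" for i
    using that ne by (simp add: offs_add wcu) (intro offs_cong, auto simp: ent)
  show 1: "height (inflate W H E u) = height (inflate W H E v)"
    using hu[of "height u"] hh by (simp add: height_inflate)
  have "inflate W H E ?c = mk_word (width (inflate W H E u) + width (inflate W H E v), height (inflate W H E u))
     (\<lambda>(i, j). if i < width (inflate W H E u) then entry (inflate W H E u) (i, j)
        else entry (inflate W H E v) (i - width (inflate W H E u), j))"
  proof (rule word_eqI)
    show "fst (inflate W H E ?c) = (width (inflate W H E u) + width (inflate W H E v), height (inflate W H E u))"
      by (intro prod_eqI) (simp_all add: width_inflate height_inflate shape wcv hc)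
    fix p q assume "p < fst (width (inflate W H E u) + width (inflate W H E v), height (inflate W H E u))"
      "q < snd (width (inflate W H E u) + width (inflate W H E v), height (inflate W H E u))"
    then have p: "p < offs ?wu (width u) + offs ?wv (width v)" and q: "q < offs ?hu (height u)"
      by (simp_all add: width_inflate height_inflate)
    obtain j s where j: "j < height u" "s < ?hu j" "q = offs ?hu j + s"
      using slot_cover[OF q] by blast
    show "entry (inflate W H E ?c) (p, q) = (case (p, q) of (i, j) \<Rightarrow>
        if i < width (inflate W H E u) then entry (inflate W H E u) (i, j)
        else entry (inflate W H E v) (i - width (inflate W H E u), j))"
    proof (cases "p < offs ?wu (width u)")
      case True
      obtain i r where i: "i < width u" "r < ?wu i" "p = offs ?wu i + r"
        using slot_cover[OF True] by blast
      have "entry (inflate W H E ?c) (offs ?wc i + r, offs ?hc j + s) = E (entry ?c (i, j)) r s"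
        using i j ne wu by (intro entry_inflate) (auto simp: ent shape)
      moreover have "entry (inflate W H E u) (offs ?wu i + r, offs ?hu j + s) = E (entry u (i, j)) r s"
        using i j by (intro entry_inflate) auto
      ultimately show ?thesis using True i j by (simp add: width_inflate wcu hc ent)
    next
      case False
      then have "p - offs ?wu (width u) < offs ?wv (width v)" using p by auto
      then obtain i r where i: "i < width v" "r < ?wv i" "p - offs ?wu (width u) = offs ?wv i + r"
        using slot_cover by blast
      have "entry (inflate W H E ?c) (offs ?wc (width u + i) + r, offs ?hc j + s) = E (entry ?c (width u + i, j)) r s"
        using i j ne wu by (intro entry_inflate) (auto simp: ent shape)
      moreover have "entry (inflate W H E v) (offs ?wv i + r, offs ?hv j + s) = E (entry v (i, j)) r s"
        using i j hh H by (intro entry_inflate) auto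
      moreover have "p = offs ?wu (width u) + offs ?wv i + r" using False i by simp
      ultimately show ?thesis using False i j hh by (simp add: width_inflate wcv hc hu ent)
    qed
  qed (rule inflate_mk)
  then show "inflate W H E ?c = hcat (inflate W H E u) (inflate W H E v)"
    by (simp add: hcat_def)
qed

text \<open>The argument for \<open>inflate_hcat\<close> with the axes exchanged.\<close>

lemma inflate_vcat:
  assumes ne: "0 < width u" and hh: "width u = width v"
    and H: "\<And>i. i < width u \<Longrightarrow> W (entry u (i, 0)) = W (entry v (i, 0))" and wu: "0 < height u"
  shows "width (inflate W H E u) = width (inflate W H E v)"
    and "inflate W H E (vcat u v) = vcat (inflate W H E u) (inflate W H E v)"
proof -
  let ?c = "vcat u v"
  let ?wu = "\<lambda>i. W (entry u (i, 0))" and ?wv = "\<lambda>i. W (entry v (i, 0))" and ?wc = "\<lambda>i. W (entry ?c (i, 0))"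
  let ?hu = "\<lambda>j. H (entry u (0, j))" and ?hv = "\<lambda>j. H (entry v (0, j))" and ?hc = "\<lambda>j. H (entry ?c (0, j))"
  have shape: "width ?c = width u" "height ?c = height u + height v"
    by (simp_all add: vcat_def)
  have ent: "entry ?c (i, j) = (if j < height u then entry u (i, j) else entry v (i, j - height u))"
    if "i < width u" "j < height u + height v" for i j
    using that by (simp add: vcat_def entry_mk_word)
  have hu: "offs ?wv j = offs ?wu j" if "j \<le> width u" for j
    using that H by (intro offs_cong) auto
  have hc: "offs ?wc j = offs ?wu j" if "j \<le> width u" for j
    using that wu by (intro offs_cong) (auto simp: ent)
  have wcu: "offs ?hc i = offs ?hu i" if "i \<le> height u" for i
    using that ne by (intro offs_cong) (auto simp: ent)
  have wcv: "offs ?hc (height u + i) = offs ?hu (height u) + offs ?hv i" if "i \<le> height v" for i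
    using that ne by (simp add: offs_add wcu) (intro offs_cong, auto simp: ent)
  show 1: "width (inflate W H E u) = width (inflate W H E v)"
    using hu[of "width u"] hh by (simp add: width_inflate)
  have "inflate W H E ?c = mk_word (width (inflate W H E u), height (inflate W H E u) + height (inflate W H E v))
     (\<lambda>(i, j). if j < height (inflate W H E u) then entry (inflate W H E u) (i, j)
        else entry (inflate W H E v) (i, j - height (inflate W H E u)))"
  proof (rule word_eqI)
    show "fst (inflate W H E ?c) = (width (inflate W H E u), height (inflate W H E u) + height (inflate W H E v))"
      by (intro prod_eqI) (simp_all add: width_inflate height_inflate shape wcv hc)
    fix p q assume "p < fst (width (inflate W H E u), height (inflate W H E u) + height (inflate W H E v))"
      "q < snd (width (inflate W H E u), height (inflate W H E u) + height (inflate W H E v))"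
    then have q: "q < offs ?hu (height u) + offs ?hv (height v)" and p: "p < offs ?wu (width u)"
      by (simp_all add: width_inflate height_inflate)
    obtain i r where i: "i < width u" "r < ?wu i" "p = offs ?wu i + r"
      using slot_cover[OF p] by blast
    show "entry (inflate W H E ?c) (p, q) = (case (p, q) of (i, j) \<Rightarrow>
        if j < height (inflate W H E u) then entry (inflate W H E u) (i, j)
        else entry (inflate W H E v) (i, j - height (inflate W H E u)))"
    proof (cases "q < offs ?hu (height u)")
      case True
      obtain j s where j: "j < height u" "s < ?hu j" "q = offs ?hu j + s"
        using slot_cover[OF True] by blast
      have "entry (inflate W H E ?c) (offs ?wc i + r, offs ?hc j + s) = E (entry ?c (i, j)) r s"
        using i j ne wu by (intro entry_inflate) (auto simp: ent shape)
      moreover have "entry (inflate W H E u) (offs ?wu i + r, offs ?hu j + s) = E (entry u (i, j)) r s"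
        using i j by (intro entry_inflate) auto
      ultimately show ?thesis using True i j by (simp add: height_inflate wcu hc ent)
    next
      case False
      then have "q - offs ?hu (height u) < offs ?hv (height v)" using q by auto
      then obtain j s where j: "j < height v" "s < ?hv j" "q - offs ?hu (height u) = offs ?hv j + s"
        using slot_cover by blast
      have "entry (inflate W H E ?c) (offs ?wc i + r, offs ?hc (height u + j) + s) = E (entry ?c (i, height u + j)) r s"
        using i j ne wu by (intro entry_inflate) (auto simp: ent shape)
      moreover have "entry (inflate W H E v) (offs ?wv i + r, offs ?hv j + s) = E (entry v (i, j)) r s"
        using i j hh H by (intro entry_inflate) auto
      moreover have "q = offs ?hu (height u) + offs ?hv j + s" using False j by simp
      ultimately show ?thesis using False i j hh by (simp add: height_inflate wcv hc hu ent)
    qed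
  qed (rule inflate_mk)
  then show "inflate W H E ?c = vcat (inflate W H E u) (inflate W H E v)"
    by (simp add: vcat_def)
qed

lemma inflate_letter: "inflate W H E (letter a) = mk_word (W a, H a) (\<lambda>(p, q). E a p q)"
proof (rule word_eqI)
  have *: "entry (letter a) (0, 0) = a" by (simp add: letter_def entry_mk_word)
  have sh: "fst (letter a) = (1, 1)" by (simp add: letter_def)
  show "fst (inflate W H E (letter a)) = (W a, H a)"
    by (intro prod_eqI) (simp_all add: width_inflate height_inflate sh *)
  fix p q assume "p < fst (W a, H a)" "q < snd (W a, H a)"
  then show "entry (inflate W H E (letter a)) (p, q) = (case (p, q) of (p, q) \<Rightarrow> E a p q)"
    using entry_inflate[of 0 "letter a" p W 0 q H E] by (simp add: sh *)
qed (rule inflate_mk)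

text \<open>\<open>P\<close> and \<open>Q\<close> are the lines between blocks. Their values at 0
  are left open, so the relation describes all shifts of the image of \<open>x\<close> at once. As
  the steps of \<open>P\<close> are prescribed for every \<open>n\<close>, and those of
  \<open>Q\<close> for every \<open>m\<close>, letters in a common column have equal widths and
  letters in a common row equal heights.\<close>

definition covers ::
    "('a \<Rightarrow> nat) \<Rightarrow> ('a \<Rightarrow> nat) \<Rightarrow> ('a \<Rightarrow> nat \<Rightarrow> nat \<Rightarrow> 'b) \<Rightarrow>
     'a config \<Rightarrow> (int \<Rightarrow> int) \<Rightarrow> (int \<Rightarrow> int) \<Rightarrow> 'b config \<Rightarrow> bool" where
  "covers W H E x P Q y \<longleftrightarrow> (\<forall>m n.
     P (m + 1) = P m + int (W (x (m, n))) \<and> Q (n + 1) = Q n + int (H (x (m, n))) \<and>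
     (\<forall>i<W (x (m, n)). \<forall>j<H (x (m, n)). y (P m + int i, Q n + int j) = E (x (m, n)) i j))"

definition compatible :: "('a \<Rightarrow> nat) \<Rightarrow> ('a \<Rightarrow> nat) \<Rightarrow> 'a config \<Rightarrow> bool" where
  "compatible W H x \<longleftrightarrow> (\<forall>m n. 0 < W (x (m, n)) \<and> 0 < H (x (m, n)) \<and>
     W (x (m, n + 1)) = W (x (m, n)) \<and> H (x (m + 1, n)) = H (x (m, n)))"

lemma compatible_const:
  assumes "compatible W H x"
  shows "W (x (m, n)) = W (x (m, 0))" "H (x (m, n)) = H (x (0, n))"
  using int_const[of "\<lambda>n. W (x (m, n))" n] int_const[of "\<lambda>m. H (x (m, n))" m] assms
  by (auto simp: compatible_def)

lemma language_entries:
  assumes "w \<in> language X"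
  obtains x p q where "x \<in> X" "\<And>i j. i < width w \<Longrightarrow> j < height w \<Longrightarrow> entry w (i, j) = x (p + int i, q + int j)"
    "0 < width w" "0 < height w"
proof -
  from assms obtain x p q where x: "x \<in> X" "w = mk_word (fst w) (\<lambda>(i, j). x (p + int i, q + int j))"
    and ne: "nonempty w"
    by (auto simp: language_def)
  have "entry w (i, j) = x (p + int i, q + int j)" if "i < width w" "j < height w" for i j
    using that by (subst x(2)) (simp add: entry_mk_word)
  with x ne show thesis by (intro that[of x p q]) (auto simp: nonempty_def)
qed

lemma morphism_on_inflate:
  assumes comp: "\<And>x. x \<in> X \<Longrightarrow> compatible W H x"
    and EB: "\<And>x p i j. x \<in> X \<Longrightarrow> i < W (x p) \<Longrightarrow> j < H (x p) \<Longrightarrow> E (x p) i j \<in> B"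
  shows "morphism_on X B (inflate W H E)"
  unfolding morphism_on_def morphism_def
proof (intro conjI ballI allI impI subword_closed_language)
  have WX: "W (x (m, n)) = W (x (m, n'))" if "x \<in> X" for x m n n'
    using compatible_const(1)[OF comp[OF that], of m] by metis
  have HX: "H (x (m, n)) = H (x (m', n))" if "x \<in> X" for x m m' n
    using compatible_const(2)[OF comp[OF that], of _ n] by metis
  have Wc: "W (entry w (i, j)) = W (entry w (i, 0))" and Hc: "H (entry w (i, j)) = H (entry w (0, j))"
    if w: "w \<in> language X" and ij: "i < width w" "j < height w" for w i j
  proof -
    obtain x p q where x: "x \<in> X" "0 < width w" "0 < height w"
      "\<And>i j. i < width w \<Longrightarrow> j < height w \<Longrightarrow> entry w (i, j) = x (p + int i, q + int j)"
      using language_entries[OF w] by metis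
    show "W (entry w (i, j)) = W (entry w (i, 0))" "H (entry w (i, j)) = H (entry w (0, j))"
      using x ij WX[OF x(1)] HX[OF x(1)] by simp_all
  qed
  show "inflate W H E \<in> language X \<rightarrow> words B"
  proof
    fix w assume w: "w \<in> language X"
    obtain x p q where x: "x \<in> X" "0 < width w" "0 < height w"
      "\<And>i j. i < width w \<Longrightarrow> j < height w \<Longrightarrow> entry w (i, j) = x (p + int i, q + int j)"
      using language_entries[OF w] by metis
    let ?w = "inflate W H E w"
    have "entry ?w (a, b) \<in> B" if ab: "a < width ?w" "b < height ?w" for a b
    proof -
      obtain i r where i: "i < width w" "r < W (entry w (i, 0))" "a = offs (\<lambda>i. W (entry w (i, 0))) i + r"
        using slot_cover[OF ab(1)[unfolded width_inflate]] by metis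
      obtain j s where j: "j < height w" "s < H (entry w (0, j))" "b = offs (\<lambda>j. H (entry w (0, j))) j + s"
        using slot_cover[OF ab(2)[unfolded height_inflate]] by metis
      have "entry ?w (a, b) = E (entry w (i, j)) r s"
        using i j by (simp add: entry_inflate)
      moreover have "r < W (entry w (i, j))" "s < H (entry w (i, j))"
        using Wc[OF w i(1) j(1)] Hc[OF w i(1) j(1)] i j by simp_all
      ultimately show ?thesis using EB[OF x(1)] x(4)[OF i(1) j(1)] by simp
    qed
    moreover have "snd ?w = restrict (snd ?w) (rect (fst ?w))"
      using inflate_mk[of W H E w] unfolding mk_word_def by (metis snd_conv)
    ultimately show "?w \<in> words B"
      unfolding words_def PiE_def rect_def
      by (intro CollectI IntI Pi_I) (clarify, simp, metis restrict_extensional)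
  qed
  fix u v assume u: "u \<in> language X" and v: "v \<in> language X"
  have ne: "0 < width u" "0 < height u" "0 < width v" "0 < height v"
    using u v by (auto simp: language_def nonempty_def)
  {
    assume "height u = height v \<and> hcat u v \<in> language X"
    then have hh: "height u = height v" and c: "hcat u v \<in> language X" by auto
    have "H (entry u (0, j)) = H (entry v (0, j))" if "j < height u" for j
    proof -
      have "H (entry (hcat u v) (width u, j)) = H (entry (hcat u v) (0, j))"
        using that ne by (intro Hc[OF c]) (auto simp: hcat_def)
      then show ?thesis using that ne by (simp add: hcat_def entry_mk_word)
    qed
    from inflate_hcat[OF ne(2) hh this ne(1)]
    show "height (inflate W H E u) = height (inflate W H E v)"
      "inflate W H E (hcat u v) = hcat (inflate W H E u) (inflate W H E v)" by auto
  }
  {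
    assume "width u = width v \<and> vcat u v \<in> language X"
    then have hh: "width u = width v" and c: "vcat u v \<in> language X" by auto
    have "W (entry u (i, 0)) = W (entry v (i, 0))" if "i < width u" for i
    proof -
      have "W (entry (vcat u v) (i, height u)) = W (entry (vcat u v) (i, 0))"
        using that ne by (intro Wc[OF c]) (auto simp: vcat_def)
      then show ?thesis using that ne by (simp add: vcat_def entry_mk_word)
    qed
    from inflate_vcat[OF ne(1) hh this ne(2)]
    show "width (inflate W H E u) = width (inflate W H E v)"
      "inflate W H E (vcat u v) = vcat (inflate W H E u) (inflate W H E v)" by auto
  }
next
  fix a assume "letter a \<in> language X"
  then obtain x p q where x: "x \<in> X" "entry (letter a) (0, 0) = x (p, q)"
    by (elim language_entries) (auto simp: letter_def)
  then have "a = x (p, q)" by (simp add: letter_def entry_mk_word)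
  then show "nonempty (inflate W H E (letter a))"
    using comp[OF x(1)] by (simp add: inflate_letter nonempty_def compatible_def)
qed

text \<open>The bridge from \<open>extend\<close>, a definite description, to the relation
  \<open>covers\<close>, with which all later arguments work. In the shifted image the block of the
  letter at the origin starts at \<open>- k\<close>, whence the values of \<open>P\<close> and
  \<open>Q\<close> at 0.\<close>

lemma shift_extend_inflate:
  assumes mor: "morphism_on X B (inflate W H E)" and x: "x \<in> X"
  shows "y = shift k (extend (inflate W H E) x) \<longleftrightarrow>
    (\<exists>P Q. covers W H E x P Q y \<and> P 0 = - fst k \<and> Q 0 = - snd k)"
proof
  let ?e = "extend (inflate W H E) x"
  note ex1 = juxtaposition_ex1[OF mor x]
  have J: "juxtaposition (inflate W H E) x z \<longleftrightarrow> (\<exists>P Q. covers W H E x P Q z \<and> P 0 = 0 \<and> Q 0 = 0)" for z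
    unfolding juxtaposition_def covers_def
    by (auto simp: inflate_letter entry_mk_word Let_def)
  {
    assume y: "y = shift k ?e"
    have "juxtaposition (inflate W H E) x ?e"
      unfolding extend_def by (rule theI'[OF ex1])
    then obtain P Q where PQ: "covers W H E x P Q ?e" "P 0 = 0" "Q 0 = 0"
      unfolding J by blast
    have "covers W H E x (\<lambda>m. P m - fst k) (\<lambda>n. Q n - snd k) y"
      using PQ(1) unfolding covers_def y shift_def by (auto simp: algebra_simps plus_prod_def)
    then show "\<exists>P Q. covers W H E x P Q y \<and> P 0 = - fst k \<and> Q 0 = - snd k"
      using PQ by (intro exI[of _ "\<lambda>m. P m - fst k"] exI[of _ "\<lambda>n. Q n - snd k"]) auto
  }
  {
    assume "\<exists>P Q. covers W H E x P Q y \<and> P 0 = - fst k \<and> Q 0 = - snd k"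
    then obtain P Q where PQ: "covers W H E x P Q y" "P 0 = - fst k" "Q 0 = - snd k" by blast
    have "covers W H E x (\<lambda>m. P m + fst k) (\<lambda>n. Q n + snd k) (shift (- k) y)"
      using PQ(1) unfolding covers_def shift_def by (auto simp: algebra_simps plus_prod_def)
    then have "juxtaposition (inflate W H E) x (shift (- k) y)"
      unfolding J using PQ by (intro exI[of _ "\<lambda>m. P m + fst k"] exI[of _ "\<lambda>n. Q n + snd k"]) auto
    then have "?e = shift (- k) y" unfolding extend_def using ex1 by (intro the1_equality)
    then show "y = shift k ?e" by (simp add: shift_def)
  }
qed

lemma covers_exist:
  assumes "compatible W H x"
  obtains P Q y where "covers W H E x P Q y" "P 0 = 0" "Q 0 = 0"
proof -
  \<comment> \<open>Languages are defined for arbitrary sets of configurations, so the singleton of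
    \<open>x\<close> will do.\<close>
  have "morphism_on {x} UNIV (inflate W H E)"
    using assms by (intro morphism_on_inflate) auto
  from shift_extend_inflate[OF this, of x "extend (inflate W H E) x" 0] show thesis
    using that by (auto simp: shift_def)
qed

section \<open>Enumerating the positions of cuts\<close>

lemma strict_mono_int:
  fixes P :: "int \<Rightarrow> int" assumes "\<And>m. P m < P (m + 1)" shows "strict_mono P"
proof (rule strict_monoI)
  fix a b :: int assume "a < b"
  then show "P a < P b"
    by (induction rule: int_gr_induct) (use assms order.strict_trans in blast)+
qed

lemma steps_cover:
  fixes P :: "int \<Rightarrow> int"
  assumes "\<And>m. P m < P (m + 1)"
  obtains m where "P m \<le> p" "p < P (m + 1)"
proof -
  have "\<exists>m i. i < nat (P (m + 1) - P m) \<and> p - P 0 = P m - P 0 + int i"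
    by (intro int_steps_cover[of "\<lambda>m. P m - P 0" "\<lambda>m. nat (P (m + 1) - P m)"])
       (use assms in \<open>auto simp: less_imp_le\<close>)
  then obtain m i where "i < nat (P (m + 1) - P m)" "p - P 0 = P m - P 0 + int i" by blast
  then show thesis by (intro that[of m]) auto
qed

text \<open>Bounded gaps give every integer a next and a previous element of \<open>S\<close>.
  Iterating these two maps from one element of \<open>S\<close> yields an enumeration by all
  integers.\<close>

lemma enumeration:
  fixes S :: "int set"
  assumes gap: "\<And>m. \<exists>i<N. m + int i \<in> S"
  shows "\<exists>P :: int \<Rightarrow> int. (\<forall>m. P m < P (m + 1)) \<and> range P = S"
proof -
  define nx where "nx p = p + 1 + int (LEAST d. p + 1 + int d \<in> S)" for p
  define pv where "pv p = p - 1 - int (LEAST d. p - 1 - int d \<in> S)" for p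
  have ex1: "\<exists>d. p + 1 + int d \<in> S" for p using gap[of "p + 1"] by blast
  have ex2: "\<exists>d. p - 1 - int d \<in> S" for p
  proof -
    \<comment> \<open>A window of length \<open>N\<close> that ends at \<open>p - 2\<close> turns
      the gap bound into an element to the left of \<open>p\<close>.\<close>
    obtain i where "i < N" "p - 1 - int N + int i \<in> S" using gap by blast
    then show ?thesis by (intro exI[of _ "N - i"]) (simp add: of_nat_diff algebra_simps)
  qed
  have nx: "nx p \<in> S" "p < nx p" for p
    using LeastI_ex[OF ex1] by (auto simp: nx_def)
  have pv: "pv p \<in> S" "pv p < p" for p
    using LeastI_ex[OF ex2] by (auto simp: pv_def)
  have nx_le: "nx p \<le> q" if "q \<in> S" "p < q" for p q
  proof -
    have "(LEAST d. p + 1 + int d \<in> S) \<le> nat (q - p - 1)" using that by (intro Least_le) simp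
    then show ?thesis using that by (simp add: nx_def)
  qed
  have pv_ge: "q \<le> pv p" if "q \<in> S" "q < p" for p q
  proof -
    have "(LEAST d. p - 1 - int d \<in> S) \<le> nat (p - q - 1)" using that by (intro Least_le) simp
    then show ?thesis using that by (simp add: pv_def)
  qed
  have nx_pv: "nx (pv q) = q" if "q \<in> S" for q
    using nx_le[OF that pv(2)] pv_ge[OF nx(1), of "pv q" q] nx(2)[of "pv q"] by force
  define P where "P m = (if 0 \<le> m then (nx ^^ nat m) (nx 0) else (pv ^^ nat (- m)) (nx 0))" for m
  have PS: "P m \<in> S" for m
  proof -
    have "(nx ^^ k) (nx 0) \<in> S" "(pv ^^ k) (nx 0) \<in> S" for k
      by (cases k; simp add: nx pv)+
    then show ?thesis by (simp add: P_def)
  qed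
  have P_step: "P (m + 1) = nx (P m)" for m
  proof (cases "0 \<le> m")
    case True
    then show ?thesis by (simp add: P_def nat_add_distrib)
  next
    case False
    then have "nat (- m) = Suc (nat (- (m + 1)))" by simp
    then have "P m = pv (P (m + 1))" using False by (auto simp: P_def)
    then show ?thesis using nx_pv[OF PS] by simp
  qed
  have lt: "P m < P (m + 1)" for m using nx P_step by simp
  have "S \<subseteq> range P"
  proof
    fix q assume q: "q \<in> S"
    obtain m where m: "P m \<le> q" "q < P (m + 1)" using steps_cover[of P, OF lt] by metis
    then have "q = P m" using nx_le[OF q, of "P m"] P_step by force
    then show "q \<in> range P" by simp
  qed
  then show ?thesis using PS lt by (intro exI[of _ P]) auto
qed

text \<open>Successive values of an increasing enumeration are successive elements of its range, so
  a single coincidence of values propagates in both directions.\<close>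

lemma enumeration_unique:
  fixes P P' :: "int \<Rightarrow> int"
  assumes P: "\<And>m. P m < P (m + 1)" and P': "\<And>m. P' m < P' (m + 1)" and r: "range P = range P'"
  obtains a where "\<And>m. P' m = P (m + a)"
proof -
  have sm: "strict_mono P" "strict_mono P'" using P P' by (auto intro: strict_mono_int)
  have "P' 0 \<in> range P" using r by simp
  then obtain a where a: "P' 0 = P a" by auto
  have "P' m = P (m + a)" for m
  proof (induction m rule: int_induct[where k = 0])
    case base then show ?case using a by simp
  next
    case (step1 m)
    obtain b where b: "P' (m + 1) = P b" using r by blast
    obtain c where c: "P (m + a + 1) = P' c" using r by (metis rangeI image_iff)
    have "P (m + a) < P b" using P'[of m] step1(2) b by simp
    then have "m + a < b" using strict_mono_less[OF sm(1)] by simp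
    then have 1: "P (m + a + 1) \<le> P' (m + 1)"
      using b strict_mono_less_eq[OF sm(1)] by simp
    have "P' m < P' c" using P[of "m + a"] step1(2) c by simp
    then have "m < c" using strict_mono_less[OF sm(2)] by simp
    then have "P' (m + 1) \<le> P (m + a + 1)"
      using c strict_mono_less_eq[OF sm(2)] by simp
    with 1 show ?case by (simp add: algebra_simps)
  next
    case (step2 m)
    obtain b where b: "P' (m - 1) = P b" using r by blast
    obtain c where c: "P (m + a - 1) = P' c" using r by (metis rangeI image_iff)
    have "P b < P (m + a)" using P'[of "m - 1"] step2(2) b by simp
    then have "b < m + a" using strict_mono_less[OF sm(1)] by simp
    then have 1: "P' (m - 1) \<le> P (m + a - 1)"
      using b strict_mono_less_eq[OF sm(1)] by simp
    have "P' c < P' m" using P[of "m + a - 1"] step2(2) c by simp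
    then have "c < m" using strict_mono_less[OF sm(2)] by simp
    then have "P (m + a - 1) \<le> P' (m - 1)"
      using c strict_mono_less_eq[OF sm(2)] by simp
    with 1 show ?case by (simp add: algebra_simps)
  qed
  then show thesis by (rule that)
qed

section \<open>Substitutions between Wang shifts\<close>

text \<open>Tilings written over indices, \<open>t\<close> giving the tile of an index. The indices
  can be chosen for convenience, such as a datatype suited to evaluation or a set of lists, while
  the Wang shifts keep natural numbers as colors.\<close>

definition tilings :: "('i \<Rightarrow> 'c tile) \<Rightarrow> 'i set \<Rightarrow> 'i config set" where
  "tilings t I = {u. (\<forall>p. u p \<in> I) \<and>
     (\<forall>m n. right_color (t (u (m, n))) = left_color (t (u (m + 1, n))) \<and>
            top_color (t (u (m, n))) = bottom_color (t (u (m, n + 1))))}"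

lemma tilingsD:
  assumes "u \<in> tilings t I"
  shows "u p \<in> I" "right_color (t (u (m, n))) = left_color (t (u (m + 1, n)))"
    "top_color (t (u (m, n))) = bottom_color (t (u (m, n + 1)))"
  using assms unfolding tilings_def by blast+

lemma wang_shift_eq_tilings: "wang_shift T = tilings id T"
  by (auto simp: wang_shift_def tilings_def plus_prod_def)

lemma wang_shift_image: "wang_shift (t ` I) = (\<lambda>u. t \<circ> u) ` tilings t I"
proof (intro equalityI subsetI)
  fix x assume x: "x \<in> wang_shift (t ` I)"
  then have "\<forall>p. \<exists>a\<in>I. x p = t a" unfolding wang_shift_def by blast
  then obtain u where u: "\<And>p. u p \<in> I" "\<And>p. x p = t (u p)" by metis
  then have "u \<in> tilings t I" using x by (auto simp: wang_shift_eq_tilings tilings_def)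
  moreover have "x = t \<circ> u" using u by auto
  ultimately show "x \<in> (\<lambda>u. t \<circ> u) ` tilings t I" by blast
qed (auto simp: wang_shift_eq_tilings tilings_def)

lemma shift_wang_shift: "x \<in> wang_shift T \<Longrightarrow> shift k x \<in> wang_shift T"
  unfolding wang_shift_eq_tilings tilings_def shift_def
  by (cases k) (simp add: algebra_simps)

lemma shift_shift [simp]: "shift k (shift l x) = shift (k + l) x"
  by (simp add: shift_def add.assoc)

lemma shift_0 [simp]: "shift 0 x = x"
  by (simp add: shift_def)

lemma covers_shift: "covers W H E x P Q y \<Longrightarrow>
   covers W H E x (\<lambda>m. P m - fst k) (\<lambda>n. Q n - snd k) (shift k y)"
  unfolding covers_def shift_def plus_prod_def by (auto simp: algebra_simps)

lemma coversD:
  assumes "covers W H E x P Q y"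
  shows "P (m + 1) = P m + int (W (x (m, n)))" "Q (n + 1) = Q n + int (H (x (m, n)))"
    "i < W (x (m, n)) \<Longrightarrow> j < H (x (m, n)) \<Longrightarrow> y (P m + int i, Q n + int j) = E (x (m, n)) i j"
  using assms by (auto simp: covers_def)

lemma covers_steps:
  assumes "covers W H E x P Q y" "compatible W H x"
  shows "P m < P (m + 1)" "Q n < Q (n + 1)"
proof -
  have "0 < W (x (m, 0))" "0 < H (x (0, n))" using assms(2) by (auto simp: compatible_def)
  moreover have "P (m + 1) = P m + int (W (x (m, 0)))" "Q (n + 1) = Q n + int (H (x (0, n)))"
    using assms(1) by (auto simp: covers_def)
  ultimately show "P m < P (m + 1)" "Q n < Q (n + 1)" by linarith+
qed

lemma covers_cell:
  assumes c: "covers W H E x P Q y" and comp: "compatible W H x"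
  obtains m :: int and n :: int and i j where "p = P m + int i" "q = Q n + int j" "i < W (x (m, n))" "j < H (x (m, n))"
    "y (p, q) = E (x (m, n)) i j"
proof -
  obtain m where m: "P m \<le> p" "p < P (m + 1)" using steps_cover covers_steps(1)[OF c comp] by metis
  obtain n where n: "Q n \<le> q" "q < Q (n + 1)" using steps_cover covers_steps(2)[OF c comp] by metis
  show thesis
    using m n coversD(1)[OF c, of m n] coversD(2)[OF c, of n m] coversD(3)[OF c, of "nat (p - P m)" m n "nat (q - Q n)"]
    by (intro that[of m "nat (p - P m)" n "nat (q - Q n)"]) auto
qed

lemma covers_in_range:
  assumes c: "covers W H E x P Q y" and comp: "compatible W H x"
  shows "i < W (x (m, n)) \<Longrightarrow> P m + int i \<in> range P \<longleftrightarrow> i = 0"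
    "j < H (x (m, n)) \<Longrightarrow> Q n + int j \<in> range Q \<longleftrightarrow> j = 0"
proof -
  have sm: "strict_mono P" "strict_mono Q"
    using covers_steps[OF c comp] by (auto intro: strict_mono_int)
  show "P m + int i \<in> range P \<longleftrightarrow> i = 0" if i: "i < W (x (m, n))"
  proof
    assume "P m + int i \<in> range P"
    then obtain m' where m': "P m + int i = P m'" by blast
    then have "P m \<le> P m'" "P m' < P (m + 1)" using coversD(1)[OF c, of m n] i by simp_all
    then have "m' = m" using strict_mono_less_eq[OF sm(1)] strict_mono_less[OF sm(1)] by fastforce
    then show "i = 0" using m' by simp
  qed simp
  show "Q n + int j \<in> range Q \<longleftrightarrow> j = 0" if j: "j < H (x (m, n))"
  proof
    assume "Q n + int j \<in> range Q"
    then obtain n' where n': "Q n + int j = Q n'" by blast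
    then have "Q n \<le> Q n'" "Q n' < Q (n + 1)" using coversD(2)[OF c, of n m] j by simp_all
    then have "n' = n" using strict_mono_less_eq[OF sm(2)] strict_mono_less[OF sm(2)] by fastforce
    then show "j = 0" using n' by simp
  qed simp
qed

lemma covers_next:
  assumes c: "covers W H E x P Q y" and comp: "compatible W H x" and ij: "i < W (x (m, n))" "j < H (x (m, n))"
  shows "y (P m + int i + 1, Q n + int j) = (if Suc i < W (x (m, n)) then E (x (m, n)) (Suc i) j else E (x (m + 1, n)) 0 j)"
    and "y (P m + int i, Q n + int j + 1) = (if Suc j < H (x (m, n)) then E (x (m, n)) i (Suc j) else E (x (m, n + 1)) i 0)"
proof -
  have W: "W (x (m, n + 1)) = W (x (m, n))" "H (x (m + 1, n)) = H (x (m, n))" "0 < W (x (m + 1, n))" "0 < H (x (m, n + 1))"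
    using comp by (auto simp: compatible_def)
  have "P m + int i + 1 = (if Suc i < W (x (m, n)) then P m + int (Suc i) else P (m + 1) + int 0)"
    "Q n + int j + 1 = (if Suc j < H (x (m, n)) then Q n + int (Suc j) else Q (n + 1) + int 0)"
    using ij coversD(1)[OF c, of m n] coversD(2)[OF c, of n m] by auto
  then show "y (P m + int i + 1, Q n + int j) = (if Suc i < W (x (m, n)) then E (x (m, n)) (Suc i) j else E (x (m + 1, n)) 0 j)"
    "y (P m + int i, Q n + int j + 1) = (if Suc j < H (x (m, n)) then E (x (m, n)) i (Suc j) else E (x (m, n + 1)) i 0)"
    using coversD(3)[OF c, of "Suc i" m n j] coversD(3)[OF c, of 0 "m + 1" n j]
      coversD(3)[OF c, of i m n "Suc j"] coversD(3)[OF c, of i m "n + 1" 0] ij W by (simp_all split: if_splits)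
qed

text \<open>Equal ranges mean equal lines, and these are enumerated uniquely up to a translation of
  the index. Corresponding blocks then fill the same rectangle of \<open>y\<close>, from which
  \<open>inj\<close> recovers the letters.\<close>

lemma covers_translate:
  assumes c: "covers W H E x P Q y" "compatible W H x" and c': "covers W H E x' P' Q' y" "compatible W H x'"
    and r: "range P = range P'" "range Q = range Q'"
    and inj: "\<And>p q. W (x' p) = W (x q) \<Longrightarrow> H (x' p) = H (x q) \<Longrightarrow>
      \<forall>i<W (x' p). \<forall>j<H (x' p). E (x' p) i j = E (x q) i j \<Longrightarrow> x' p = x q"
  obtains a b :: int where "\<And>m. P' m = P (m + a)" "\<And>n. Q' n = Q (n + b)" "x' = shift (a, b) x"
proof -
  obtain a b where ab: "\<And>m. P' m = P (m + a)" "\<And>n. Q' n = Q (n + b)"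
    using enumeration_unique[of P P'] enumeration_unique[of Q Q'] covers_steps[OF c] covers_steps[OF c'] r by metis
  have "x' (m, n) = x (m + a, n + b)" for m n
  proof (rule inj)
    show W: "W (x' (m, n)) = W (x (m + a, n + b))"
      using coversD(1)[OF c(1), of "m + a" "n + b"] coversD(1)[OF c'(1), of m n] ab
      by (simp add: add.assoc add.commute[of 1])
    show H: "H (x' (m, n)) = H (x (m + a, n + b))"
      using coversD(2)[OF c(1), of "n + b" "m + a"] coversD(2)[OF c'(1), of n m] ab
      by (simp add: add.assoc add.commute[of 1])
    show "\<forall>i<W (x' (m, n)). \<forall>j<H (x' (m, n)). E (x' (m, n)) i j = E (x (m + a, n + b)) i j"
      using coversD(3)[OF c(1), of _ "m + a" "n + b"] coversD(3)[OF c'(1), of _ m n] ab W H by simp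
  qed
  then have "x' = shift (a, b) x" by (auto simp: shift_def plus_prod_def)
  with ab show thesis by (rule that)
qed

text \<open>\<open>V\<close> and \<open>K\<close> mark the tiles in the first column and in the
  first row of a block. By \<open>V_inv\<close> and \<open>K_inv\<close> the marks spread along
  entire columns and rows, so the cuts are full lines. The outer conditions are equivalences because
  they are used both ways: to see that images of tilings are tilings, and that desubstituted
  configurations are. The gap and block conditions are stated at the origin and get applied to all
  shifts of a tiling.\<close>

locale wang_substitution =
  fixes I :: "'i set" and t :: "'i \<Rightarrow> 'c tile" and T :: "'d tile set"
    and W H :: "'i \<Rightarrow> nat" and E :: "'i \<Rightarrow> nat \<Rightarrow> nat \<Rightarrow> 'd tile"
    and V K :: "'d tile \<Rightarrow> bool" and N :: nat
  assumes inj: "inj_on t I"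
    and pos: "a \<in> I \<Longrightarrow> 0 < W a" "a \<in> I \<Longrightarrow> 0 < H a"
    and E_in: "a \<in> I \<Longrightarrow> i < W a \<Longrightarrow> j < H a \<Longrightarrow> E a i j \<in> T"
    and inner_h: "a \<in> I \<Longrightarrow> Suc i < W a \<Longrightarrow> j < H a \<Longrightarrow> right_color (E a i j) = left_color (E a (Suc i) j)"
    and inner_v: "a \<in> I \<Longrightarrow> i < W a \<Longrightarrow> Suc j < H a \<Longrightarrow> top_color (E a i j) = bottom_color (E a i (Suc j))"
    and outer_h: "a \<in> I \<Longrightarrow> b \<in> I \<Longrightarrow> right_color (t a) = left_color (t b) \<longleftrightarrow>
      H a = H b \<and> (\<forall>j<H a. right_color (E a (W a - 1) j) = left_color (E b 0 j))"
    and outer_v: "a \<in> I \<Longrightarrow> b \<in> I \<Longrightarrow> top_color (t a) = bottom_color (t b) \<longleftrightarrow>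
      W a = W b \<and> (\<forall>i<W a. top_color (E a i (H a - 1)) = bottom_color (E b i 0))"
    and V_inv: "r \<in> T \<Longrightarrow> s \<in> T \<Longrightarrow> top_color r = bottom_color s \<Longrightarrow> V r = V s"
    and K_inv: "r \<in> T \<Longrightarrow> s \<in> T \<Longrightarrow> right_color r = left_color s \<Longrightarrow> K r = K s"
    and V_E: "a \<in> I \<Longrightarrow> i < W a \<Longrightarrow> j < H a \<Longrightarrow> V (E a i j) \<longleftrightarrow> i = 0"
    and K_E: "a \<in> I \<Longrightarrow> i < W a \<Longrightarrow> j < H a \<Longrightarrow> K (E a i j) \<longleftrightarrow> j = 0"
    and V_gap: "y \<in> wang_shift T \<Longrightarrow> \<exists>i<N. V (y (int i, 0))"
    and K_gap: "y \<in> wang_shift T \<Longrightarrow> \<exists>j<N. K (y (0, int j))"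
    and block: "y \<in> wang_shift T \<Longrightarrow> 0 < w \<Longrightarrow> 0 < h \<Longrightarrow>
      \<forall>i<w. V (y (int i, 0)) \<longleftrightarrow> i = 0 \<Longrightarrow> V (y (int w, 0)) \<Longrightarrow>
      \<forall>j<h. K (y (0, int j)) \<longleftrightarrow> j = 0 \<Longrightarrow> K (y (0, int h)) \<Longrightarrow>
      \<exists>a\<in>I. W a = w \<and> H a = h \<and> (\<forall>i<w. \<forall>j<h. y (int i, int j) = E a i j)"
    and E_inj: "a \<in> I \<Longrightarrow> b \<in> I \<Longrightarrow> W a = W b \<Longrightarrow> H a = H b \<Longrightarrow>
      \<forall>i<W a. \<forall>j<H a. E a i j = E b i j \<Longrightarrow> a = b"
begin

lemma tilings_compatible: "u \<in> tilings t I \<Longrightarrow> compatible W H u"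
  unfolding compatible_def by (metis tilingsD outer_h outer_v pos)

lemma V_const:
  assumes "y \<in> wang_shift T" shows "V (y (m, n)) = V (y (m, 0))"
proof (rule int_const[of "\<lambda>n. V (y (m, n))"])
  fix n show "V (y (m, n + 1)) = V (y (m, n))"
    using V_inv[of "y (m, n)" "y (m, n + 1)"] tilingsD[of y id T] assms by (simp add: wang_shift_eq_tilings)
qed

lemma K_const:
  assumes "y \<in> wang_shift T" shows "K (y (m, n)) = K (y (0, n))"
proof (rule int_const[of "\<lambda>m. K (y (m, n))"])
  fix m show "K (y (m + 1, n)) = K (y (m, n))"
    using K_inv[of "y (m, n)" "y (m + 1, n)"] tilingsD[of y id T] assms by (simp add: wang_shift_eq_tilings)
qed

lemma desubstitute:
  assumes y: "y \<in> wang_shift T"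
  obtains u and P Q :: "int \<Rightarrow> int" where "u \<in> tilings t I" "covers W H E u P Q y"
proof -
  have gapV: "\<exists>i<N. m + int i \<in> {m. V (y (m, 0))}" for m
    using V_gap[OF shift_wang_shift[OF y], of "(m, 0)"] by (simp add: shift_def plus_prod_def add.commute)
  obtain P :: "int \<Rightarrow> int" where P: "\<And>m. P m < P (m + 1)" "range P = {m. V (y (m, 0))}"
    using enumeration[OF gapV] by blast
  have gapK: "\<exists>i<N. m + int i \<in> {n. K (y (0, n))}" for m
    using K_gap[OF shift_wang_shift[OF y], of "(0, m)"] by (simp add: shift_def plus_prod_def add.commute)
  obtain Q :: "int \<Rightarrow> int" where Q: "\<And>m. Q m < Q (m + 1)" "range Q = {n. K (y (0, n))}"
    using enumeration[OF gapK] by blast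
  define w where "w m = nat (P (m + 1) - P m)" for m
  define h where "h n = nat (Q (n + 1) - Q n)" for n
  have w: "P (m + 1) = P m + int (w m)" "0 < w m" for m using P(1)[of m] by (auto simp: w_def)
  have h: "Q (n + 1) = Q n + int (h n)" "0 < h n" for n using Q(1)[of n] by (auto simp: h_def)
  have V: "V (y (p, q)) \<longleftrightarrow> p \<in> range P" for p q using V_const[OF y, of p q] P(2) by auto
  have K: "K (y (p, q)) \<longleftrightarrow> q \<in> range Q" for p q using K_const[OF y, of p q] Q(2) by auto
  have Pi: "P m + int i \<in> range P \<longleftrightarrow> i = 0" if "i < w m" for m i
  proof
    assume "P m + int i \<in> range P"
    then obtain m' where m': "P m + int i = P m' + int 0" by auto
    show "i = 0" using int_steps_disjoint[of P w i m 0 m', OF w(1) that w(2) m'] by simp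
  qed simp
  have Qi: "Q m + int i \<in> range Q \<longleftrightarrow> i = 0" if "i < h m" for m i
  proof
    assume "Q m + int i \<in> range Q"
    then obtain m' where m': "Q m + int i = Q m' + int 0" by auto
    show "i = 0" using int_steps_disjoint[of Q h i m 0 m', OF h(1) that h(2) m'] by simp
  qed simp
  \<comment> \<open>The block condition is applied to the shift of \<open>y\<close> that moves the
    corner of block \<open>(m, n)\<close> to the origin.\<close>
  have "\<exists>a\<in>I. W a = w m \<and> H a = h n \<and> (\<forall>i<w m. \<forall>j<h n. y (P m + int i, Q n + int j) = E a i j)" for m n
    using block[OF shift_wang_shift[OF y, of "(P m, Q n)"] w(2)[of m] h(2)[of n]]
    by (simp add: shift_def plus_prod_def add.commute[of _ "P m"] add.commute[of _ "Q n"] V K Pi Qi flip: w(1) h(1))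
  then obtain u' where u': "\<And>m n. u' m n \<in> I \<and> W (u' m n) = w m \<and> H (u' m n) = h n \<and>
      (\<forall>i<w m. \<forall>j<h n. y (P m + int i, Q n + int j) = E (u' m n) i j)" by metis
  define u where "u = (\<lambda>(m, n). u' m n)"
  have u: "u (m, n) \<in> I" "W (u (m, n)) = w m" "H (u (m, n)) = h n"
    "i < w m \<Longrightarrow> j < h n \<Longrightarrow> E (u (m, n)) i j = y (P m + int i, Q n + int j)" for m n i j
    using u'[of m n] by (auto simp: u_def)
  have cov: "covers W H E u P Q y" unfolding covers_def by (simp add: u w h)
  note yD = tilingsD[of y id T, folded wang_shift_eq_tilings, OF y, simplified]
  have "u \<in> tilings t I" unfolding tilings_def
  proof (intro CollectI conjI allI)
    fix m n
    show "right_color (t (u (m, n))) = left_color (t (u (m + 1, n)))"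
    proof (subst outer_h; (intro conjI allI impI)?)
      fix j assume "j < H (u (m, n))"
      then have "E (u (m, n)) (W (u (m, n)) - 1) j = y (P m + int (w m - 1), Q n + int j)"
        "E (u (m + 1, n)) 0 j = y (P (m + 1), Q n + int j)"
        using u(4)[of "w m - 1" m j n] u(4)[of 0 "m + 1" j n] w(2)[of m] w(2)[of "m + 1"] by (simp_all add: u)
      moreover have "P m + int (w m - 1) + 1 = P (m + 1)" using w[of m] by simp
      ultimately show "right_color (E (u (m, n)) (W (u (m, n)) - 1) j) = left_color (E (u (m + 1, n)) 0 j)"
        using yD(2)[of "P m + int (w m - 1)" "Q n + int j"] by simp
    qed (use u in auto)
    show "top_color (t (u (m, n))) = bottom_color (t (u (m, n + 1)))"
    proof (subst outer_v; (intro conjI allI impI)?)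
      fix i assume "i < W (u (m, n))"
      then have "E (u (m, n)) i (H (u (m, n)) - 1) = y (P m + int i, Q n + int (h n - 1))"
        "E (u (m, n + 1)) i 0 = y (P m + int i, Q (n + 1))"
        using u(4)[of i m "h n - 1" n] u(4)[of i m 0 "n + 1"] h(2)[of n] h(2)[of "n + 1"] by (simp_all add: u)
      moreover have "Q n + int (h n - 1) + 1 = Q (n + 1)" using h[of n] by simp
      ultimately show "top_color (E (u (m, n)) i (H (u (m, n)) - 1)) = bottom_color (E (u (m, n + 1)) i 0)"
        using yD(3)[of "P m + int i" "Q n + int (h n - 1)"] by simp
    qed (use u in auto)
  qed (use u in auto)
  with cov show thesis by (rule that[rotated])
qed

lemma substitute:
  assumes u: "u \<in> tilings t I" and c: "covers W H E u P Q y"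
  shows "y \<in> wang_shift T"
  unfolding wang_shift_eq_tilings tilings_def id_apply
proof (intro CollectI conjI allI)
  note comp = tilings_compatible[OF u]
  note uD = tilingsD[OF u]
  { fix p show "y p \<in> T"
      using covers_cell[OF c comp, of "fst p" "snd p"] E_in uD(1) by (metis prod.collapse) }
  fix p q
  obtain m n i j where *: "p = P m + int i" "q = Q n + int j" "i < W (u (m, n))" "j < H (u (m, n))"
    "y (p, q) = E (u (m, n)) i j" using covers_cell[OF c comp] by metis
  show "right_color (y (p, q)) = left_color (y (p + 1, q))"
  proof (cases "Suc i < W (u (m, n))")
    case True
    then show ?thesis using covers_next(1)[OF c comp *(3,4)] inner_h[OF uD(1) True *(4)] * by simp
  next
    case False
    then have i: "i = W (u (m, n)) - 1" using *(3) by simp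
    have "right_color (E (u (m, n)) i j) = left_color (E (u (m + 1, n)) 0 j)"
      using uD(2)[of m n] outer_h[OF uD(1) uD(1), of "(m, n)" "(m + 1, n)"] *(4) unfolding i by blast
    then show ?thesis using covers_next(1)[OF c comp *(3,4)] False * by simp
  qed
  show "top_color (y (p, q)) = bottom_color (y (p, q + 1))"
  proof (cases "Suc j < H (u (m, n))")
    case True
    then show ?thesis using covers_next(2)[OF c comp *(3,4)] inner_v[OF uD(1) *(3) True] * by simp
  next
    case False
    then have j: "j = H (u (m, n)) - 1" using *(4) by simp
    have "top_color (E (u (m, n)) i j) = bottom_color (E (u (m, n + 1)) i 0)"
      using uD(3)[of m n] outer_v[OF uD(1) uD(1), of "(m, n)" "(m, n + 1)"] *(3) unfolding j by blast
    then show ?thesis using covers_next(2)[OF c comp *(3,4)] False * by simp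
  qed
qed

lemma range_covers:
  assumes u: "u \<in> tilings t I" and c: "covers W H E u P Q y"
  shows "range P = {p. V (y (p, q))}" "range Q = {q. K (y (p, q))}"
proof -
  note comp = tilings_compatible[OF u]
  have "V (y (p, q)) \<longleftrightarrow> p \<in> range P" "K (y (p, q)) \<longleftrightarrow> q \<in> range Q" for p q
  proof -
    obtain m n i j where *: "p = P m + int i" "q = Q n + int j" "i < W (u (m, n))" "j < H (u (m, n))"
      "y (p, q) = E (u (m, n)) i j" using covers_cell[OF c comp] by metis
    show "V (y (p, q)) \<longleftrightarrow> p \<in> range P" "K (y (p, q)) \<longleftrightarrow> q \<in> range Q"
      unfolding *(1,2) covers_in_range(1)[OF c comp *(3)] covers_in_range(2)[OF c comp *(4)]
      using V_E K_E tilingsD(1)[OF u] * by simp_all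
  qed
  then show "range P = {p. V (y (p, q))}" "range Q = {q. K (y (p, q))}" by auto
qed

text \<open>By \<open>range_covers\<close> the lines of any covering are visible in \<open>y\<close>
  through \<open>V\<close> and \<open>K\<close>, so two coverings share them.\<close>

lemma covers_unique:
  assumes u: "u \<in> tilings t I" and c: "covers W H E u P Q y"
    and u': "u' \<in> tilings t I" and c': "covers W H E u' P' Q' y"
  obtains a b :: int where "\<And>m. P' m = P (m + a)" "\<And>n. Q' n = Q (n + b)" "u' = shift (a, b) u"
proof (rule covers_translate[OF c tilings_compatible[OF u] c' tilings_compatible[OF u']])
  show "range P = range P'" "range Q = range Q'"
    using range_covers[OF u c, of 0] range_covers[OF u' c', of 0] by simp_all
qed (use E_inj tilingsD(1)[OF u] tilingsD(1)[OF u'] in blast)+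

definition expand :: "'c tile word2 \<Rightarrow> 'd tile word2" where
  "expand = inflate (W \<circ> inv_into I t) (H \<circ> inv_into I t) (E \<circ> inv_into I t)"

lemma covers_tiles:
  assumes "u \<in> tilings t I"
  shows "covers (W \<circ> inv_into I t) (H \<circ> inv_into I t) (E \<circ> inv_into I t) (t \<circ> u) P Q y
    \<longleftrightarrow> covers W H E u P Q y"
  using tilingsD(1)[OF assms] inj by (simp add: covers_def)

lemma morphism_on_expand: "morphism_on (wang_shift (t ` I)) T expand"
  unfolding expand_def
proof (rule morphism_on_inflate)
  fix x assume "x \<in> wang_shift (t ` I)"
  then obtain u where u: "u \<in> tilings t I" "x = t \<circ> u" by (auto simp: wang_shift_image)
  show "compatible (W \<circ> inv_into I t) (H \<circ> inv_into I t) x"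
    using tilings_compatible[OF u(1)] tilingsD(1)[OF u(1)] inj by (simp add: u compatible_def)
  show "(E \<circ> inv_into I t) (x p) i j \<in> T"
    if "i < (W \<circ> inv_into I t) (x p)" "j < (H \<circ> inv_into I t) (x p)" for p i j
    using that tilingsD(1)[OF u(1)] inj by (simp add: u E_in)
qed

lemma shift_extend_expand:
  assumes "u \<in> tilings t I"
  shows "y = shift k (extend expand (t \<circ> u)) \<longleftrightarrow>
    (\<exists>P Q. covers W H E u P Q y \<and> P 0 = - fst k \<and> Q 0 = - snd k)"
  using assms shift_extend_inflate[OF morphism_on_expand[unfolded expand_def], of "t \<circ> u" y k]
  by (auto simp: covers_tiles[OF assms] expand_def[symmetric] wang_shift_image)

lemma recognizable_expand: "recognizable (wang_shift (t ` I)) expand"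
  unfolding recognizable_def
proof (intro allI Uniq_I)
  fix y :: "'d tile config" and kx lx' :: "(int \<times> int) \<times> 'c tile config"
  obtain k1 k2 x where kx: "kx = ((k1, k2), x)" by (metis prod.collapse)
  obtain l1 l2 x' where lx': "lx' = ((l1, l2), x')" by (metis prod.collapse)
  assume "case kx of (k, x) \<Rightarrow> x \<in> wang_shift (t ` I) \<and> y = shift k (extend expand x) \<and>
     0 \<le> fst k \<and> fst k < int (width (expand (letter (x 0)))) \<and>
     0 \<le> snd k \<and> snd k < int (height (expand (letter (x 0))))"
  then have x: "x \<in> wang_shift (t ` I)" and y: "y = shift (k1, k2) (extend expand x)"
    and k: "0 \<le> k1" "k1 < int (width (expand (letter (x 0))))"
      "0 \<le> k2" "k2 < int (height (expand (letter (x 0))))" by (auto simp: kx)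
  assume "case lx' of (k, x) \<Rightarrow> x \<in> wang_shift (t ` I) \<and> y = shift k (extend expand x) \<and>
     0 \<le> fst k \<and> fst k < int (width (expand (letter (x 0)))) \<and>
     0 \<le> snd k \<and> snd k < int (height (expand (letter (x 0))))"
  then have x': "x' \<in> wang_shift (t ` I)" and y': "y = shift (l1, l2) (extend expand x')"
    and l: "0 \<le> l1" "l1 < int (width (expand (letter (x' 0))))"
      "0 \<le> l2" "l2 < int (height (expand (letter (x' 0))))" by (auto simp: lx')
  obtain u where u: "u \<in> tilings t I" "x = t \<circ> u" using x by (auto simp: wang_shift_image)
  obtain u' where u': "u' \<in> tilings t I" "x' = t \<circ> u'" using x' by (auto simp: wang_shift_image)
  obtain P Q where c: "covers W H E u P Q y" "P 0 = - k1" "Q 0 = - k2"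
    using shift_extend_expand[OF u(1), of y "(k1, k2)"] y u by auto
  obtain P' Q' where c': "covers W H E u' P' Q' y" "P' 0 = - l1" "Q' 0 = - l2"
    using shift_extend_expand[OF u'(1), of y "(l1, l2)"] y' u' by auto
  obtain a b where ab: "\<And>m. P' m = P (m + a)" "\<And>n. Q' n = Q (n + b)" "u' = shift (a, b) u"
    using covers_unique[OF u(1) c(1) u'(1) c'(1)] by metis
  have W: "width (expand (letter (x 0))) = W (u (0, 0))" "height (expand (letter (x 0))) = H (u (0, 0))"
    "width (expand (letter (x' 0))) = W (u' (0, 0))" "height (expand (letter (x' 0))) = H (u' (0, 0))"
    using tilingsD(1)[OF u(1)] tilingsD(1)[OF u'(1)] inj
    by (simp_all add: expand_def inflate_letter u u' zero_prod_def)
  have "strict_mono P" "strict_mono Q"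
    using covers_steps[OF c(1) tilings_compatible[OF u(1)]] by (auto intro: strict_mono_int)
  note sm = this[THEN strict_mono_less]
  have "P (a + 1) = P' (0 + 1)" "Q (b + 1) = Q' (0 + 1)" by (simp_all add: ab add.commute)
  \<comment> \<open>The bounds on the two shifts say that the origin lies in the block with index 0
    of either covering. Among the blocks of \<open>u\<close> these have indices
    \<open>(0, 0)\<close> and \<open>(a, b)\<close>; they overlap and hence coincide.\<close>
  then have "P 0 < P (a + 1)" "P a < P (0 + 1)" "Q 0 < Q (b + 1)" "Q b < Q (0 + 1)"
    using coversD(1)[OF c(1), of 0 0] coversD(1)[OF c'(1), of 0 0] coversD(2)[OF c(1), of 0 0]
      coversD(2)[OF c'(1), of 0 0] k l c c' ab(1)[of 0] ab(2)[of 0] unfolding W by simp_all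
  then have "a = 0" "b = 0" unfolding sm by simp_all
  then have "u' = u" "P' 0 = P 0" "Q' 0 = Q 0" using ab by (simp_all add: shift_def zero_prod_def[symmetric])
  then show "lx' = kx" using c c' u u' by (simp add: kx lx')
qed

lemma onto_expand: "onto_up_to_shift (wang_shift (t ` I)) (wang_shift T) expand"
  unfolding onto_up_to_shift_def shift_closure_def
proof (intro equalityI subsetI)
  fix y assume "y \<in> (\<Union>k. shift k ` extend expand ` wang_shift (t ` I))"
  then obtain k u where "u \<in> tilings t I" "y = shift k (extend expand (t \<circ> u))"
    by (auto simp: wang_shift_image)
  then show "y \<in> wang_shift T" using shift_extend_expand substitute by metis
next
  fix y assume "y \<in> wang_shift T"
  then obtain u P Q where u: "u \<in> tilings t I" "covers W H E u P Q y" by (rule desubstitute)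
  then have "y = shift (- P 0, - Q 0) (extend expand (t \<circ> u))"
    using shift_extend_expand[OF u(1), of y "(- P 0, - Q 0)"] by auto
  then show "y \<in> (\<Union>k. shift k ` extend expand ` wang_shift (t ` I))"
    using u(1) unfolding wang_shift_image by blast
qed

lemma extend_expand: "extend expand \<in> wang_shift (t ` I) \<rightarrow> wang_shift T"
proof
  fix x assume "x \<in> wang_shift (t ` I)"
  then obtain u where u: "u \<in> tilings t I" "x = t \<circ> u" by (auto simp: wang_shift_image)
  then have "extend expand x = shift 0 (extend expand (t \<circ> u))" by simp
  then obtain P Q where "covers W H E u P Q (extend expand x)"
    using shift_extend_expand[OF u(1)] by blast
  then show "extend expand x \<in> wang_shift T" by (rule substitute[OF u(1)])
qed

end

section \<open>Topology of Wang shifts\<close>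

text \<open>Cylinders over finite sets of positions form a base of the product topology.\<close>

lemma openin_config_iff: "openin config_topology S \<longleftrightarrow>
   (\<forall>x\<in>S. \<exists>D. finite D \<and> (\<forall>y. (\<forall>q\<in>D. y q = x q) \<longrightarrow> y \<in> S))"
  (is "?L \<longleftrightarrow> ?R")
proof
  assume ?L
  show ?R
  proof
    fix x assume "x \<in> S"
    then obtain U where U: "finite {i. U i \<noteq> UNIV}" "x \<in> PiE UNIV U" "PiE UNIV U \<subseteq> S"
      using \<open>?L\<close> unfolding config_topology_def openin_product_topology_alt by auto
    have "y \<in> S" if "\<forall>q\<in>{i. U i \<noteq> UNIV}. y q = x q" for y
    proof -
      have "y i \<in> U i" for i
      proof (cases "U i = UNIV")
        case False
        then have "y i = x i" using that by blast
        then show ?thesis using U(2) by (metis PiE_mem UNIV_I)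
      qed simp
      then show ?thesis using U(3) by (auto simp: PiE_UNIV_domain)
    qed
    with U(1) show "\<exists>D. finite D \<and> (\<forall>y. (\<forall>q\<in>D. y q = x q) \<longrightarrow> y \<in> S)" by blast
  qed
next
  assume R: ?R
  have "\<exists>U. finite {i. U i \<noteq> UNIV} \<and> x \<in> Pi UNIV U \<and> Pi UNIV U \<subseteq> S" if x: "x \<in> S" for x
  proof -
    obtain D where D: "finite D" "\<forall>y. (\<forall>q\<in>D. y q = x q) \<longrightarrow> y \<in> S"
      using bspec[OF R x] by (elim exE conjE)
    have "finite {i. (if i \<in> D then {x i} else UNIV) \<noteq> UNIV}"
      by (rule finite_subset[OF _ D(1)]) auto
    moreover have "Pi UNIV (\<lambda>i. if i \<in> D then {x i} else UNIV) \<subseteq> S"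
    proof
      fix y assume y: "y \<in> Pi UNIV (\<lambda>i. if i \<in> D then {x i} else UNIV)"
      have "y q = x q" if "q \<in> D" for q using Pi_mem[OF y, of q] that by simp
      then show "y \<in> S" by (intro D(2)[THEN spec, THEN mp] ballI)
    qed
    ultimately show ?thesis
      by (intro exI[of _ "\<lambda>i. if i \<in> D then {x i} else UNIV"]) auto
  qed
  then show ?L unfolding config_topology_def openin_product_topology_alt
    by (auto simp: PiE_UNIV_domain)
qed

lemma topspace_config [simp]: "topspace config_topology = UNIV"
  by (simp add: config_topology_def PiE_UNIV_domain)

lemma Hausdorff_config: "Hausdorff_space config_topology"
  by (simp add: config_topology_def Hausdorff_space_product_topology)

lemma closedin_local:
  assumes "finite D" "\<And>x y. \<forall>q\<in>D. x q = y q \<Longrightarrow> x \<in> S \<Longrightarrow> y \<in> S"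
  shows "closedin config_topology S"
proof -
  have "openin config_topology (- S)"
    unfolding openin_config_iff
  proof
    fix x assume "x \<in> - S"
    then have "\<forall>y. (\<forall>q\<in>D. y q = x q) \<longrightarrow> y \<in> - S" using assms(2) by (metis ComplD ComplI)
    with assms(1) show "\<exists>D. finite D \<and> (\<forall>y. (\<forall>q\<in>D. y q = x q) \<longrightarrow> y \<in> - S)" by blast
  qed
  then show ?thesis by (simp add: closedin_def Compl_eq_Diff_UNIV)
qed

definition fits_at :: "'c tile config \<Rightarrow> int \<times> int \<Rightarrow> bool" where
  "fits_at x p \<longleftrightarrow> right_color (x p) = left_color (x (p + (1, 0))) \<and> top_color (x p) = bottom_color (x (p + (0, 1)))"

lemma wang_shift_inter: "wang_shift T = PiE UNIV (\<lambda>_. T) \<inter> (\<Inter>p. {x. fits_at x p})"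
proof (rule set_eqI)
  fix x
  show "x \<in> wang_shift T \<longleftrightarrow> x \<in> PiE UNIV (\<lambda>_. T) \<inter> (\<Inter>p. {x. fits_at x p})"
    unfolding wang_shift_def fits_at_def PiE_UNIV_domain mem_Collect_eq Int_iff INT_iff Pi_iff image_subset_iff
    by blast
qed

lemma closedin_fits_at: "closedin config_topology {x. fits_at x p}"
proof (rule closedin_local[of "{p, p + (1, 0), p + (0, 1)}"])
  fix x y :: "'a tile config"
  assume "\<forall>q\<in>{p, p + (1, 0), p + (0, 1)}. x q = y q"
  then have "y p = x p" "y (p + (1, 0)) = x (p + (1, 0))" "y (p + (0, 1)) = x (p + (0, 1))"
    by (simp_all only: insert_iff ball_simps)
  then show "x \<in> {x. fits_at x p} \<Longrightarrow> y \<in> {x. fits_at x p}"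
    by (simp only: mem_Collect_eq fits_at_def)
qed simp

lemma closedin_wang_shift: "closedin config_topology (wang_shift T)"
  unfolding wang_shift_inter
proof (intro closedin_Int closedin_INT)
  show "closedin config_topology (PiE UNIV (\<lambda>_. T))"
    unfolding config_topology_def by (simp add: closedin_product_topology)
qed (rule UNIV_not_empty closedin_fits_at)+

lemma compactin_PiE_config: "finite T \<Longrightarrow> compactin config_topology (PiE UNIV (\<lambda>_. T))"
  unfolding config_topology_def by (simp add: compactin_PiE compactin_discrete_topology)

lemma compactin_wang_shift: "finite T \<Longrightarrow> compactin config_topology (wang_shift T)"
  by (rule closed_compactin[OF compactin_PiE_config _ closedin_wang_shift]) (auto simp: wang_shift_inter)

text \<open>Compactness: the matching rule at each position is a closed condition on the compact
  space of configurations over \<open>T\<close>. The configuration supplied for \<open>F\<close> may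
  violate the rules outside \<open>F\<close>, so it can be one with invalid seams far away.\<close>

lemma wang_shift_nonempty:
  fixes T :: "'c tile set"
  assumes "finite T"
    and "\<And>F :: (int \<times> int) set. finite F \<Longrightarrow> \<exists>x. range x \<subseteq> T \<and> (\<forall>p\<in>F. fits_at x p)"
  shows "wang_shift T \<noteq> {}"
proof -
  let ?C = "\<lambda>p. {x :: 'c tile config. fits_at x p}"
  have fip: "\<forall>\<F>. finite \<F> \<and> \<F> \<subseteq> range ?C \<longrightarrow> PiE UNIV (\<lambda>_. T) \<inter> \<Inter>\<F> \<noteq> {}"
  proof (intro allI impI, elim conjE)
    fix \<F> assume F: "finite \<F>" "\<F> \<subseteq> range ?C"
    obtain F :: "(int \<times> int) set" where "finite F" "\<F> = ?C ` F" using finite_subset_image[OF F] by blast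
    moreover obtain x where "range x \<subseteq> T" "\<forall>p\<in>F. x \<in> ?C p" using assms(2)[OF \<open>finite F\<close>] by blast
    ultimately have "x \<in> PiE UNIV (\<lambda>_. T) \<inter> \<Inter>\<F>" by (auto simp: PiE_UNIV_domain)
    then show "PiE UNIV (\<lambda>_. T) \<inter> \<Inter>\<F> \<noteq> {}" by blast
  qed
  have closed: "\<forall>C\<in>range ?C. closedin config_topology C" using closedin_fits_at by blast
  have "PiE UNIV (\<lambda>_. T) \<inter> \<Inter>(range ?C) \<noteq> {}"
    by (rule compactin_PiE_config[OF assms(1), unfolded compactin_fip, THEN conjunct2, THEN spec, THEN mp,
        OF conjI[OF closed fip]])
  then show ?thesis unfolding wang_shift_inter .
qed

lemma subshift_wang_shift: "subshift (wang_shift T)"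
  unfolding subshift_def
proof (intro conjI allI closedin_wang_shift equalityI subsetI)
  fix n x assume x: "x \<in> wang_shift T"
  have "x = shift n (shift (- n) x)" by simp
  then show "x \<in> shift n ` wang_shift T" using shift_wang_shift[OF x] by blast
qed (auto intro: shift_wang_shift)

lemma continuous_map_local:
  fixes f :: "'a config \<Rightarrow> 'b config"
  assumes "f \<in> X \<rightarrow> Y"
    and "\<And>p. \<exists>D. finite D \<and> (\<forall>x y. (\<forall>q\<in>D. x q = y q) \<longrightarrow> f x p = f y p)"
  shows "continuous_map (subtopology config_topology X) (subtopology config_topology Y) f"
proof (intro continuous_map_into_subtopology continuous_map_from_subtopology)
  have "continuous_map config_topology (discrete_topology UNIV) (\<lambda>x. f x p)" for p
    unfolding continuous_map_def
  proof (intro conjI allI impI)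
    fix U :: "'b set"
    obtain D where "finite D" "\<And>x y. (\<forall>q\<in>D. x q = y q) \<Longrightarrow> f x p = f y p" using assms(2) by blast
    then show "openin config_topology {x \<in> topspace config_topology. f x p \<in> U}"
      unfolding openin_config_iff by auto metis
  qed auto
  then show "continuous_map config_topology config_topology f"
    unfolding config_topology_def[where 'a = 'b] by (simp add: continuous_map_componentwise_UNIV)
qed (use assms(1) in auto)

section \<open>Factor maps, embeddings and shears of Wang shifts\<close>

definition wang_factor :: "'c tile set \<Rightarrow> 'd tile set \<Rightarrow> bool" where
  "wang_factor S T \<longleftrightarrow> (\<exists>\<omega>. morphism_on (wang_shift S) T \<omega> \<and> extend \<omega> \<in> wang_shift S \<rightarrow> wang_shift T \<and>
     recognizable (wang_shift S) \<omega> \<and> onto_up_to_shift (wang_shift S) (wang_shift T) \<omega>)"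

context wang_substitution
begin

lemma wang_factor: "wang_factor (t ` I) T"
  unfolding wang_factor_def
  using morphism_on_expand extend_expand recognizable_expand onto_expand by blast

end

lemma wang_factor_refl: "wang_factor T T"
proof -
  interpret wang_substitution T id T "\<lambda>_. 1" "\<lambda>_. 1" "\<lambda>a _ _. a" "\<lambda>_. True" "\<lambda>_. True" 1
  proof (unfold_locales, goal_cases)
    \<comment> \<open>This is the block condition. Every tile is marked, so a block between
      successive cuts is a single cell.\<close>
    case (13 y w h)
    then have "\<not> 1 < w" "\<not> 1 < h" by (metis zero_neq_one)+
    then have "w = 1" "h = 1" using 13(2,3) by linarith+
    with 13 show ?case by (auto simp: wang_shift_def image_subset_iff)
  qed auto
  show ?thesis using wang_factor by simp
qed

text \<open>A continuous injection of a compact space into a Hausdorff space is a homeomorphism onto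
  its image, so injectivity is all that has to be supplied.\<close>

lemma embedding_letter_map:
  assumes X: "compactin config_topology X" and f: "\<And>x. x \<in> X \<Longrightarrow> g \<circ> x \<in> Y"
    and inj: "\<And>x y. x \<in> X \<Longrightarrow> y \<in> X \<Longrightarrow> g \<circ> x = g \<circ> y \<Longrightarrow> x = y"
  shows "embedding X Y (\<lambda>x. g \<circ> x)" "topological_conjugacy X ((\<lambda>x. g \<circ> x) ` X) (\<lambda>x. g \<circ> x)"
proof -
  have cont: "continuous_map (subtopology config_topology X) (subtopology config_topology Z) (\<lambda>x. g \<circ> x)"
    if "(\<lambda>x. g \<circ> x) \<in> X \<rightarrow> Z" for Z
  proof (intro continuous_map_local that)
    show "\<exists>D. finite D \<and> (\<forall>x y. (\<forall>q\<in>D. x q = y q) \<longrightarrow> (g \<circ> x) p = (g \<circ> y) p)" for p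
      by (intro exI[of _ "{p}"]) auto
  qed
  have sh: "g \<circ> shift k x = shift k (g \<circ> x)" for k x by (auto simp: shift_def)
  have inj': "inj_on (\<lambda>x. g \<circ> x) X" using inj by (auto intro: inj_onI)
  show "embedding X Y (\<lambda>x. g \<circ> x)"
    unfolding embedding_def using inj' cont[of Y] f sh by auto
  have "homeomorphic_map (subtopology config_topology X) (subtopology config_topology ((\<lambda>x. g \<circ> x) ` X)) (\<lambda>x. g \<circ> x)"
    by (intro continuous_imp_homeomorphic_map cont compact_space_subtopology X
        Hausdorff_space_subtopology Hausdorff_config) (use inj' in auto)
  then show "topological_conjugacy X ((\<lambda>x. g \<circ> x) ` X) (\<lambda>x. g \<circ> x)"
    unfolding topological_conjugacy_def using sh by auto
qed

text \<open>A tile of the sheared shift is a horizontal domino \<open>s r\<close>. The domino above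
  it has as its right component the tile that stood above \<open>s\<close>, so the top color is
  taken from \<open>s\<close> and the bottom color from \<open>r\<close>. Encoding whole tiles as
  vertical colors makes neighboring dominoes overlap in one tile.\<close>

definition pair_tile :: "nat tile \<Rightarrow> nat tile \<Rightarrow> nat tile" where
  "pair_tile s r = (to_nat r, top_color s, to_nat s, bottom_color r)"

definition shear_tiles :: "nat tile set \<Rightarrow> nat tile set" where
  "shear_tiles R = {pair_tile s r | s r. s \<in> R \<and> r \<in> R \<and> right_color s = left_color r}"

definition shear :: "nat tile config \<Rightarrow> nat tile config" where
  "shear x = (\<lambda>(m, n). pair_tile (x (m - n - 1, n)) (x (m - n, n)))"

definition unshear :: "nat tile config \<Rightarrow> nat tile config" where
  "unshear y = (\<lambda>(m, n). from_nat (right_color (y (m + n, n))))"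

lemma pair_tile_colors [simp]:
  "right_color (pair_tile s r) = to_nat r" "top_color (pair_tile s r) = top_color s"
  "left_color (pair_tile s r) = to_nat s" "bottom_color (pair_tile s r) = bottom_color r"
  by (simp_all add: pair_tile_def)

lemma finite_shear_tiles: "finite R \<Longrightarrow> finite (shear_tiles R)"
  by (rule finite_subset[of _ "(\<lambda>(s, r). pair_tile s r) ` (R \<times> R)"]) (auto simp: shear_tiles_def)

lemma shear_wang_shift:
  assumes "x \<in> wang_shift R" shows "shear x \<in> wang_shift (shear_tiles R)"
proof -
  have R: "x p \<in> R" and h: "right_color (x (m, n)) = left_color (x (m + 1, n))"
    and v: "top_color (x (m, n)) = bottom_color (x (m, n + 1))" for p m n
    using tilingsD[of x id R] assms by (auto simp: wang_shift_eq_tilings)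
  have "shear x (m, n) \<in> shear_tiles R" for m n
    using R h[of "m - n - 1" n] unfolding shear_def shear_tiles_def
    by (intro CollectI exI[of _ "x (m - n - 1, n)"] exI[of _ "x (m - n, n)"]) simp
  moreover have "top_color (x (m - n - 1, n)) = bottom_color (x (m - (n + 1), n + 1))" for m n
    using v[of "m - n - 1" n] by (simp add: diff_diff_eq)
  ultimately show ?thesis unfolding wang_shift_eq_tilings tilings_def
    by (auto simp: shear_def)
qed

text \<open>Since a vertical color encodes a whole tile, the left component of a domino is the right
  component of the domino to its left. Thus \<open>unshear\<close>, which reads right components
  only, loses nothing.\<close>

lemma shear_tiles_cases:
  assumes "y \<in> wang_shift (shear_tiles R)"
  shows "y (m, n) = pair_tile (unshear y (m - n - 1, n)) (unshear y (m - n, n))"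
    and "unshear y p \<in> R" "right_color (unshear y (m, n)) = left_color (unshear y (m + 1, n))"
proof -
  have S: "y p \<in> shear_tiles R" and h: "right_color (y (m, n)) = left_color (y (m + 1, n))" for p m n
    using tilingsD[of y id] assms by (auto simp: wang_shift_eq_tilings)
  have *: "y (m, n) = pair_tile (unshear y (m - n - 1, n)) (unshear y (m - n, n)) \<and>
     unshear y (m - n, n) \<in> R \<and> right_color (unshear y (m - n - 1, n)) = left_color (unshear y (m - n, n))" for m n
  proof -
    obtain s r where sr: "y (m, n) = pair_tile s r" "s \<in> R" "r \<in> R" "right_color s = left_color r"
      using S[of "(m, n)"] by (auto simp: shear_tiles_def)
    have "unshear y (m - n, n) = r" by (simp add: unshear_def sr)
    moreover have "right_color (y (m - 1, n)) = to_nat s" using h[of "m - 1" n] by (simp add: sr)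
    then have "unshear y (m - n - 1, n) = s" by (simp add: unshear_def)
    ultimately show ?thesis using sr by simp
  qed
  show "y (m, n) = pair_tile (unshear y (m - n - 1, n)) (unshear y (m - n, n))" using * by blast
  show "unshear y p \<in> R" using *[of "fst p + snd p" "snd p"] by simp
  show "right_color (unshear y (m, n)) = left_color (unshear y (m + 1, n))"
    using *[of "m + n + 1" "n"] by (simp add: algebra_simps)
qed

lemma unshear_wang_shift:
  assumes "y \<in> wang_shift (shear_tiles R)" shows "unshear y \<in> wang_shift R"
proof -
  note c = shear_tiles_cases[OF assms]
  have "top_color (y (m, n)) = bottom_color (y (m, n + 1))" for m n
    using tilingsD(3)[of y id] assms by (auto simp: wang_shift_eq_tilings)
  then have "top_color (unshear y (m - n - 1, n)) = bottom_color (unshear y (m - (n + 1), n + 1))" for m n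
    using c(1)[of m n] c(1)[of m "n + 1"] by (metis pair_tile_colors(2,4))
  from this[of "m + n + 1" n for m n]
  have "top_color (unshear y (m, n)) = bottom_color (unshear y (m, n + 1))" for m n
    by (simp add: algebra_simps)
  then show ?thesis unfolding wang_shift_eq_tilings tilings_def using c(2,3) by simp
qed

lemma unshear_shear: "unshear (shear x) = x"
  by (auto simp: unshear_def shear_def)

lemma shear_unshear: "y \<in> wang_shift (shear_tiles R) \<Longrightarrow> shear (unshear y) = y"
  using shear_tiles_cases(1) by (auto simp: shear_def)

text \<open>The tile at \<open>(p, q)\<close> becomes the right component at
  \<open>(p + q, q)\<close>, which is the matrix applied to \<open>(p, q)\<close>.\<close>

lemma shear_conjugacy_shear:
  "shear_conjugacy (vector [vector [1, 1], vector [0, 1]]) (wang_shift R) (wang_shift (shear_tiles R)) shear"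
  unfolding shear_conjugacy_def
proof (intro conjI allI ballI)
  let ?M = "vector [vector [1, 1], vector [0, 1]] :: int^2^2"
  have M: "?M $ 1 $ 1 = 1" "?M $ 1 $ 2 = 1" "?M $ 2 $ 1 = 0" "?M $ 2 $ 2 = 1"
    by (simp_all add: vector_2)
  show "shear_matrix ?M"
    unfolding shear_matrix_def by (simp add: vec_eq_iff matrix_matrix_mult_def mat_def forall_2 sum_2 M)
  show "shear (shift k x) = shift (mat_act ?M k) (shear x)" for k x
    by (cases k) (auto simp: shear_def shift_def mat_act_def M plus_prod_def algebra_simps)
  have "continuous_map (subtopology config_topology (wang_shift R))
      (subtopology config_topology (wang_shift (shear_tiles R))) shear"
  proof (rule continuous_map_local)
    fix p :: "int \<times> int"
    show "\<exists>D. finite D \<and> (\<forall>x y. (\<forall>q\<in>D. x q = y q) \<longrightarrow> shear x p = shear y p)"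
      by (intro exI[of _ "{(fst p - snd p - 1, snd p), (fst p - snd p, snd p)}"]) (auto simp: shear_def split_beta)
  qed (use shear_wang_shift in auto)
  moreover have "continuous_map (subtopology config_topology (wang_shift (shear_tiles R)))
      (subtopology config_topology (wang_shift R)) unshear"
  proof (rule continuous_map_local)
    fix p :: "int \<times> int"
    show "\<exists>D. finite D \<and> (\<forall>x y. (\<forall>q\<in>D. x q = y q) \<longrightarrow> unshear x p = unshear y p)"
      by (intro exI[of _ "{(fst p + snd p, snd p)}"]) (auto simp: unshear_def split_beta)
  qed (use unshear_wang_shift in auto)
  ultimately have "homeomorphic_maps (subtopology config_topology (wang_shift R))
      (subtopology config_topology (wang_shift (shear_tiles R))) shear unshear"
    unfolding homeomorphic_maps_def by (simp add: unshear_shear shear_unshear)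
  then show "homeomorphic_map (subtopology config_topology (wang_shift R))
      (subtopology config_topology (wang_shift (shear_tiles R))) shear"
    by (auto simp: homeomorphic_map_maps)
qed

section \<open>Cutting Jeandel-Rao tilings into columns\<close>

text \<open>In the functions that are to be evaluated, nested conditionals make the simplifier evaluate
  lazily, and named functions instead of abstractions keep it from unfolding their bodies before
  they are fully applied.\<close>

primrec some :: "('s \<Rightarrow> bool) \<Rightarrow> 's list \<Rightarrow> bool" where
  "some P [] = False"
| "some P (x # xs) = (if P x then True else some P xs)"

definition swap_args :: "('s \<Rightarrow> 't \<Rightarrow> bool) \<Rightarrow> 't \<Rightarrow> 's \<Rightarrow> bool" where
  "swap_args R p q = R q p"

definition alive :: "('s \<Rightarrow> 's \<Rightarrow> bool) \<Rightarrow> ('s \<Rightarrow> 's \<Rightarrow> bool) \<Rightarrow> 's list \<Rightarrow> 's \<Rightarrow> bool" where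
  "alive R S Q p =
     (if some (R p) Q then if some (swap_args R p) Q then
        if some (S p) Q then some (swap_args S p) Q else False else False else False)"

definition prune :: "('s \<Rightarrow> 's \<Rightarrow> bool) \<Rightarrow> ('s \<Rightarrow> 's \<Rightarrow> bool) \<Rightarrow> 's list \<Rightarrow> 's list" where
  "prune R S Q = filter (alive R S Q) Q"

lemma some_iff: "some P xs \<longleftrightarrow> (\<exists>x\<in>set xs. P x)"
  by (induction xs) auto

text \<open>The neighbors that keep an entry of the array from being removed are its neighbors in
  the array itself.\<close>

lemma prune_invariant:
  fixes s :: "int \<Rightarrow> int \<Rightarrow> 's"
  assumes Q: "\<And>m n. s m n \<in> set Q"
    and R: "\<And>m n. R (s m n) (s (m + 1) n)" and S: "\<And>m n. S (s m n) (s m (n + 1))"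
  shows "s m n \<in> set (prune R S Q)"
proof -
  have "R (s (m - 1) n) (s m n)" "S (s m (n - 1)) (s m n)"
    using R[of "m - 1" n] S[of m "n - 1"] by simp_all
  with R[of m n] S[of m n] have "alive R S Q (s m n)"
    using Q unfolding alive_def some_iff swap_args_def by auto
  then show ?thesis using Q by (simp add: prune_def)
qed

lemma prune_pow_invariant:
  fixes s :: "int \<Rightarrow> int \<Rightarrow> 's"
  assumes "\<And>m n. s m n \<in> set Q" "\<And>m n. R (s m n) (s (m + 1) n)" "\<And>m n. S (s m n) (s m (n + 1))"
  shows "s m n \<in> set ((prune R S ^^ k) Q)"
proof (induction k arbitrary: m n)
  case (Suc k)
  then show ?case using prune_invariant[of s "(prune R S ^^ k) Q" R S] assms(2,3) by simp
qed (use assms(1) in simp)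

definition recolor :: "('c \<Rightarrow> 'd) \<Rightarrow> 'c tile \<Rightarrow> 'd tile" where
  "recolor f = (\<lambda>(a, b, c, d). (f a, f b, f c, f d))"

lemma recolor_simps [simp]:
  "right_color (recolor f r) = f (right_color r)" "top_color (recolor f r) = f (top_color r)"
  "left_color (recolor f r) = f (left_color r)" "bottom_color (recolor f r) = f (bottom_color r)"
  by (cases r; simp add: recolor_def)+

datatype jcolor = L0 | L1 | L2 | L3 | L4

primrec jcode :: "jcolor \<Rightarrow> nat" where
  "jcode L0 = 0" | "jcode L1 = 1" | "jcode L2 = 2" | "jcode L3 = 3" | "jcode L4 = 4"

lemma jcode_eq_iff: "jcode a = jcode b \<longleftrightarrow> a = b"
  by (cases a; cases b) simp_all

datatype jtile = J1 | J2 | J3 | J4 | J5 | J6 | J7 | J8 | J9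

text \<open>The Jeandel-Rao tiles with left and right colors different from 2.\<close>

primrec jcolors :: "jtile \<Rightarrow> jcolor tile" where
  "jcolors J1 = (L1,L1,L3,L1)" | "jcolors J2 = (L1,L2,L3,L2)" | "jcolors J3 = (L3,L1,L3,L3)"
| "jcolors J4 = (L0,L1,L3,L1)" | "jcolors J5 = (L0,L0,L0,L1)" | "jcolors J6 = (L3,L1,L0,L2)"
| "jcolors J7 = (L0,L2,L1,L2)" | "jcolors J8 = (L1,L2,L1,L4)" | "jcolors J9 = (L3,L3,L1,L2)"

fun beside :: "jtile list \<Rightarrow> jtile list \<Rightarrow> bool" where
  "beside [] [] = True"
| "beside (r # c) (s # d) =
     (if right_color (jcolors r) = left_color (jcolors s) then beside c d else False)"
| "beside _ _ = False"

fun below :: "jtile \<Rightarrow> jtile list \<Rightarrow> bool" where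
  "below r [] = True"
| "below r (s # c) = (top_color (jcolors r) = bottom_color (jcolors s))"

definition put_below :: "jtile list list \<Rightarrow> jtile \<Rightarrow> jtile list list" where
  "put_below C r = map (Cons r) (filter (below r) C)"

definition stack :: "jtile list list \<Rightarrow> jtile list list" where
  "stack C = concat (map (put_below C) [J1, J2, J3, J4, J5, J6, J7, J8, J9])"

text \<open>A vacuous vertical relation for \<open>prune\<close>: stacks are compared with their
  horizontal neighbors only.\<close>

definition unrelated :: "'s \<Rightarrow> 's \<Rightarrow> bool" where
  "unrelated p q = True"

definition trim :: "jtile list list \<Rightarrow> jtile list list" where
  "trim = prune beside unrelated"

text \<open>Five consecutive rows avoiding color 2 on vertical edges would form a bi-infinite walk
  through stacks of five tiles. Repeatedly removing stacks that lack a left or right neighbor leaves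
  none. Trimming at heights three and four already reduces the lists that are extended
  further.\<close>

lemma five_stack_empty:
  "(trim ^^ 3) (stack ((trim ^^ 3) (stack ((trim ^^ 1) (stack (stack (stack [[]]))))))) = []"
  by code_simp

section \<open>Rows of start tiles and the columns between them\<close>

definition jr_start :: "nat tile \<Rightarrow> bool" where
  "jr_start r \<longleftrightarrow> left_color r = 2"

lemma jr_start_iff:
  assumes "r \<in> jeandel_rao"
  shows "\<not> jr_start r \<Longrightarrow> r \<in> range (recolor jcode \<circ> jcolors)" "jr_start r \<longleftrightarrow> right_color r = 2"
proof -
  have "\<forall>r\<in>jeandel_rao. (jr_start r \<or> r \<in> (recolor jcode \<circ> jcolors) ` {J1, J2, J3, J4, J5, J6, J7, J8, J9}) \<and>
      (jr_start r \<longleftrightarrow> right_color r = 2)"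
    by (simp add: jeandel_rao_def recolor_def jr_start_def)
  with assms show "\<not> jr_start r \<Longrightarrow> r \<in> range (recolor jcode \<circ> jcolors)" "jr_start r \<longleftrightarrow> right_color r = 2"
    by blast+
qed

text \<open>This allows a column to be recovered from its outer colors, although these omit all
  horizontal colors inside it.\<close>

lemma jeandel_rao_determined:
  assumes "r \<in> jeandel_rao" "s \<in> jeandel_rao"
    "right_color r = right_color s" "left_color r = left_color s" "bottom_color r = bottom_color s"
  shows "r = s"
proof -
  have "\<forall>r\<in>jeandel_rao. \<forall>s\<in>jeandel_rao. right_color r = right_color s \<longrightarrow>
      left_color r = left_color s \<longrightarrow> bottom_color r = bottom_color s \<longrightarrow> r = s"
    by (simp add: jeandel_rao_def)
  with assms show ?thesis by blast
qed

lemma jr_start_const: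
  assumes "y \<in> wang_shift jeandel_rao" shows "jr_start (y (m, n)) = jr_start (y (0, n))"
proof (rule int_const[of "\<lambda>m. jr_start (y (m, n))"])
  note yD = tilingsD[of y id jeandel_rao, folded wang_shift_eq_tilings, OF assms, simplified]
  fix m show "jr_start (y (m + 1, n)) = jr_start (y (m, n))"
    using jr_start_iff(2)[OF yD(1)[of "(m, n)"]] yD(2)[of m n] by (simp add: jr_start_def)
qed

lemma beside_map:
  "beside (map f xs) (map g xs) \<longleftrightarrow> (\<forall>x\<in>set xs. right_color (jcolors (f x)) = left_color (jcolors (g x)))"
  by (induction xs) auto

lemma jr_start_gap:
  assumes y: "y \<in> wang_shift jeandel_rao" shows "\<exists>j<5. jr_start (y (0, int j))"
proof (rule ccontr)
  note yD = tilingsD[of y id jeandel_rao, folded wang_shift_eq_tilings, OF y, simplified]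
  assume "\<not> ?thesis"
  then have "\<not> jr_start (y (m, int j))" if "j < 5" for m j
    using that jr_start_const[OF y] by blast
  then have ex: "\<exists>b. y (m, int j) = recolor jcode (jcolors b)" if "j < 5" for m j
    using that jr_start_iff(1)[OF yD(1)[of "(m, int j)"]] by auto
  define b where "b m j = (SOME b. y (m, int j) = recolor jcode (jcolors b))" for m j
  have b: "y (m, int j) = recolor jcode (jcolors (b m j))" if "j < 5" for m j
    unfolding b_def by (rule someI_ex[OF ex[OF that]])
  have bh: "right_color (jcolors (b m j)) = left_color (jcolors (b (m + 1) j))" if "j < 5" for m j
    using yD(2)[of m "int j"] b[OF that] by (simp add: jcode_eq_iff)
  have bv: "top_color (jcolors (b m j)) = bottom_color (jcolors (b m (Suc j)))" if "Suc j < 5" for m j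
    using yD(3)[of m "int j"] b[OF that, of m] b[of j m] that by (simp add: jcode_eq_iff add.commute)
  \<comment> \<open>The stack of the upper \<open>k\<close> of the five rows at abscissa
    \<open>m\<close>. The argument \<open>n\<close> is a dummy that gives the array the two
    dimensions expected by \<open>prune_pow_invariant\<close>.\<close>
  define s where "s k m n = map (b m) [5 - k..<5]" for k and m n :: int
  have extend: "s (Suc k) m n \<in> set (stack C)" if C: "s k m n \<in> set C" and k: "k < 5" for k C m n
  proof -
    have "Suc (5 - Suc k) = 5 - k" using k by simp
    then have "[5 - Suc k..<5] = (5 - Suc k) # [5 - k..<5]"
      using upt_conv_Cons[of "5 - Suc k" 5] by simp
    then have s: "s (Suc k) m n = b m (5 - Suc k) # s k m n" by (simp add: s_def)
    have "below (b m (5 - Suc k)) (s k m n)"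
    proof (cases k)
      case (Suc l)
      then have "[5 - k..<5] = (5 - k) # [Suc (5 - k)..<5]" using k by (simp add: upt_conv_Cons)
      moreover have "Suc (5 - Suc k) = 5 - k" "5 - k < 5" using k Suc by simp_all
      ultimately show ?thesis using bv[of "5 - Suc k" m] by (simp add: s_def)
    qed (simp add: s_def)
    moreover have "b m (5 - Suc k) \<in> set [J1, J2, J3, J4, J5, J6, J7, J8, J9]"
      by (cases "b m (5 - Suc k)") simp_all
    ultimately show ?thesis using C unfolding stack_def put_below_def s by auto
  qed
  have trim: "s k m n \<in> set ((trim ^^ i) C)" if "\<And>m n. s k m n \<in> set C" for k i C m n
    unfolding trim_def using that bh
    by (intro prune_pow_invariant) (auto simp: s_def beside_map unrelated_def)
  have 0: "s 0 m n \<in> set [[]]" for m n by (simp add: s_def)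
  \<comment> \<open>The following facts retrace the nested term of \<open>five_stack_empty\<close>
    from the inside, with the same numbers of trimmings.\<close>
  note 1 = extend[OF 0, simplified]
  note 2 = extend[OF 1, simplified]
  note 3 = trim[where i = 1, OF extend[OF 2]]
  note 4 = trim[where i = 3, OF extend[OF 3]]
  note 5 = trim[where i = 3, OF extend[OF 4]]
  show False using 5[of 0 0] five_stack_empty by simp
qed

definition stacked :: "nat tile list \<Rightarrow> bool" where
  "stacked c \<longleftrightarrow> (\<forall>j. Suc j < length c \<longrightarrow> top_color (c ! j) = bottom_color (c ! Suc j))"

definition jr_columns :: "nat tile list set" where
  "jr_columns = {c. 0 < length c \<and> length c \<le> 5 \<and> set c \<subseteq> jeandel_rao \<and>
     (\<forall>j<length c. jr_start (c ! j) \<longleftrightarrow> j = 0) \<and> stacked c}"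

text \<open>Vertical colors encode the whole sequence of colors along a side. Columns therefore
  match only if they have equal heights and all of their rows match.\<close>

definition fused :: "nat tile list \<Rightarrow> nat tile" where
  "fused c = (to_nat (map right_color c), top_color (last c), to_nat (map left_color c), bottom_color (hd c))"

lemma finite_jr_columns: "finite jr_columns"
proof (rule finite_subset)
  show "jr_columns \<subseteq> {c. set c \<subseteq> jeandel_rao \<and> length c \<le> 5}" by (auto simp: jr_columns_def)
qed (intro finite_lists_length_le, simp add: jeandel_rao_def)

text \<open>From the bottom upwards: each tile is fixed by its two sides and its bottom color, and
  its top color is the bottom color of the next tile.\<close>

lemma jr_column_determined:
  assumes c: "c \<in> jr_columns" "d \<in> jr_columns" and eq: "map right_color c = map right_color d"
    "map left_color c = map left_color d" "bottom_color (hd c) = bottom_color (hd d)"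
  shows "c = d"
proof (rule nth_equalityI)
  show len: "length c = length d" using eq(1) by (metis length_map)
  have det: "c ! j = d ! j" if j: "j < length c" and b: "bottom_color (c ! j) = bottom_color (d ! j)" for j
  proof (rule jeandel_rao_determined[OF _ _ _ _ b])
    show "c ! j \<in> jeandel_rao" "d ! j \<in> jeandel_rao"
      using c j len nth_mem[of j c] nth_mem[of j d] by (auto simp: jr_columns_def)
    show "right_color (c ! j) = right_color (d ! j)" "left_color (c ! j) = left_color (d ! j)"
      using arg_cong[OF eq(1), of "\<lambda>l. l ! j"] arg_cong[OF eq(2), of "\<lambda>l. l ! j"] j len by simp_all
  qed
  fix j assume "j < length c"
  then show "c ! j = d ! j"
  proof (induction j)
    case 0
    have "c \<noteq> []" "d \<noteq> []" using 0 len by auto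
    then show ?case using det[OF 0] eq(3) by (simp add: hd_conv_nth)
  next
    case (Suc j)
    have "top_color (c ! j) = bottom_color (c ! Suc j)" "top_color (d ! j) = bottom_color (d ! Suc j)"
      using c Suc.prems len by (simp_all add: jr_columns_def stacked_def)
    then show ?case using det[OF Suc.prems] Suc by simp
  qed
qed

text \<open>Blocks have width 1, so every vertical line is a cut; the horizontal cuts are the lines
  below the start rows.\<close>

interpretation jr: wang_substitution jr_columns fused jeandel_rao "\<lambda>_. 1" length "\<lambda>c _ j. c ! j"
  "\<lambda>_. True" jr_start 5
proof unfold_locales
  show "inj_on fused jr_columns"
    by (rule inj_onI) (auto simp: fused_def intro: jr_column_determined)
  show "right_color (fused c) = left_color (fused d) \<longleftrightarrow>
      length c = length d \<and> (\<forall>j<length c. right_color (c ! j) = left_color (d ! j))" for c d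
    by (auto simp: fused_def list_eq_iff_nth_eq)
  show "top_color (fused c) = bottom_color (fused d) \<longleftrightarrow>
      (1 :: nat) = 1 \<and> (\<forall>i<1 :: nat. top_color (c ! (length c - 1)) = bottom_color (d ! 0))"
    if "c \<in> jr_columns" "d \<in> jr_columns" for c d
    using that by (auto simp: fused_def jr_columns_def last_conv_nth hd_conv_nth)
  show "jr_start r = jr_start s" if "r \<in> jeandel_rao" "s \<in> jeandel_rao" "right_color r = left_color s" for r s
    using that jr_start_iff(2)[of r] by (simp add: jr_start_def)
  show "c ! j \<in> jeandel_rao" if "c \<in> jr_columns" "j < length c" for c and i j :: nat
    using that by (auto simp: jr_columns_def)
  show "\<exists>i<5 :: nat. True" by (intro exI[of _ 0]) simp
  show "\<exists>j<5. jr_start (y (0, int j))" if "y \<in> wang_shift jeandel_rao" for y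
    using jr_start_gap[OF that] .
  show "\<exists>a\<in>jr_columns. 1 = w \<and> length a = h \<and> (\<forall>i<w. \<forall>j<h. y (int i, int j) = a ! j)"
    if y: "y \<in> wang_shift jeandel_rao" and w: "0 < w" "\<forall>i<w. True = (i = 0)"
      and h: "0 < h" "\<forall>j<h. jr_start (y (0, int j)) = (j = 0)" for y w h
  proof (intro bexI[of _ "map (\<lambda>j. y (0, int j)) [0..<h]"] conjI)
    note yD = tilingsD[of y id jeandel_rao, folded wang_shift_eq_tilings, OF y, simplified]
    have "\<not> 1 < w" using w(2) by auto
    then show w1: "1 = w" using w(1) by simp
    show "length (map (\<lambda>j. y (0, int j)) [0..<h]) = h" by simp
    show "\<forall>i<w. \<forall>j<h. y (int i, int j) = map (\<lambda>j. y (0, int j)) [0..<h] ! j" using w1 by auto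
    \<comment> \<open>One of the rows 1 to 5 is a start row, but no row strictly between 0 and
      \<open>h\<close> is, which bounds \<open>h\<close> by 5.\<close>
    obtain j where j: "j < 5" "jr_start (y (0, 1 + int j))"
      using jr_start_gap[OF shift_wang_shift[OF y, of "(0, 1)"]] by (auto simp: shift_def add.commute)
    have "h \<le> 5"
    proof (rule ccontr)
      assume "\<not> h \<le> 5"
      then have "jr_start (y (0, int (Suc j))) = (Suc j = 0)" using h(2) j(1) by (intro h(2)[rule_format]) simp
      then show False using j(2) by simp
    qed
    then show "map (\<lambda>j. y (0, int j)) [0..<h] \<in> jr_columns"
      using h yD by (auto simp: jr_columns_def stacked_def add.commute[of 1])
  qed
  show "c = d" if "length c = length d" "\<forall>i<1 :: nat. \<forall>j<length c. c ! j = d ! j" for c d :: "nat tile list"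
    using that by (auto intro: nth_equalityI)
qed (auto simp: jr_columns_def stacked_def)

section \<open>The self-similar Wang shift on 19 tiles\<close>

datatype utile = U0 | U1 | U2 | U3 | U4 | U5 | U6 | U7 | U8 | U9 | U10 | U11 | U12 | U13 | U14 | U15 | U16 | U17 | U18

definition utiles :: "utile list" where
  "utiles = [U0, U1, U2, U3, U4, U5, U6, U7, U8, U9, U10, U11, U12, U13, U14, U15, U16, U17, U18]"

primrec ucolors :: "utile \<Rightarrow> ucolor tile" where
  "ucolors U0 = (cF,cO,cJ,cO)" | "ucolors U1 = (cF,cO,cH,cL)" | "ucolors U2 = (cJ,cM,cF,cP)" | "ucolors U3 = (cD,cM,cF,cK)"
| "ucolors U4 = (cH,cP,cJ,cP)" | "ucolors U5 = (cH,cP,cH,cN)" | "ucolors U6 = (cH,cK,cF,cP)" | "ucolors U7 = (cH,cK,cD,cP)"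
| "ucolors U8 = (cB,cO,cI,cO)" | "ucolors U9 = (cG,cL,cE,cO)" | "ucolors U10 = (cG,cL,cC,cL)" | "ucolors U11 = (cA,cL,cI,cO)"
| "ucolors U12 = (cE,cP,cG,cP)" | "ucolors U13 = (cE,cP,cI,cP)" | "ucolors U14 = (cI,cP,cG,cK)" | "ucolors U15 = (cI,cP,cI,cK)"
| "ucolors U16 = (cI,cK,cB,cM)" | "ucolors U17 = (cI,cK,cA,cK)" | "ucolors U18 = (cC,cN,cI,cP)"

text \<open>The image of a tile is the list of its columns from left to right, each column being listed from
  bottom to top. Tiles with horizontal colors in \<open>{O, L}\<close> are merged with their left neighbor and
  tiles with vertical colors in \<open>{F, J, H, D}\<close> with the tile below.\<close>

primrec inflation :: "utile \<Rightarrow> utile list list" where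
  "inflation U0 = [[U17]]" | "inflation U1 = [[U16]]" | "inflation U2 = [[U15],[U11]]"
| "inflation U3 = [[U13],[U9]]" | "inflation U4 = [[U17],[U8]]" | "inflation U5 = [[U16],[U8]]"
| "inflation U6 = [[U15],[U8]]" | "inflation U7 = [[U14],[U8]]" | "inflation U8 = [[U14,U6]]"
| "inflation U9 = [[U17,U3]]" | "inflation U10 = [[U16,U3]]" | "inflation U11 = [[U14,U2]]"
| "inflation U12 = [[U15,U7],[U11,U1]]" | "inflation U13 = [[U14,U6],[U11,U1]]" | "inflation U14 = [[U13,U7],[U9,U1]]"
| "inflation U15 = [[U12,U6],[U9,U1]]" | "inflation U16 = [[U18,U5],[U10,U1]]" | "inflation U17 = [[U13,U4],[U9,U1]]"
| "inflation U18 = [[U14,U2],[U8,U0]]"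

definition joins_left :: "utile \<Rightarrow> bool" where
  "joins_left a \<longleftrightarrow> bottom_color (ucolors a) \<in> {cO, cL}"

definition joins_below :: "utile \<Rightarrow> bool" where
  "joins_below a \<longleftrightarrow> left_color (ucolors a) \<in> {cF, cJ, cH, cD}"

type_synonym upatch = "utile \<times> utile \<times> utile \<times> utile"

text \<open>A patch \<open>(a, b, c, d)\<close> has bottom row \<open>a b\<close> and top row \<open>c d\<close>.\<close>

definition patches :: "upatch list" where
  "patches = [
     (U0,U3,U8,U16), (U1,U2,U8,U16), (U1,U3,U8,U16), (U1,U6,U9,U14),
     (U1,U6,U11,U17), (U2,U0,U16,U8), (U2,U4,U16,U13), (U3,U7,U16,U15),
     (U4,U1,U13,U9), (U5,U1,U13,U9), (U6,U1,U14,U8), (U6,U1,U14,U11),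
     (U6,U1,U17,U8), (U6,U5,U14,U13), (U6,U5,U17,U13), (U7,U1,U15,U8),
     (U7,U1,U15,U11), (U8,U16,U0,U3), (U8,U16,U9,U14), (U8,U16,U11,U17),
     (U9,U14,U1,U2), (U9,U14,U1,U6), (U9,U14,U10,U12), (U10,U12,U1,U6),
     (U10,U14,U1,U6), (U11,U17,U1,U3), (U11,U17,U10,U14), (U12,U9,U6,U1),
     (U13,U9,U4,U1), (U13,U9,U7,U1), (U13,U9,U18,U10), (U14,U8,U2,U0),
     (U14,U8,U12,U9), (U14,U11,U6,U1), (U14,U13,U2,U4), (U14,U18,U6,U5),
     (U15,U8,U13,U9), (U15,U11,U7,U1), (U15,U11,U18,U10), (U16,U8,U14,U11),
     (U16,U13,U3,U7), (U16,U13,U14,U18), (U16,U15,U3,U7), (U16,U15,U14,U13),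
     (U16,U15,U14,U18), (U16,U15,U17,U13), (U17,U8,U14,U11), (U17,U13,U3,U7),
     (U17,U13,U14,U18), (U18,U10,U5,U1)]"

primrec every :: "('s \<Rightarrow> bool) \<Rightarrow> 's list \<Rightarrow> bool" where
  "every P [] = True"
| "every P (x # xs) = (if P x then every P xs else False)"

lemma every_iff: "every P xs \<longleftrightarrow> (\<forall>x\<in>set xs. P x)"
  by (induction xs) auto

lemma set_utiles: "set utiles = UNIV"
proof -
  have "a \<in> set utiles" for a by (cases a) (simp_all add: utiles_def)
  then show ?thesis by auto
qed

definition every_pair :: "('s \<Rightarrow> 't \<Rightarrow> bool) \<Rightarrow> 't list \<Rightarrow> 's \<Rightarrow> bool" where
  "every_pair P ys x = every (P x) ys"

lemma utile_pairs:
  assumes "every (every_pair P utiles) utiles" shows "P a b"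
  using assms set_utiles by (auto simp: every_iff every_pair_def)

definition h_match :: "utile \<Rightarrow> utile \<Rightarrow> bool" where
  "h_match a b \<longleftrightarrow> right_color (ucolors a) = left_color (ucolors b)"

definition v_match :: "utile \<Rightarrow> utile \<Rightarrow> bool" where
  "v_match a b \<longleftrightarrow> top_color (ucolors a) = bottom_color (ucolors b)"

definition memb :: "'s list \<Rightarrow> 's \<Rightarrow> bool" where
  "memb xs x = some (HOL.eq x) xs"

text \<open>If adjacency in a tiling implies \<open>R\<close> and \<open>S\<close> in the two directions, then dominoes of \<open>R\<close> in a
  tiling have such neighbors on both sides.\<close>

definition successors :: "(utile \<Rightarrow> utile \<Rightarrow> bool) \<Rightarrow> utile \<Rightarrow> utile list" where
  "successors R a = filter (R a) utiles"

definition linked :: "(utile \<Rightarrow> utile \<Rightarrow> bool) \<Rightarrow> utile list \<Rightarrow> utile \<Rightarrow> bool" where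
  "linked R ys x = some (R x) ys"

definition extendable :: "(utile \<Rightarrow> utile \<Rightarrow> bool) \<Rightarrow> (utile \<Rightarrow> utile \<Rightarrow> bool) \<Rightarrow> utile \<Rightarrow> utile \<Rightarrow> bool" where
  "extendable R S a b = some (linked R (successors S b)) (successors S a)"

text \<open>A check of a proposed relation \<open>R'\<close>: each domino of \<open>R\<close>
  outside \<open>R'\<close> must lack a continuation on one of its two sides, so that it occurs in
  no tiling.\<close>

definition prunes_to :: "(utile \<Rightarrow> utile \<Rightarrow> bool) \<Rightarrow> (utile \<Rightarrow> utile \<Rightarrow> bool) \<Rightarrow> (utile \<Rightarrow> utile \<Rightarrow> bool) \<Rightarrow>
    utile \<Rightarrow> utile \<Rightarrow> bool" where
  "prunes_to R S R' a b =
     (if R a b then if R' a b then True else if extendable R S a b then \<not> extendable R (swap_args S) a b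
        else True else True)"

text \<open>The dominoes kept by a first round of pruning, given as data so that
  \<open>domino_prunings\<close> only has to verify them. The lists with suffix 2 belong to a second
  round, which starts from these.\<close>

primrec h_next1 :: "utile \<Rightarrow> utile list" where
  "h_next1 U0 = [U3]" | "h_next1 U1 = [U2,U3,U6]" | "h_next1 U2 = [U0,U4]" | "h_next1 U3 = [U7]"
| "h_next1 U4 = [U1,U5]" | "h_next1 U5 = [U1]" | "h_next1 U6 = [U1,U5]" | "h_next1 U7 = [U1,U5]"
| "h_next1 U8 = [U16]" | "h_next1 U9 = [U14]" | "h_next1 U10 = [U12,U14]" | "h_next1 U11 = [U17]"
| "h_next1 U12 = [U9]" | "h_next1 U13 = [U9]" | "h_next1 U14 = [U8,U11,U13,U18]" | "h_next1 U15 = [U8,U11,U13,U18]"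
| "h_next1 U16 = [U8,U13,U15]" | "h_next1 U17 = [U8,U13]" | "h_next1 U18 = [U10]"

primrec v_next1 :: "utile \<Rightarrow> utile list" where
  "v_next1 U0 = [U8,U11]" | "v_next1 U1 = [U0,U8,U9,U11]" | "v_next1 U2 = [U16]" | "v_next1 U3 = [U16]"
| "v_next1 U4 = [U13]" | "v_next1 U5 = [U13]" | "v_next1 U6 = [U3,U14,U17]" | "v_next1 U7 = [U15]"
| "v_next1 U8 = [U0,U9,U11]" | "v_next1 U9 = [U1,U10]" | "v_next1 U10 = [U1]" | "v_next1 U11 = [U1,U10]"
| "v_next1 U12 = [U6]" | "v_next1 U13 = [U4,U7,U18]" | "v_next1 U14 = [U2,U6,U12]" | "v_next1 U15 = [U4,U7,U13,U18]"
| "v_next1 U16 = [U3,U14,U17]" | "v_next1 U17 = [U3,U14]" | "v_next1 U18 = [U5]"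

primrec h_next2 :: "utile \<Rightarrow> utile list" where
  "h_next2 U0 = [U3]" | "h_next2 U1 = [U2,U3,U6]" | "h_next2 U2 = [U0,U4]" | "h_next2 U3 = [U7]"
| "h_next2 U4 = [U1]" | "h_next2 U5 = [U1]" | "h_next2 U6 = [U1,U5]" | "h_next2 U7 = [U1,U5]"
| "h_next2 U8 = [U16]" | "h_next2 U9 = [U14]" | "h_next2 U10 = [U12,U14]" | "h_next2 U11 = [U17]"
| "h_next2 U12 = [U9]" | "h_next2 U13 = [U9]" | "h_next2 U14 = [U8,U11,U13,U18]" | "h_next2 U15 = [U8,U11]"
| "h_next2 U16 = [U8,U13,U15]" | "h_next2 U17 = [U8,U13]" | "h_next2 U18 = [U10]"

primrec v_next2 :: "utile \<Rightarrow> utile list" where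
  "v_next2 U0 = [U8]" | "v_next2 U1 = [U8,U9,U11]" | "v_next2 U2 = [U16]" | "v_next2 U3 = [U16]"
| "v_next2 U4 = [U13]" | "v_next2 U5 = [U13]" | "v_next2 U6 = [U14,U17]" | "v_next2 U7 = [U15]"
| "v_next2 U8 = [U0,U9,U11]" | "v_next2 U9 = [U1,U10]" | "v_next2 U10 = [U1]" | "v_next2 U11 = [U1,U10]"
| "v_next2 U12 = [U6]" | "v_next2 U13 = [U4,U7,U18]" | "v_next2 U14 = [U2,U6,U12]" | "v_next2 U15 = [U7,U13,U18]"
| "v_next2 U16 = [U3,U14,U17]" | "v_next2 U17 = [U3,U14]" | "v_next2 U18 = [U5]"

definition h_rel1 :: "utile \<Rightarrow> utile \<Rightarrow> bool" where "h_rel1 a = memb (h_next1 a)"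
definition v_rel1 :: "utile \<Rightarrow> utile \<Rightarrow> bool" where "v_rel1 a = memb (v_next1 a)"
definition h_rel2 :: "utile \<Rightarrow> utile \<Rightarrow> bool" where "h_rel2 a = memb (h_next2 a)"
definition v_rel2 :: "utile \<Rightarrow> utile \<Rightarrow> bool" where "v_rel2 a = memb (v_next2 a)"

lemma domino_prunings:
  "every (every_pair (prunes_to h_match v_match h_rel1) utiles) utiles"
  "every (every_pair (prunes_to v_match h_match v_rel1) utiles) utiles"
  "every (every_pair (prunes_to h_rel1 v_rel1 h_rel2) utiles) utiles"
  "every (every_pair (prunes_to v_rel1 h_rel1 v_rel2) utiles) utiles"
  by code_simp+

definition surviving3 :: "utile \<Rightarrow> utile \<Rightarrow> utile \<Rightarrow> upatch list" where
  "surviving3 a b c = map (\<lambda>d. (a, b, c, d)) (filter (v_rel2 b) (h_next2 c))"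

definition surviving2 :: "utile \<Rightarrow> utile \<Rightarrow> upatch list" where
  "surviving2 a b = concat (map (surviving3 a b) (v_next2 a))"

definition surviving1 :: "utile \<Rightarrow> upatch list" where
  "surviving1 a = concat (map (surviving2 a) (h_next2 a))"

definition surviving :: "upatch list" where
  "surviving = concat (map surviving1 utiles)"

fun adjacent_columns :: "'s list \<Rightarrow> 's list \<Rightarrow> ('s \<times> 's \<times> 's \<times> 's) list" where
  "adjacent_columns (a # c # cs) (b # d # ds) = (a, b, c, d) # adjacent_columns (c # cs) (d # ds)"
| "adjacent_columns _ _ = []"

fun subpatches :: "'s list list \<Rightarrow> ('s \<times> 's \<times> 's \<times> 's) list" where
  "subpatches (c # d # cs) = adjacent_columns c d @ subpatches (d # cs)"
| "subpatches _ = []"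

fun juxtapose :: "upatch \<Rightarrow> utile list list" where
  "juxtapose (a, b, c, d) = map2 (@) (inflation a) (inflation c) @ map2 (@) (inflation b) (inflation d)"

definition images_in :: "upatch list \<Rightarrow> upatch \<Rightarrow> bool" where
  "images_in Q q = every (memb Q) (subpatches (juxtapose q))"

text \<open>Pruning leaves 51 patches. The spurious one does not occur in the image of any of them.\<close>

lemma images_of_surviving: "every (images_in patches) surviving"
  by code_simp

text \<open>The block with lower left tile \<open>a\<close> as dictated by the merging rules,
  provided that \<open>a\<close> itself joins neither its left neighbor nor the tile below.\<close>

fun cut_block :: "upatch \<Rightarrow> utile list list" where
  "cut_block (a, b, c, d) =
     (if joins_left b then if joins_below c then [[a, c], [b, d]] else [[a], [b]]
      else if joins_below c then [[a, c]] else [[a]])"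

definition equals_inflation :: "utile list list \<Rightarrow> utile \<Rightarrow> bool" where
  "equals_inflation w a = (inflation a = w)"

text \<open>Besides identifying a block as an image, this records that no two horizontally adjacent
  tiles both join to the left, which bounds the width of blocks by 2. The bound on heights comes
  from \<open>isolated_below\<close>.\<close>

fun desubstitutable :: "upatch \<Rightarrow> bool" where
  "desubstitutable (a, b, c, d) =
     (if joins_left a then \<not> joins_left b else if joins_below a then True
      else some (equals_inflation (cut_block (a, b, c, d))) utiles)"

fun isolated_below :: "upatch \<Rightarrow> bool" where
  "isolated_below (a, b, c, d) = (if joins_below a then \<not> joins_below c else True)"

lemma surviving_cut:
  "every desubstitutable surviving" "every isolated_below surviving"
  by code_simp+

text \<open>The rows above and below supply continuations of every domino in the array. Applied to
  transposed arrays, this also treats vertical dominoes.\<close>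

lemma prunes_toD:
  fixes u :: "int \<Rightarrow> int \<Rightarrow> utile"
  assumes c: "every (every_pair (prunes_to R S R') utiles) utiles"
    and R: "\<And>m n. R (u m n) (u (m + 1) n)" and S: "\<And>m n. S (u m n) (u m (n + 1))"
  shows "R' (u m n) (u (m + 1) n)"
proof -
  have "extendable R S (u m n) (u (m + 1) n)"
    using R[of m "n + 1"] S[of m n] S[of "m + 1" n] set_utiles
    by (auto simp: extendable_def linked_def successors_def some_iff)
  moreover have "S (u m (n - 1)) (u m n)" "S (u (m + 1) (n - 1)) (u (m + 1) n)"
    using S[of m "n - 1"] S[of "m + 1" "n - 1"] by simp_all
  then have "extendable R (swap_args S) (u m n) (u (m + 1) n)"
    using R[of m "n - 1"] set_utiles
    by (auto simp: extendable_def linked_def successors_def some_iff swap_args_def)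
  ultimately show ?thesis
    using utile_pairs[OF c, of "u m n" "u (m + 1) n"] R[of m n]
    by (simp add: prunes_to_def split: if_splits)
qed

instance ucolor :: countable
  by countable_datatype

definition utile_code :: "utile \<Rightarrow> nat tile" where
  "utile_code a = recolor to_nat (ucolors a)"

abbreviation utilings :: "utile config set" where
  "utilings \<equiv> tilings utile_code UNIV"

lemma utilings_match:
  assumes "u \<in> utilings"
  shows "h_match (u (m, n)) (u (m + 1, n))" "v_match (u (m, n)) (u (m, n + 1))"
  using tilingsD(2,3)[OF assms, of m n] by (simp_all add: utile_code_def h_match_def v_match_def)

definition patch_at :: "utile config \<Rightarrow> int \<Rightarrow> int \<Rightarrow> upatch" where
  "patch_at u m n = (u (m, n), u (m + 1, n), u (m, n + 1), u (m + 1, n + 1))"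

lemma memb_iff: "memb xs x \<longleftrightarrow> x \<in> set xs"
  by (auto simp: memb_def some_iff)

lemma patch_at_surviving:
  assumes u: "u \<in> utilings" shows "patch_at u m n \<in> set surviving"
proof -
  note h0 = utilings_match(1)[OF u] and v0 = utilings_match(2)[OF u]
  have h1: "h_rel1 (u (m, n)) (u (m + 1, n))" for m n
    using prunes_toD[where u = "\<lambda>m n. u (m, n)", OF domino_prunings(1)] h0 v0 by blast
  have v1: "v_rel1 (u (m, n)) (u (m, n + 1))" for m n
    using prunes_toD[where u = "\<lambda>n m. u (m, n)", OF domino_prunings(2)] h0 v0 by blast
  have h2: "h_rel2 (u (m, n)) (u (m + 1, n))" for m n
    using prunes_toD[where u = "\<lambda>m n. u (m, n)", OF domino_prunings(3)] h1 v1 by blast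
  have v2: "v_rel2 (u (m, n)) (u (m, n + 1))" for m n
    using prunes_toD[where u = "\<lambda>n m. u (m, n)", OF domino_prunings(4)] h1 v1 by blast
  show ?thesis
    using h2[of m n] h2[of m "n + 1"] v2[of m n] v2[of "m + 1" n] set_utiles
    by (force simp: patch_at_def surviving_def surviving1_def surviving2_def surviving3_def
        h_rel2_def v_rel2_def memb_iff)
qed

definition uwidth :: "utile \<Rightarrow> nat" where
  "uwidth a = length (inflation a)"

definition uheight :: "utile \<Rightarrow> nat" where
  "uheight a = length (hd (inflation a))"

definition right_edge :: "utile \<Rightarrow> ucolor list" where
  "right_edge a = map (\<lambda>c. right_color (ucolors c)) (last (inflation a))"
definition left_edge :: "utile \<Rightarrow> ucolor list" where
  "left_edge a = map (\<lambda>c. left_color (ucolors c)) (hd (inflation a))"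
definition top_edge :: "utile \<Rightarrow> ucolor list" where
  "top_edge a = map (\<lambda>c. top_color (ucolors (last c))) (inflation a)"
definition bottom_edge :: "utile \<Rightarrow> ucolor list" where
  "bottom_edge a = map (\<lambda>c. bottom_color (ucolors (hd c))) (inflation a)"

text \<open>Two tiles match exactly if the sides of their images do. Both directions are needed for
  \<open>outer_h\<close> and \<open>outer_v\<close>.\<close>

definition edges_agree :: "utile \<Rightarrow> utile \<Rightarrow> bool" where
  "edges_agree a b \<longleftrightarrow> (h_match a b \<longleftrightarrow> right_edge a = left_edge b) \<and>
     (v_match a b \<longleftrightarrow> top_edge a = bottom_edge b)"

definition joins_agree :: "utile \<Rightarrow> utile \<Rightarrow> bool" where
  "joins_agree a b \<longleftrightarrow> (v_match a b \<longrightarrow> joins_left a = joins_left b) \<and>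
     (h_match a b \<longrightarrow> joins_below a = joins_below b) \<and>
     (ucolors a = ucolors b \<longrightarrow> a = b) \<and> (inflation a = inflation b \<longrightarrow> a = b)"

lemma utile_checks: "every (every_pair edges_agree utiles) utiles" "every (every_pair joins_agree utiles) utiles"
  by code_simp+

lemma inflation_shape:
  "0 < uwidth a" "0 < uheight a" "i < uwidth a \<Longrightarrow> length (inflation a ! i) = uheight a"
  by (cases a; auto simp: uwidth_def uheight_def less_Suc_eq)+

lemma edge_nth:
  "right_edge a = left_edge b \<longleftrightarrow> uheight a = uheight b \<and>
     (\<forall>j<uheight a. right_color (ucolors (inflation a ! (uwidth a - 1) ! j)) = left_color (ucolors (inflation b ! 0 ! j)))"
  "top_edge a = bottom_edge b \<longleftrightarrow> uwidth a = uwidth b \<and>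
     (\<forall>i<uwidth a. top_color (ucolors (inflation a ! i ! (uheight a - 1))) = bottom_color (ucolors (inflation b ! i ! 0)))"
proof -
  have 1: "last (inflation a) = inflation a ! (uwidth a - 1)" "hd (inflation a) = inflation a ! 0" for a
    using inflation_shape(1)[of a] by (auto simp: uwidth_def last_conv_nth hd_conv_nth)
  have 2: "last (inflation a ! i) = inflation a ! i ! (uheight a - 1)" "hd (inflation a ! i) = inflation a ! i ! 0"
    if "i < uwidth a" for a i
  proof -
    have "inflation a ! i \<noteq> []" using inflation_shape(2)[of a] inflation_shape(3)[OF that] by force
    then show "last (inflation a ! i) = inflation a ! i ! (uheight a - 1)" "hd (inflation a ! i) = inflation a ! i ! 0"
      using inflation_shape(3)[OF that] by (simp_all add: last_conv_nth hd_conv_nth)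
  qed
  show "right_edge a = left_edge b \<longleftrightarrow> uheight a = uheight b \<and>
     (\<forall>j<uheight a. right_color (ucolors (inflation a ! (uwidth a - 1) ! j)) = left_color (ucolors (inflation b ! 0 ! j)))"
    using inflation_shape(1)[of a] inflation_shape(1)[of b] inflation_shape(3)[of "uwidth a - 1" a] inflation_shape(3)[of 0 b]
    by (auto simp: right_edge_def left_edge_def 1 list_eq_iff_nth_eq)
  show "top_edge a = bottom_edge b \<longleftrightarrow> uwidth a = uwidth b \<and>
     (\<forall>i<uwidth a. top_color (ucolors (inflation a ! i ! (uheight a - 1))) = bottom_color (ucolors (inflation b ! i ! 0)))"
    using 2 by (auto simp: top_edge_def bottom_edge_def list_eq_iff_nth_eq uwidth_def)
qed

lemma inflation_inner:
  "Suc i < uwidth a \<Longrightarrow> j < uheight a \<Longrightarrow> h_match (inflation a ! i ! j) (inflation a ! Suc i ! j)"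
  "i < uwidth a \<Longrightarrow> Suc j < uheight a \<Longrightarrow> v_match (inflation a ! i ! j) (inflation a ! i ! Suc j)"
  "i < uwidth a \<Longrightarrow> j < uheight a \<Longrightarrow> joins_left (inflation a ! i ! j) \<longleftrightarrow> i \<noteq> 0"
  "i < uwidth a \<Longrightarrow> j < uheight a \<Longrightarrow> joins_below (inflation a ! i ! j) \<longleftrightarrow> j \<noteq> 0"
  by (cases a; auto simp: uwidth_def uheight_def less_Suc_eq h_match_def v_match_def joins_left_def joins_below_def)+

lemma inj_utile_code: "inj utile_code"
proof (rule injI)
  fix a b assume "utile_code a = utile_code b"
  then have "ucolors a = ucolors b"
    unfolding utile_code_def recolor_def by (cases "ucolors a"; cases "ucolors b") simp
  then show "a = b" using utile_pairs[OF utile_checks(2), of a b] by (simp add: joins_agree_def)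
qed

lemma nth_nth_eqI:
  assumes "length xs = length ys" "\<And>i. i < length xs \<Longrightarrow> length (xs ! i) = length (ys ! i)"
    "\<And>i j. i < length xs \<Longrightarrow> j < length (xs ! i) \<Longrightarrow> xs ! i ! j = ys ! i ! j"
  shows "xs = ys"
  using assms by (intro nth_equalityI) auto

text \<open>The source and target tiles coincide here, so the resulting morphism maps the Wang shift
  to itself and can be iterated.\<close>

interpretation U: wang_substitution UNIV utile_code "range utile_code" uwidth uheight
  "\<lambda>a i j. utile_code (inflation a ! i ! j)"
  "\<lambda>r. \<not> joins_left (inv utile_code r)" "\<lambda>r. \<not> joins_below (inv utile_code r)" 2
proof unfold_locales
  have inv: "inv utile_code (utile_code a) = a" for a by (simp add: inj_utile_code)
  show "inj utile_code" by (rule inj_utile_code)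
  show "0 < uwidth a" "0 < uheight a" for a by (rule inflation_shape)+
  show "right_color (utile_code (inflation a ! i ! j)) = left_color (utile_code (inflation a ! Suc i ! j))"
    if "Suc i < uwidth a" "j < uheight a" for a i j
    using inflation_inner(1)[OF that] by (simp add: utile_code_def h_match_def)
  show "top_color (utile_code (inflation a ! i ! j)) = bottom_color (utile_code (inflation a ! i ! Suc j))"
    if "i < uwidth a" "Suc j < uheight a" for a i j
    using inflation_inner(2)[OF that] by (simp add: utile_code_def v_match_def)
  show "right_color (utile_code a) = left_color (utile_code b) \<longleftrightarrow> uheight a = uheight b \<and>
     (\<forall>j<uheight a. right_color (utile_code (inflation a ! (uwidth a - 1) ! j)) = left_color (utile_code (inflation b ! 0 ! j)))"
    for a b
    using utile_pairs[OF utile_checks(1), of a b] edge_nth(1)[of a b]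
    by (simp add: edges_agree_def h_match_def utile_code_def)
  show "top_color (utile_code a) = bottom_color (utile_code b) \<longleftrightarrow> uwidth a = uwidth b \<and>
     (\<forall>i<uwidth a. top_color (utile_code (inflation a ! i ! (uheight a - 1))) = bottom_color (utile_code (inflation b ! i ! 0)))"
    for a b
    using utile_pairs[OF utile_checks(1), of a b] edge_nth(2)[of a b]
    by (simp add: edges_agree_def v_match_def utile_code_def)
  show "(\<not> joins_left (inv utile_code r)) = (\<not> joins_left (inv utile_code s))"
    if "r \<in> range utile_code" "s \<in> range utile_code" "top_color r = bottom_color s" for r s
  proof -
    obtain a b where ab: "r = utile_code a" "s = utile_code b" using \<open>r \<in> _\<close> \<open>s \<in> _\<close> by blast
    then have "v_match a b" using \<open>top_color r = _\<close> by (simp add: utile_code_def v_match_def)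
    then show ?thesis using utile_pairs[OF utile_checks(2), of a b] by (simp add: joins_agree_def inv ab)
  qed
  show "(\<not> joins_below (inv utile_code r)) = (\<not> joins_below (inv utile_code s))"
    if "r \<in> range utile_code" "s \<in> range utile_code" "right_color r = left_color s" for r s
  proof -
    obtain a b where ab: "r = utile_code a" "s = utile_code b" using \<open>r \<in> _\<close> \<open>s \<in> _\<close> by blast
    then have "h_match a b" using \<open>right_color r = _\<close> by (simp add: utile_code_def h_match_def)
    then show ?thesis using utile_pairs[OF utile_checks(2), of a b] by (simp add: joins_agree_def inv ab)
  qed
  show "(\<not> joins_left (inv utile_code (utile_code (inflation a ! i ! j)))) = (i = 0)"
    "(\<not> joins_below (inv utile_code (utile_code (inflation a ! i ! j)))) = (j = 0)"
    if "i < uwidth a" "j < uheight a" for a i j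
    using inflation_inner(3,4)[OF that] by (simp_all add: inv)
  show "a = b" if "uwidth a = uwidth b" "uheight a = uheight b"
    "\<forall>i<uwidth a. \<forall>j<uheight a. utile_code (inflation a ! i ! j) = utile_code (inflation b ! i ! j)" for a b
  proof -
    have "inflation a = inflation b"
      using that inflation_shape(3) inj_utile_code
      by (intro nth_nth_eqI) (auto simp: uwidth_def inj_eq)
    then show "a = b" using utile_pairs[OF utile_checks(2), of a b] by (simp add: joins_agree_def)
  qed
  fix y :: "nat tile config" assume "y \<in> wang_shift (range utile_code)"
  then obtain v where v: "v \<in> utilings" "y = utile_code \<circ> v" by (auto simp: wang_shift_image)
  have y: "inv utile_code (y p) = v p" for p by (simp add: v inv)
  have cut: "desubstitutable (patch_at v m n)" "isolated_below (patch_at v m n)" for m n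
    using patch_at_surviving[OF v(1), of m n] surviving_cut unfolding every_iff by blast+
  have iso: "joins_left (v (m, n)) \<Longrightarrow> \<not> joins_left (v (m + 1, n))"
    "joins_below (v (m, n)) \<Longrightarrow> \<not> joins_below (v (m, n + 1))" for m n
    using cut[of m n] by (simp_all add: patch_at_def)
  show "\<exists>i<2. \<not> joins_left (inv utile_code (y (int i, 0)))"
    using iso(1)[of 0 0] by (cases "joins_left (v (0, 0))") (auto simp: y intro: exI[of _ 0] exI[of _ 1])
  show "\<exists>i<2. \<not> joins_below (inv utile_code (y (0, int i)))"
    using iso(2)[of 0 0] by (cases "joins_below (v (0, 0))") (auto simp: y intro: exI[of _ 0] exI[of _ 1])
  fix w h :: nat
  assume w: "0 < w" "\<forall>i<w. (\<not> joins_left (inv utile_code (y (int i, 0)))) = (i = 0)"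
      "\<not> joins_left (inv utile_code (y (int w, 0)))"
    and h: "0 < h" "\<forall>i<h. (\<not> joins_below (inv utile_code (y (0, int i)))) = (i = 0)"
      "\<not> joins_below (inv utile_code (y (0, int h)))"
  have a: "\<not> joins_left (v (0, 0))" "\<not> joins_below (v (0, 0))"
    using w(2)[rule_format, OF w(1)] h(2)[rule_format, OF h(1)] by (simp_all add: y)
  then obtain e where e: "inflation e = cut_block (patch_at v 0 0)"
    using cut(1)[of 0 0] by (auto simp: patch_at_def some_iff equals_inflation_def)
  \<comment> \<open>The next cut is one step away, unless the right neighbor joins to the left; then
    it is two steps away, because joining tiles are isolated.\<close>
  have w': "w = (if joins_left (v (1, 0)) then 2 else 1)"
  proof (cases "joins_left (v (1, 0))")
    case True
    then have "\<not> joins_left (v (2, 0))" using iso(1)[of 1 0] by simp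
    then have "\<not> 2 < w" using w(2)[rule_format, of 2] by (auto simp: y)
    moreover have "w \<noteq> 1" using w(3) True by (auto simp: y)
    ultimately show ?thesis using w(1) True by simp
  next
    case False
    then have "\<not> 1 < w" using w(2)[rule_format, of 1] by (auto simp: y)
    then show ?thesis using w(1) False by simp
  qed
  have h': "h = (if joins_below (v (0, 1)) then 2 else 1)"
  proof (cases "joins_below (v (0, 1))")
    case True
    then have "\<not> joins_below (v (0, 2))" using iso(2)[of 0 1] by simp
    then have "\<not> 2 < h" using h(2)[rule_format, of 2] by (auto simp: y)
    moreover have "h \<noteq> 1" using h(3) True by (auto simp: y)
    ultimately show ?thesis using h(1) True by simp
  next
    case False
    then have "\<not> 1 < h" using h(2)[rule_format, of 1] by (auto simp: y)
    then show ?thesis using h(1) False by simp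
  qed
  show "\<exists>a\<in>UNIV. uwidth a = w \<and> uheight a = h \<and> (\<forall>i<w. \<forall>j<h. y (int i, int j) = utile_code (inflation a ! i ! j))"
    by (intro bexI[of _ e]) (auto simp: uwidth_def uheight_def e w' h' patch_at_def v less_Suc_eq numeral_2_eq_2)
qed auto

section \<open>Patches in the image of a tiling\<close>

abbreviation cut_into :: "utile config \<Rightarrow> (int \<Rightarrow> int) \<Rightarrow> (int \<Rightarrow> int) \<Rightarrow> utile config \<Rightarrow> bool" where
  "cut_into \<equiv> covers uwidth uheight (\<lambda>a i j. inflation a ! i ! j)"

lemma cut_into_code: "covers uwidth uheight (\<lambda>a i j. utile_code (inflation a ! i ! j)) u P Q (utile_code \<circ> v)
    \<longleftrightarrow> cut_into u P Q v"
  by (simp add: covers_def inj_eq[OF inj_utile_code])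

lemma utilings_cut:
  assumes "v \<in> utilings"
  obtains u and P Q :: "int \<Rightarrow> int" where "u \<in> utilings" "cut_into u P Q v"
proof -
  have "utile_code \<circ> v \<in> wang_shift (range utile_code)" using assms by (auto simp: wang_shift_image)
  then show thesis by (rule U.desubstitute) (use that cut_into_code in blast)
qed

lemma adjacent_columns_map:
  "adjacent_columns (map f [a..<b]) (map g [a..<b]) = map (\<lambda>j. (f j, g j, f (Suc j), g (Suc j))) [a..<b - 1]"
proof (induction "b - a" arbitrary: a)
  case (Suc k)
  then have ab: "a < b" by simp
  show ?case
  proof (cases "Suc a < b")
    case True
    then have "[a..<b - 1] = a # [Suc a..<b - 1]" by (intro upt_conv_Cons) simp
    then show ?thesis
      using Suc(1)[of "Suc a"] Suc(2) upt_conv_Cons[OF ab] upt_conv_Cons[OF True] by simp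
  next
    case False
    then show ?thesis using ab by (simp add: upt_conv_Cons)
  qed
qed simp

lemma subpatches_map:
  "subpatches (map F [a..<b]) = concat (map (\<lambda>i. adjacent_columns (F i) (F (Suc i))) [a..<b - 1])"
proof (induction "b - a" arbitrary: a)
  case (Suc k)
  then have ab: "a < b" by simp
  show ?case
  proof (cases "Suc a < b")
    case True
    then have "[a..<b - 1] = a # [Suc a..<b - 1]" by (intro upt_conv_Cons) simp
    then show ?thesis
      using Suc(1)[of "Suc a"] Suc(2) upt_conv_Cons[OF ab] upt_conv_Cons[OF True] by simp
  next
    case False
    then show ?thesis using ab by (simp add: upt_conv_Cons)
  qed
qed simp

text \<open>This turns computations with lists of columns into statements about tilings. The four
  images fit together into a rectangle because widths and heights are compatible in
  \<open>u\<close>.\<close>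

lemma juxtapose_cut:
  assumes u: "u \<in> utilings" and c: "cut_into u P Q v"
  shows "juxtapose (patch_at u m n) =
    map (\<lambda>i. map (\<lambda>j. v (P m + int i, Q n + int j)) [0..<uheight (u (m, n)) + uheight (u (m, n + 1))])
      [0..<uwidth (u (m, n)) + uwidth (u (m + 1, n))]"
proof (rule nth_nth_eqI)
  note comp = U.tilings_compatible[OF u]
  have W: "uwidth (u (m, n + 1)) = uwidth (u (m, n))" "uwidth (u (m + 1, n + 1)) = uwidth (u (m + 1, n))"
    and H: "uheight (u (m + 1, n)) = uheight (u (m, n))" "uheight (u (m + 1, n + 1)) = uheight (u (m, n + 1))"
    using comp by (auto simp: compatible_def)
  have P: "P (m + 1) = P m + int (uwidth (u (m, n)))" and Q: "Q (n + 1) = Q n + int (uheight (u (m, n)))"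
    using coversD(1,2)[OF c] by blast+
  have len: "length (inflation a) = uwidth a" for a by (simp add: uwidth_def)
  let ?r = "map (\<lambda>i. map (\<lambda>j. v (P m + int i, Q n + int j)) [0..<uheight (u (m, n)) + uheight (u (m, n + 1))])
      [0..<uwidth (u (m, n)) + uwidth (u (m + 1, n))]"
  let ?j = "juxtapose (patch_at u m n)"
  show l: "length ?j = length ?r"
    by (simp add: patch_at_def len W)
  have nth: "?j ! i = (if i < uwidth (u (m, n)) then inflation (u (m, n)) ! i @ inflation (u (m, n + 1)) ! i
      else inflation (u (m + 1, n)) ! (i - uwidth (u (m, n))) @ inflation (u (m + 1, n + 1)) ! (i - uwidth (u (m, n))))"
    if "i < uwidth (u (m, n)) + uwidth (u (m + 1, n))" for i
    using that by (auto simp: patch_at_def nth_append len W)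
  fix i assume "i < length ?j"
  then have i: "i < uwidth (u (m, n)) + uwidth (u (m + 1, n))" using l by simp
  show l2: "length (?j ! i) = length (?r ! i)"
    using i by (auto simp: nth inflation_shape(3) W H)
  fix j assume "j < length (?j ! i)"
  then have j: "j < uheight (u (m, n)) + uheight (u (m, n + 1))" using l2 i by simp
  have r: "?r ! i ! j = v (P m + int i, Q n + int j)" using i j by simp
  show "?j ! i ! j = ?r ! i ! j"
  proof (cases "i < uwidth (u (m, n))")
    case True
    show ?thesis
    proof (cases "j < uheight (u (m, n))")
      case jT: True
      then show ?thesis unfolding r nth[OF i] using True coversD(3)[OF c True jT]
        by (simp add: nth_append inflation_shape(3))
    next
      case False
      then have "j - uheight (u (m, n)) < uheight (u (m, n + 1))" using j by simp
      from coversD(3)[OF c _ this, of i] show ?thesis unfolding r nth[OF i] using True False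
        by (simp add: nth_append inflation_shape(3) W Q of_nat_diff)
    qed
  next
    case iF: False
    then have i': "i - uwidth (u (m, n)) < uwidth (u (m + 1, n))" using i by simp
    show ?thesis
    proof (cases "j < uheight (u (m, n))")
      case True
      then show ?thesis unfolding r nth[OF i] using iF coversD(3)[OF c i', of j] i'
        by (simp add: nth_append inflation_shape(3) P H of_nat_diff)
    next
      case False
      then have "j - uheight (u (m, n)) < uheight (u (m + 1, n + 1))" using j H by simp
      from coversD(3)[OF c _ this, of "i - uwidth (u (m, n))"] show ?thesis unfolding r nth[OF i]
        using iF False i' by (simp add: nth_append inflation_shape(3) P Q W H of_nat_diff)
    qed
  qed
qed

lemma subpatches_cut:
  assumes u: "u \<in> utilings" and c: "cut_into u P Q v"
  shows "set (subpatches (juxtapose (patch_at u m n))) =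
    {patch_at v (P m + int i) (Q n + int j) | i j.
       i < uwidth (u (m, n)) + uwidth (u (m + 1, n)) - 1 \<and> j < uheight (u (m, n)) + uheight (u (m, n + 1)) - 1}"
  unfolding juxtapose_cut[OF assms] subpatches_map adjacent_columns_map
  by (auto simp: patch_at_def algebra_simps image_iff Bex_def atLeast0LessThan)

text \<open>A patch of \<open>v\<close> that starts in block \<open>(m, n)\<close> reaches at most
  into the next block column and the next block row. It therefore lies in the image of a patch of
  \<open>u\<close>, which is among the surviving ones.\<close>

lemma patch_at_patches:
  assumes v: "v \<in> utilings" shows "patch_at v p q \<in> set patches"
proof -
  obtain u P Q where u: "u \<in> utilings" "cut_into u P Q v" using utilings_cut[OF v] by blast
  obtain m n i j where *: "p = P m + int i" "q = Q n + int j" "i < uwidth (u (m, n))" "j < uheight (u (m, n))"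
    using covers_cell[OF u(2) U.tilings_compatible[OF u(1)]] by metis
  have "i < uwidth (u (m, n)) + uwidth (u (m + 1, n)) - 1" "j < uheight (u (m, n)) + uheight (u (m, n + 1)) - 1"
    using *(3,4) inflation_shape(1)[of "u (m + 1, n)"] inflation_shape(2)[of "u (m, n + 1)"] by linarith+
  then have "patch_at v p q \<in> set (subpatches (juxtapose (patch_at u m n)))"
    unfolding subpatches_cut[OF u] * by blast
  then show ?thesis
    using patch_at_surviving[OF u(1), of m n] images_of_surviving
    by (auto simp: every_iff images_in_def memb_iff)
qed

section \<open>Primitivity of the substitution on patches\<close>

definition image_patches :: "upatch \<Rightarrow> upatch list" where
  "image_patches q = subpatches (juxtapose q)"

primrec dedup :: "'s list \<Rightarrow> 's list \<Rightarrow> 's list" where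
  "dedup ys [] = ys"
| "dedup ys (x # xs) = (if memb ys x then dedup ys xs else dedup (x # ys) xs)"

definition forward :: "upatch list \<Rightarrow> upatch list" where
  "forward S = dedup [] (concat (map image_patches S))"

definition leads_to :: "upatch list \<Rightarrow> upatch \<Rightarrow> bool" where
  "leads_to S q = some (memb S) (image_patches q)"

definition backward :: "upatch list \<Rightarrow> upatch list" where
  "backward S = filter (leads_to S) patches"

text \<open>The chosen patch is a hub: every patch leads to it in three steps, and from it every
  patch is reached in five. Hence every patch leads to every other in eight.\<close>

lemma patches_primitive:
  "every (memb ((backward ^^ 3) [(U11,U17,U1,U3)])) patches"
  "every (memb ((forward ^^ 5) [(U11,U17,U1,U3)])) patches"
  by code_simp+

lemma set_dedup: "set (dedup ys xs) = set ys \<union> set xs"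
  by (induction xs arbitrary: ys) (auto simp: memb_iff)

definition occurs :: "upatch \<Rightarrow> utile config \<Rightarrow> bool" where
  "occurs q x \<longleftrightarrow> (\<exists>m n. patch_at x m n = q)"

lemma occurs_image:
  assumes "u \<in> utilings" "cut_into u P Q v" "occurs q u" "r \<in> set (image_patches q)"
  shows "occurs r v"
proof -
  obtain m n where "q = patch_at u m n" using assms(3) unfolding occurs_def by blast
  with assms(4) have "r \<in> set (subpatches (juxtapose (patch_at u m n)))" by (simp add: image_patches_def)
  then show ?thesis unfolding subpatches_cut[OF assms(1,2)] occurs_def by blast
qed

text \<open>The hypothesis concerns all tilings, so it may be used for the desubstitution of
  \<open>v\<close>: some patch there has a member of \<open>S\<close> in its image.\<close>

lemma occurs_backward:
  assumes "\<And>x. x \<in> utilings \<Longrightarrow> \<exists>q\<in>set (backward S). occurs q x" and v: "v \<in> utilings"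
  shows "\<exists>q\<in>set S. occurs q v"
proof -
  obtain u P Q where u: "u \<in> utilings" "cut_into u P Q v" using utilings_cut[OF v] by blast
  then obtain q where "q \<in> set (backward S)" "occurs q u" using assms(1) by blast
  moreover from this(1) obtain r where "r \<in> set (image_patches q)" "r \<in> set S"
    unfolding backward_def leads_to_def set_filter mem_Collect_eq some_iff memb_iff by blast
  ultimately show ?thesis using occurs_image[OF u] by blast
qed

lemma occurs_forward:
  assumes "\<And>x q. x \<in> utilings \<Longrightarrow> q \<in> set S \<Longrightarrow> occurs q x" and v: "v \<in> utilings" and r: "r \<in> set (forward S)"
  shows "occurs r v"
proof -
  obtain u P Q where u: "u \<in> utilings" "cut_into u P Q v" using utilings_cut[OF v] by blast
  obtain q where "q \<in> set S" "r \<in> set (image_patches q)"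
    using r unfolding forward_def set_dedup set_concat set_map by auto
  then show ?thesis using assms(1)[OF u(1)] occurs_image[OF u] by blast
qed

lemma occurs_all:
  assumes "x \<in> utilings" "q \<in> set patches" shows "occurs q x"
proof -
  let ?S = "[(U11,U17,U1,U3)]"
  have 3: "\<exists>q\<in>set ((backward ^^ 3) ?S). occurs q x" if "x \<in> utilings" for x
    using patch_at_patches[OF that, of 0 0] patches_primitive(1) unfolding occurs_def every_iff memb_iff by blast
  have "(\<forall>x\<in>utilings. \<exists>q\<in>set ((backward ^^ k) S). occurs q x) \<longrightarrow> (\<forall>x\<in>utilings. \<exists>q\<in>set S. occurs q x)" for k S
    by (induction k) (use occurs_backward in auto)
  with 3 have "occurs q x" if "x \<in> utilings" "q \<in> set ?S" for x q
    using that by (metis empty_iff empty_set set_ConsD)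
  then have "\<forall>x\<in>utilings. \<forall>q\<in>set ((forward ^^ k) ?S). occurs q x" for k
  proof (induction k)
    case (Suc k)
    then show ?case using occurs_forward[of "(forward ^^ k) ?S"] unfolding funpow.simps comp_def by blast
  qed simp
  then show ?thesis using assms patches_primitive(2) unfolding every_iff memb_iff by blast
qed

section \<open>Minimality and aperiodicity\<close>

definition same_window :: "'a config \<Rightarrow> int \<Rightarrow> int \<Rightarrow> 'a config \<Rightarrow> int \<Rightarrow> int \<Rightarrow> int \<Rightarrow> int \<Rightarrow> bool" where
  "same_window x a b z m n s t \<longleftrightarrow>
     (\<forall>i j. 0 \<le> i \<longrightarrow> i < s \<longrightarrow> 0 \<le> j \<longrightarrow> j < t \<longrightarrow> x (a + i, b + j) = z (m + i, n + j))"

text \<open>Equal letters have equal blocks, so inside the two windows the lines between blocks run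
  in parallel. Agreement of the preimages on a window of letters thus becomes agreement on
  everything these letters cover.\<close>

lemma same_window_cut:
  assumes y: "y \<in> utilings" "cut_into y P Q z" and w: "w \<in> utilings" "cut_into w P' Q' x"
    and s: "same_window w a b y m n s t" "0 < s" "0 < t"
  shows "same_window x (P' a) (Q' b) z (P m) (Q n) (P (m + s) - P m) (Q (n + t) - Q n)"
proof -
  note compy = U.tilings_compatible[OF y(1)]
  have P': "P' (a + int k) - P' a = P (m + int k) - P m" if "int k \<le> s" for k
    using that
  proof (induction k)
    case (Suc k)
    have "w (a + int k, b + 0) = y (m + int k, n + 0)"
      by (rule s(1)[unfolded same_window_def, rule_format]) (use s(3) Suc.prems in auto)
    then show ?case
      using Suc coversD(1)[OF y(2), of "m + int k" n] coversD(1)[OF w(2), of "a + int k" b]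
      by (simp add: algebra_simps)
  qed simp
  have Q': "Q' (b + int k) - Q' b = Q (n + int k) - Q n" if "int k \<le> t" for k
    using that
  proof (induction k)
    case (Suc k)
    have "w (a + 0, b + int k) = y (m + 0, n + int k)"
      by (rule s(1)[unfolded same_window_def, rule_format]) (use s(2) Suc.prems in auto)
    then show ?case
      using Suc coversD(2)[OF y(2), of "n + int k" m] coversD(2)[OF w(2), of "b + int k" a]
      by (simp add: algebra_simps)
  qed simp
  have smP: "strict_mono P" and smQ: "strict_mono Q"
    using covers_steps[OF y(2) compy] by (auto intro: strict_mono_int)
  show ?thesis
    unfolding same_window_def
  proof (intro allI impI)
    fix p q assume p: "0 \<le> p" "p < P (m + s) - P m" and q: "0 \<le> q" "q < Q (n + t) - Q n"
    obtain m' n' i j where *: "P m + p = P m' + int i" "Q n + q = Q n' + int j"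
      "i < uwidth (y (m', n'))" "j < uheight (y (m', n'))" "z (P m + p, Q n + q) = inflation (y (m', n')) ! i ! j"
      using covers_cell[OF y(2) compy] by metis
    have "P m < P (m' + 1)" "P m' < P (m + s)"
      using *(1,3) p coversD(1)[OF y(2), of m' n'] by linarith+
    then have m': "m \<le> m'" "m' < m + s" using strict_mono_less[OF smP] by auto
    have "Q n < Q (n' + 1)" "Q n' < Q (n + t)"
      using *(2,4) q coversD(2)[OF y(2), of n' m'] by linarith+
    then have n': "n \<le> n'" "n' < n + t" using strict_mono_less[OF smQ] by auto
    define k l where "k = nat (m' - m)" and "l = nat (n' - n)"
    have kl: "m' = m + int k" "n' = n + int l" "int k < s" "int l < t" using m' n' by (auto simp: k_def l_def)
    have eq: "w (a + int k, b + int l) = y (m', n')"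
      unfolding kl(1,2) by (rule s(1)[unfolded same_window_def, rule_format]) (use kl in auto)
    have "P' a + p = P' (a + int k) + int i" "Q' b + q = Q' (b + int l) + int j"
      using P'[of k] Q'[of l] kl *(1,2) by auto
    then show "x (P' a + p, Q' b + q) = z (P m + p, Q n + q)"
      using coversD(3)[OF w(2), of i "a + int k" "b + int l" j] *(3-5) eq by simp
  qed
qed

text \<open>In every image the first column consists of letters of width 2 and the first row of
  letters of height 2, all others having size 1 in that direction. It follows that two inflations
  stretch every letter to at least two columns and two rows, and that inflated configurations stay
  compatible.\<close>

lemma double_inflation:
  "uwidth a = 1 \<Longrightarrow> uwidth (inflation a ! 0 ! 0) = 2" "uheight a = 1 \<Longrightarrow> uheight (inflation a ! 0 ! 0) = 2"
  "i < uwidth a \<Longrightarrow> j < uheight a \<Longrightarrow> uwidth (inflation a ! i ! j) = (if i = 0 then 2 else 1)"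
  "i < uwidth a \<Longrightarrow> j < uheight a \<Longrightarrow> uheight (inflation a ! i ! j) = (if j = 0 then 2 else 1)"
  by (cases a; auto simp: uwidth_def uheight_def less_Suc_eq)+

lemma two_steps_aux:
  fixes F G :: "int \<Rightarrow> int"
  assumes F: "\<And>k. F k < F (k + 1)" and G: "G k < G (k + 1)" "G (k + 1) = G k + 1 \<Longrightarrow> F (G k + 1) = F (G k) + 2"
  shows "F (G k) + 2 \<le> F (G (k + 1))"
proof (cases "G (k + 1) = G k + 1")
  case False
  then have "G k + 1 + 1 \<le> G (k + 1)" using G(1) by simp
  then have "F (G k + 1 + 1) \<le> F (G (k + 1))"
    using strict_mono_less_eq[OF strict_mono_int[of F, OF F]] by blast
  then show ?thesis using F[of "G k"] F[of "G k + 1"] by linarith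
qed (use G(2) in simp)

lemma two_steps:
  assumes y: "y \<in> utilings" "cut_into y P Q z" and y': "y' \<in> utilings" "cut_into y' P' Q' y"
  shows "P (P' k) + 2 \<le> P (P' (k + 1))" "Q (Q' k) + 2 \<le> Q (Q' (k + 1))"
proof -
  note steps = covers_steps[OF y(2) U.tilings_compatible[OF y(1)]]
    and steps' = covers_steps[OF y'(2) U.tilings_compatible[OF y'(1)]]
  show "P (P' k) + 2 \<le> P (P' (k + 1))"
  proof (rule two_steps_aux[where F = P and G = P' and k = k, OF steps(1) steps'(1)])
    assume "P' (k + 1) = P' k + 1"
    then show "P (P' k + 1) = P (P' k) + 2"
      using coversD(1)[OF y(2), of "P' k" "Q' 0"] coversD(1)[OF y'(2), of k 0]
        coversD(3)[OF y'(2), of 0 k 0 0] inflation_shape(1,2) double_inflation(1)[of "y' (k, 0)"] by simp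
  qed
  show "Q (Q' k) + 2 \<le> Q (Q' (k + 1))"
  proof (rule two_steps_aux[where F = Q and G = Q' and k = k, OF steps(2) steps'(2)])
    assume "Q' (k + 1) = Q' k + 1"
    then show "Q (Q' k + 1) = Q (Q' k) + 2"
      using coversD(2)[OF y(2), of "Q' k" "P' 0"] coversD(2)[OF y'(2), of k 0]
        coversD(3)[OF y'(2), of 0 0 k 0] inflation_shape(1,2) double_inflation(2)[of "y' (0, k)"] by simp
  qed
qed

lemma steps_growth:
  fixes F :: "int \<Rightarrow> int"
  assumes "\<And>k. F k + 2 \<le> F (k + 1)" shows "F m + 2 * int s \<le> F (m + int s)"
proof (induction s)
  case (Suc s)
  then show ?case using assms[of "m + int s"] by (simp add: algebra_simps)
qed simp

text \<open>A window of side \<open>s + 3\<close> lies in the twofold image of one of side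
  \<open>s + 2\<close>: the first block contains its corner, and each of the \<open>s + 1\<close>
  further blocks adds at least two positions. Each induction step desubstitutes twice because a
  single inflation can leave a letter at width or height 1.\<close>

lemma same_window_exists:
  assumes "x \<in> utilings" "z \<in> utilings"
  shows "\<exists>a b. same_window x a b z m n (int s + 2) (int s + 2)"
  using assms
proof (induction s arbitrary: x z m n)
  case 0
  have "occurs (patch_at z m n) x" using 0 occurs_all patch_at_patches by blast
  then obtain a b where ab: "patch_at x a b = patch_at z m n" by (auto simp: occurs_def)
  have "same_window x a b z m n 2 2"
    unfolding same_window_def
  proof (intro allI impI)
    fix i j :: int assume "0 \<le> i" "i < 2" "0 \<le> j" "j < 2"
    then have "i = 0 \<or> i = 1" "j = 0 \<or> j = 1" by linarith+
    then show "x (a + i, b + j) = z (m + i, n + j)" using ab by (auto simp: patch_at_def)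
  qed
  then show ?case by auto
next
  case (Suc s)
  obtain y P Q where y: "y \<in> utilings" "cut_into y P Q z" using utilings_cut[OF Suc.prems(2)] by blast
  obtain y' P1 Q1 where y': "y' \<in> utilings" "cut_into y' P1 Q1 y" using utilings_cut[OF y(1)] by blast
  obtain w P' Q' where w: "w \<in> utilings" "cut_into w P' Q' x" using utilings_cut[OF Suc.prems(1)] by blast
  obtain w' P1' Q1' where w': "w' \<in> utilings" "cut_into w' P1' Q1' w" using utilings_cut[OF w(1)] by blast
  note steps = covers_steps[OF y(2) U.tilings_compatible[OF y(1)]]
  note steps' = covers_steps[OF y'(2) U.tilings_compatible[OF y'(1)]]
  have sm: "strict_mono P" "strict_mono Q" "strict_mono P1" "strict_mono Q1"
    using steps steps' by (auto intro: strict_mono_int)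
  obtain m0 where m0: "P m0 \<le> m" "m < P (m0 + 1)" using steps_cover[of P m] steps(1) by blast
  obtain n0 where n0: "Q n0 \<le> n" "n < Q (n0 + 1)" using steps_cover[of Q n] steps(2) by blast
  obtain m1 where m1: "P1 m1 \<le> m0" "m0 < P1 (m1 + 1)" using steps_cover[of P1 m0] steps'(1) by blast
  obtain n1 where n1: "Q1 n1 \<le> n0" "n0 < Q1 (n1 + 1)" using steps_cover[of Q1 n0] steps'(2) by blast
  let ?s = "int s + 2"
  obtain a b where "same_window w' a b y' m1 n1 ?s ?s" using Suc.IH[OF w'(1) y'(1)] by blast
  from same_window_cut[OF y' w' this]
  have 1: "same_window w (P1' a) (Q1' b) y (P1 m1) (Q1 n1) (P1 (m1 + ?s) - P1 m1) (Q1 (n1 + ?s) - Q1 n1)" by simp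
  have pos: "0 < P1 (m1 + ?s) - P1 m1" "0 < Q1 (n1 + ?s) - Q1 n1"
    using strict_mono_less[OF sm(3), of m1 "m1 + ?s"] strict_mono_less[OF sm(4), of n1 "n1 + ?s"] by simp_all
  have 2: "same_window x (P' (P1' a)) (Q' (Q1' b)) z (P (P1 m1)) (Q (Q1 n1))
      (P (P1 (m1 + ?s)) - P (P1 m1)) (Q (Q1 (n1 + ?s)) - Q (Q1 n1))"
    using same_window_cut[OF y w 1 pos] by simp
  have "P (P1 m1) \<le> m" "Q (Q1 n1) \<le> n"
    using m0 n0 m1 n1 strict_mono_less_eq[OF sm(1), of "P1 m1" m0] strict_mono_less_eq[OF sm(2), of "Q1 n1" n0] by simp_all
  moreover have "m + 1 \<le> P (P1 (m1 + 1))" "n + 1 \<le> Q (Q1 (n1 + 1))"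
    using m0 n0 m1 n1 strict_mono_less_eq[OF sm(1), of "m0 + 1" "P1 (m1 + 1)"]
      strict_mono_less_eq[OF sm(2), of "n0 + 1" "Q1 (n1 + 1)"] by simp_all
  moreover have "P (P1 (m1 + 1)) + 2 * int (Suc s) \<le> P (P1 (m1 + ?s))"
    "Q (Q1 (n1 + 1)) + 2 * int (Suc s) \<le> Q (Q1 (n1 + ?s))"
    using steps_growth[of "\<lambda>k. P (P1 k)" "m1 + 1" "Suc s", OF two_steps(1)[OF y y']]
      steps_growth[of "\<lambda>k. Q (Q1 k)" "n1 + 1" "Suc s", OF two_steps(2)[OF y y']] by (simp_all add: algebra_simps)
  ultimately have m: "P (P1 m1) \<le> m" "m + (int (Suc s) + 2) \<le> P (P1 (m1 + ?s))"
    and n: "Q (Q1 n1) \<le> n" "n + (int (Suc s) + 2) \<le> Q (Q1 (n1 + ?s))" by simp_all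
  \<comment> \<open>The position of the requested window inside the twofold image.\<close>
  define A B where "A = m - P (P1 m1)" and "B = n - Q (Q1 n1)"
  have "same_window x (P' (P1' a) + A) (Q' (Q1' b) + B) z m n (int (Suc s) + 2) (int (Suc s) + 2)"
    unfolding same_window_def
  proof (intro allI impI)
    fix i j :: int assume ij: "0 \<le> i" "i < int (Suc s) + 2" "0 \<le> j" "j < int (Suc s) + 2"
    have "x (P' (P1' a) + (A + i), Q' (Q1' b) + (B + j)) = z (P (P1 m1) + (A + i), Q (Q1 n1) + (B + j))"
      by (rule 2[unfolded same_window_def, rule_format]) (use ij m n in \<open>simp_all add: A_def B_def\<close>)
    then show "x (P' (P1' a) + A + i, Q' (Q1' b) + B + j) = z (m + i, n + j)"
      by (simp add: A_def B_def add.assoc)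
  qed
  then show ?case by blast
qed

lemma finite_in_box:
  assumes "finite (D :: (int \<times> int) set)"
  obtains b :: nat where "\<And>p. p \<in> D \<Longrightarrow> \<bar>fst p\<bar> \<le> int b \<and> \<bar>snd p\<bar> \<le> int b"
proof -
  have "\<exists>b :: nat. \<forall>p\<in>D. \<bar>fst p\<bar> \<le> int b \<and> \<bar>snd p\<bar> \<le> int b"
    using assms
  proof induction
    case (insert p D)
    then obtain b :: nat where b: "\<forall>p\<in>D. \<bar>fst p\<bar> \<le> int b \<and> \<bar>snd p\<bar> \<le> int b" by blast
    show ?case
    proof (intro exI[of _ "b + nat \<bar>fst p\<bar> + nat \<bar>snd p\<bar>"] ballI)
      fix q assume "q \<in> insert p D"
      then show "\<bar>fst q\<bar> \<le> int (b + nat \<bar>fst p\<bar> + nat \<bar>snd p\<bar>) \<and> \<bar>snd q\<bar> \<le> int (b + nat \<bar>fst p\<bar> + nat \<bar>snd p\<bar>)"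
        using b by force
    qed
  qed auto
  then show thesis using that by blast
qed

text \<open>If a tiling \<open>z\<close> were outside the closed set \<open>Y\<close>, some finite
  window of \<open>z\<close> would rule out membership in \<open>Y\<close>. But this window occurs
  in each tiling of \<open>Y\<close>, and a shift brings it into place.\<close>

lemma minimal_U: "minimal_subshift (wang_shift (range utile_code))"
  unfolding minimal_subshift_def
proof (intro conjI subshift_wang_shift allI impI)
  fix Y :: "nat tile config set"
  assume Y: "subshift Y \<and> Y \<noteq> {} \<and> Y \<subseteq> wang_shift (range utile_code)"
  then obtain x where x: "x \<in> utilings" "utile_code \<circ> x \<in> Y" by (auto simp: wang_shift_image)
  have "z \<in> Y" if z: "z \<in> wang_shift (range utile_code)" for z
  proof (rule ccontr)
    assume "z \<notin> Y"
    moreover have "openin config_topology (- Y)"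
      using Y by (simp add: subshift_def closedin_def Compl_eq_Diff_UNIV)
    ultimately have "\<exists>D. finite D \<and> (\<forall>y. (\<forall>q\<in>D. y q = z q) \<longrightarrow> y \<in> - Y)"
      unfolding openin_config_iff by (elim ballE[of _ _ z]) auto
    then obtain D where D: "finite D" "\<And>y. (\<forall>q\<in>D. y q = z q) \<Longrightarrow> y \<notin> Y" by auto
    obtain b :: nat where b: "\<And>p. p \<in> D \<Longrightarrow> \<bar>fst p\<bar> \<le> int b \<and> \<bar>snd p\<bar> \<le> int b"
      using finite_in_box[OF D(1)] by blast
    obtain v where v: "v \<in> utilings" "z = utile_code \<circ> v" using z by (auto simp: wang_shift_image)
    obtain k l where kl: "same_window x k l v (- int b) (- int b) (int (2 * b) + 2) (int (2 * b) + 2)"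
      using same_window_exists[OF x(1) v(1)] by blast
    define y where "y = shift (k + int b, l + int b) (utile_code \<circ> x)"
    have "y q = z q" if "q \<in> D" for q
    proof -
      have "x (k + (fst q + int b), l + (snd q + int b)) = v (- int b + (fst q + int b), - int b + (snd q + int b))"
        by (rule kl[unfolded same_window_def, rule_format]) (use b[OF that] in auto)
      then show ?thesis by (simp add: y_def v shift_def plus_prod_def algebra_simps)
    qed
    then have "y \<notin> Y" using D(2) by blast
    moreover have "y \<in> Y" unfolding y_def using Y x(2) unfolding subshift_def by blast
    ultimately show False by blast
  qed
  then show "Y = wang_shift (range utile_code)" using Y by blast
qed

section \<open>Absence of periods\<close>

lemma narrow_isolated:
  assumes "u \<in> utilings"
  shows "uwidth (u (m, n)) = 1 \<Longrightarrow> uwidth (u (m + 1, n)) = 2" "uheight (u (m, n)) = 1 \<Longrightarrow> uheight (u (m, n + 1)) = 2"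
proof -
  have joins: "uwidth a = 1 \<longleftrightarrow> joins_left a" "uheight a = 1 \<longleftrightarrow> joins_below a"
    "uwidth a = 1 \<or> uwidth a = 2" "uheight a = 1 \<or> uheight a = 2" for a
    by (cases a; simp add: uwidth_def uheight_def joins_left_def joins_below_def)+
  have "desubstitutable (patch_at u m n)" "isolated_below (patch_at u m n)"
    using patch_at_surviving[OF assms, of m n] surviving_cut unfolding every_iff by blast+
  then have "joins_left (u (m, n)) \<Longrightarrow> \<not> joins_left (u (m + 1, n))"
    "joins_below (u (m, n)) \<Longrightarrow> \<not> joins_below (u (m, n + 1))"
    by (simp_all add: patch_at_def)
  then show "uwidth (u (m, n)) = 1 \<Longrightarrow> uwidth (u (m + 1, n)) = 2"
    "uheight (u (m, n)) = 1 \<Longrightarrow> uheight (u (m, n + 1)) = 2"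
    using joins by blast+
qed

lemma steps_at_least:
  fixes F :: "int \<Rightarrow> int"
  assumes "\<And>k. F k < F (k + 1)" shows "F m + int s \<le> F (m + int s)"
proof (induction s)
  case (Suc s)
  then show ?case using assms[of "m + int s"] by (simp add: algebra_simps)
qed simp

text \<open>A period of the partition into rows and columns spans more positions than blocks, since some
  block is longer than 1.\<close>

lemma period_shrinks:
  fixes F :: "int \<Rightarrow> int"
  assumes step: "\<And>k. F k < F (k + 1)" and long: "F j + 2 \<le> F (j + 1)"
    and period: "\<And>k. F k - p = F (k + a)"
  shows "(p = 0 \<and> a = 0) \<or> (a \<noteq> 0 \<and> \<bar>a\<bar> < \<bar>p\<bar>)"
proof -
  have grow: "F j + int (Suc s) + 1 \<le> F (j + int (Suc s))" for s
    using steps_at_least[of F "j + 1" s, OF step] long by (simp add: algebra_simps)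
  consider "a = 0" | s where "a = int (Suc s)" | s where "a = - int (Suc s)"
  proof (cases a rule: int_cases3)
    case zero
    then show thesis using that by simp
  next
    case (pos n)
    then show thesis using that(2)[of "n - 1"] by simp
  next
    case (neg n)
    then show thesis using that(3)[of "n - 1"] by simp
  qed
  then show ?thesis
  proof cases
    case 1
    then show ?thesis using period[of 0] by simp
  next
    case (2 s)
    then show ?thesis using period[of j] grow[of s] by simp
  next
    case (3 s)
    then show ?thesis using period[of "j + int (Suc s)"] grow[of s] by simp
  qed
qed

lemma utilings_no_period:
  assumes "v \<in> utilings" "shift k v = v" shows "k = 0"
  using assms
proof (induction "nat (\<bar>fst k\<bar> + \<bar>snd k\<bar>)" arbitrary: k v rule: less_induct)
  case less
  obtain u P Q where u: "u \<in> utilings" "cut_into u P Q v" using utilings_cut[OF less.prems(1)] by blast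
  have c: "covers uwidth uheight (\<lambda>a i j. utile_code (inflation a ! i ! j)) u P Q (utile_code \<circ> v)"
    using u(2) by (simp add: cut_into_code)
  have "shift k (utile_code \<circ> v) = utile_code \<circ> v"
    using less.prems(2) by (auto simp: shift_def fun_eq_iff)
  then have c': "covers uwidth uheight (\<lambda>a i j. utile_code (inflation a ! i ! j)) u
      (\<lambda>m. P m - fst k) (\<lambda>n. Q n - snd k) (utile_code \<circ> v)"
    using covers_shift[OF c, of k] by simp
  \<comment> \<open>Shifting by a period gives a second covering of the same configuration by
    \<open>u\<close>. Comparing the two coverings yields a period \<open>(a, b)\<close> of
    \<open>u\<close>.\<close>
  obtain a b where ab: "\<And>m. P m - fst k = P (m + a)" "\<And>n. Q n - snd k = Q (n + b)" "u = shift (a, b) u"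
    using U.covers_unique[OF u(1) c u(1) c'] by metis
  note steps = covers_steps[OF u(2) U.tilings_compatible[OF u(1)]]
  \<comment> \<open>Of two adjacent columns, and of two adjacent rows, at least one has size 2; this
    provides the long block for \<open>period_shrinks\<close>.\<close>
  have "uwidth (u (0, 0)) \<noteq> 1 \<or> uwidth (u (1, 0)) \<noteq> 1" "uheight (u (0, 0)) \<noteq> 1 \<or> uheight (u (0, 1)) \<noteq> 1"
    using narrow_isolated[OF u(1), of 0 0] by auto
  moreover have "P 0 + 2 \<le> P (0 + 1)" if "uwidth (u (0, 0)) \<noteq> 1"
    using that coversD(1)[OF u(2), of 0 0] inflation_shape(1)[of "u (0, 0)"] by linarith
  moreover have "P 1 + 2 \<le> P (1 + 1)" if "uwidth (u (1, 0)) \<noteq> 1"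
    using that coversD(1)[OF u(2), of 1 0] inflation_shape(1)[of "u (1, 0)"] by linarith
  moreover have "Q 0 + 2 \<le> Q (0 + 1)" if "uheight (u (0, 0)) \<noteq> 1"
    using that coversD(2)[OF u(2), of 0 0] inflation_shape(2)[of "u (0, 0)"] by linarith
  moreover have "Q 1 + 2 \<le> Q (1 + 1)" if "uheight (u (0, 1)) \<noteq> 1"
    using that coversD(2)[OF u(2), of 1 0] inflation_shape(2)[of "u (0, 1)"] by linarith
  ultimately obtain i j where "P i + 2 \<le> P (i + 1)" "Q j + 2 \<le> Q (j + 1)" by blast
  then have p: "(fst k = 0 \<and> a = 0) \<or> (a \<noteq> 0 \<and> \<bar>a\<bar> < \<bar>fst k\<bar>)" "(snd k = 0 \<and> b = 0) \<or> (b \<noteq> 0 \<and> \<bar>b\<bar> < \<bar>snd k\<bar>)"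
    using period_shrinks[OF steps(1) _ ab(1)] period_shrinks[OF steps(2) _ ab(2)] by blast+
  show ?case
  proof (rule ccontr)
    assume "k \<noteq> 0"
    then have k: "fst k \<noteq> 0 \<or> snd k \<noteq> 0" by (auto simp: prod_eq_iff)
    then have "nat (\<bar>fst (a, b)\<bar> + \<bar>snd (a, b)\<bar>) < nat (\<bar>fst k\<bar> + \<bar>snd k\<bar>)" using p by auto
    then have "(a, b) = 0" using less.hyps u(1) ab(3) by metis
    then show False using k p by (auto simp: zero_prod_def)
  qed
qed

text \<open>Inflating a constant configuration yields configurations that are valid on ever larger squares,
  although they are invalid across the seams of the initial configuration.\<close>

definition valid_to :: "utile config \<Rightarrow> int \<Rightarrow> bool" where
  "valid_to c L \<longleftrightarrow> (\<forall>p q. 0 \<le> p \<longrightarrow> p < L \<longrightarrow> 0 \<le> q \<longrightarrow> q < L \<longrightarrow>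
     (p + 1 < L \<longrightarrow> h_match (c (p, q)) (c (p + 1, q))) \<and> (q + 1 < L \<longrightarrow> v_match (c (p, q)) (c (p, q + 1))))"

lemma edges_agree_nth:
  "h_match a b \<Longrightarrow> j < uheight a \<Longrightarrow> h_match (inflation a ! (uwidth a - 1) ! j) (inflation b ! 0 ! j)"
  "v_match a b \<Longrightarrow> i < uwidth a \<Longrightarrow> v_match (inflation a ! i ! (uheight a - 1)) (inflation b ! i ! 0)"
  using utile_pairs[OF utile_checks(1), of a b] edge_nth[of a b]
  by (auto simp: edges_agree_def h_match_def v_match_def)

text \<open>By \<open>double_inflation\<close> the width of a letter in an image depends only on its
  column within the block, and its height only on its row. This holds across seams as well, even
  where the tiles do not match.\<close>

lemma compatible_inflated:
  assumes comp: "compatible uwidth uheight c" and c: "cut_into c P Q d"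
  shows "compatible uwidth uheight d"
  unfolding compatible_def
proof (intro allI conjI inflation_shape)
  fix p q
  obtain m n i j where *: "p = P m + int i" "q = Q n + int j" "i < uwidth (c (m, n))" "j < uheight (c (m, n))"
    "d (p, q) = inflation (c (m, n)) ! i ! j"
    using covers_cell[OF c comp] by metis
  have W: "uwidth (c (m, n + 1)) = uwidth (c (m, n))" "uheight (c (m + 1, n)) = uheight (c (m, n))"
    using comp by (auto simp: compatible_def)
  note nbr = covers_next[OF c comp *(3,4), folded *(1,2)]
  show "uwidth (d (p, q + 1)) = uwidth (d (p, q))"
    using nbr(2) double_inflation(3) W * inflation_shape(2) by simp
  show "uheight (d (p + 1, q)) = uheight (d (p, q))"
    using nbr(1) double_inflation(4) W * inflation_shape(1) by simp
qed

text \<open>The block at the origin is 2 by 2 and every block is nonempty, so the first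
  \<open>L\<close> blocks in either direction span at least \<open>L + 1\<close> positions. Adjacent
  positions in the enlarged square lie either in one block or on the two sides of a seam between
  matching letters.\<close>

lemma valid_to_inflated:
  assumes comp: "compatible uwidth uheight c" and c: "cut_into c P Q d" and z: "P 0 = 0" "Q 0 = 0"
    and v: "valid_to c L" and corner: "uwidth (c (0, 0)) = 2" "uheight (c (0, 0)) = 2" and L: "0 < L"
  shows "valid_to d (L + 1)"
proof -
  note steps = covers_steps[OF c comp]
  have sm: "strict_mono P" "strict_mono Q" using steps by (auto intro: strict_mono_int)
  have PL: "L + 1 \<le> P L"
    using steps_at_least[of P 1 "nat (L - 1)", OF steps(1)] coversD(1)[OF c, of 0 0] z corner L by simp
  have QL: "L + 1 \<le> Q L"
    using steps_at_least[of Q 1 "nat (L - 1)", OF steps(2)] coversD(2)[OF c, of 0 0] z corner L by simp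
  show ?thesis
    unfolding valid_to_def
  proof (intro allI impI conjI)
    fix p q assume p: "0 \<le> p" "p < L + 1" and q: "0 \<le> q" "q < L + 1"
    obtain m n i j where *: "p = P m + int i" "q = Q n + int j" "i < uwidth (c (m, n))" "j < uheight (c (m, n))"
      "d (p, q) = inflation (c (m, n)) ! i ! j"
      using covers_cell[OF c comp] by metis
    note P1 = coversD(1)[OF c, of m n] and Q1 = coversD(2)[OF c, of n m]
    have "P 0 < P (m + 1)" "P m < P L" "Q 0 < Q (n + 1)" "Q n < Q L"
      using *(1-4) p q z P1 Q1 PL QL by linarith+
    then have mn: "0 \<le> m" "m < L" "0 \<le> n" "n < L"
      using strict_mono_less[OF sm(1)] strict_mono_less[OF sm(2)] by auto
    show "h_match (d (p, q)) (d (p + 1, q))" if "p + 1 < L + 1"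
    proof (cases "Suc i < uwidth (c (m, n))")
      case True
      then show ?thesis using covers_next(1)[OF c comp *(3,4)] inflation_inner(1)[OF True *(4)] * by simp
    next
      case False
      then have i: "i = uwidth (c (m, n)) - 1" using *(3) by simp
      have p1: "p + 1 = P (m + 1)" using P1 *(1,3) i by simp
      then have "P (m + 1) < P L" using that PL by simp
      then have "m + 1 < L" using strict_mono_less[OF sm(1)] by simp
      then have "h_match (c (m, n)) (c (m + 1, n))" using v mn by (simp add: valid_to_def)
      then show ?thesis using covers_next(1)[OF c comp *(3,4)] False edges_agree_nth(1) * i by simp
    qed
    show "v_match (d (p, q)) (d (p, q + 1))" if "q + 1 < L + 1"
    proof (cases "Suc j < uheight (c (m, n))")
      case True
      then show ?thesis using covers_next(2)[OF c comp *(3,4)] inflation_inner(2)[OF *(3) True] * by simp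
    next
      case False
      then have i: "j = uheight (c (m, n)) - 1" using *(4) by simp
      have p1: "q + 1 = Q (n + 1)" using Q1 *(2,4) i by simp
      then have "Q (n + 1) < Q L" using that QL by simp
      then have "n + 1 < L" using strict_mono_less[OF sm(2)] by simp
      then have "v_match (c (m, n)) (c (m, n + 1))" using v mn by (simp add: valid_to_def)
      then show ?thesis using covers_next(2)[OF c comp *(3,4)] False edges_agree_nth(2) * i by simp
    qed
  qed
qed

lemma valid_to_exists:
  "\<exists>c. compatible uwidth uheight c \<and> uwidth (c (0, 0)) = 2 \<and> uheight (c (0, 0)) = 2 \<and> valid_to c (int n + 1)"
proof (induction n)
  case 0
  \<comment> \<open>The image of \<open>U12\<close> is 2 by 2, and a square of side 1 contains no
    adjacent pair.\<close>
  show ?case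
    by (intro exI[of _ "\<lambda>_. U12"]) (simp add: compatible_def valid_to_def uwidth_def uheight_def)
next
  case (Suc n)
  then obtain c where c: "compatible uwidth uheight c" "uwidth (c (0, 0)) = 2" "uheight (c (0, 0)) = 2"
    "valid_to c (int n + 1)" by blast
  obtain P Q d where d: "cut_into c P Q d" "P 0 = 0" "Q 0 = 0" using covers_exist[OF c(1)] by blast
  have "d (0, 0) = inflation (c (0, 0)) ! 0 ! 0"
    using coversD(3)[OF d(1), of 0 0 0 0] d c by simp
  then have "uwidth (d (0, 0)) = 2" "uheight (d (0, 0)) = 2"
    using double_inflation(3,4)[of 0 "c (0, 0)" 0] inflation_shape by simp_all
  moreover have "valid_to d (int (Suc n) + 1)"
    using valid_to_inflated[OF c(1) d c(4,2,3)] by (simp add: algebra_simps)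
  ultimately show ?case using compatible_inflated[OF c(1) d(1)] by blast
qed

lemma nonempty_U: "wang_shift (range utile_code) \<noteq> {}"
proof (rule wang_shift_nonempty)
  have "range utile_code = utile_code ` set utiles" by (simp add: set_utiles)
  then show "finite (range utile_code)" by simp
  fix F :: "(int \<times> int) set" assume "finite F"
  then obtain b :: nat where b: "\<And>p. p \<in> F \<Longrightarrow> \<bar>fst p\<bar> \<le> int b \<and> \<bar>snd p\<bar> \<le> int b"
    using finite_in_box by metis
  \<comment> \<open>The valid square starts at the origin and is shifted by \<open>b\<close> to be
    centered; its side leaves room for the right and upper neighbors of the positions in
    \<open>F\<close>.\<close>
  obtain c where c: "valid_to c (int (2 * b + 2) + 1)" using valid_to_exists by blast
  show "\<exists>x. range x \<subseteq> range utile_code \<and> (\<forall>p\<in>F. fits_at x p)"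
  proof (intro exI[of _ "shift (int b, int b) (utile_code \<circ> c)"] conjI ballI)
    fix p assume "p \<in> F"
    note p = b[OF this]
    obtain m n where mn: "p = (m, n)" by (cases p)
    have "h_match (c (m + int b, n + int b)) (c (m + int b + 1, n + int b))"
      "v_match (c (m + int b, n + int b)) (c (m + int b, n + int b + 1))"
      using c[unfolded valid_to_def, rule_format, of "m + int b" "n + int b"] p mn by auto
    then show "fits_at (shift (int b, int b) (utile_code \<circ> c)) p"
      by (simp add: fits_at_def mn shift_def plus_prod_def utile_code_def h_match_def v_match_def algebra_simps)
  qed (auto simp: shift_def)
qed

lemma aperiodic_U: "aperiodic (wang_shift (range utile_code))"
  unfolding aperiodic_def
proof (intro conjI nonempty_U ballI allI impI notI)
  fix x n assume "x \<in> wang_shift (range utile_code)" and n: "n \<noteq> 0" and s: "shift n x = x"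
  then obtain v where v: "v \<in> utilings" "x = utile_code \<circ> v" by (auto simp: wang_shift_image)
  have "shift n v = v"
    using s by (auto simp: v shift_def fun_eq_iff inj_eq[OF inj_utile_code])
  then show False using utilings_no_period v(1) n by blast
qed

text \<open>The lower left letter of every image has a 2 by 2 image itself, so from the second
  application on each one adds at least a row and a column.\<close>

lemma expand_grows:
  assumes "0 < width w" "0 < height w"
  shows "uwidth (inv utile_code (entry (U.expand w) (0, 0))) = 2" "uheight (inv utile_code (entry (U.expand w) (0, 0))) = 2"
    "width w \<le> width (U.expand w)" "height w \<le> height (U.expand w)"
    "uwidth (inv utile_code (entry w (0, 0))) = 2 \<Longrightarrow> width w < width (U.expand w)"
    "uheight (inv utile_code (entry w (0, 0))) = 2 \<Longrightarrow> height w < height (U.expand w)"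
proof -
  let ?a = "inv utile_code (entry w (0, 0))"
  have "entry (U.expand w) (0, 0) = utile_code (inflation ?a ! 0 ! 0)"
    using entry_inflate[of 0 w 0 "uwidth \<circ> inv utile_code" 0 0 "uheight \<circ> inv utile_code"] assms inflation_shape
    by (simp add: U.expand_def comp_def)
  then show "uwidth (inv utile_code (entry (U.expand w) (0, 0))) = 2" "uheight (inv utile_code (entry (U.expand w) (0, 0))) = 2"
    using double_inflation(3,4)[of 0 ?a 0] inflation_shape by (simp_all add: inj_utile_code)
  have grow: "n \<le> offs f n" "0 < n \<Longrightarrow> f 0 = 2 \<Longrightarrow> n < offs f n" if "\<And>i. 0 < f i" for f :: "nat \<Rightarrow> nat" and n
  proof -
    show le: "n \<le> offs f n" for n
    proof (induction n)
      case (Suc n)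
      then show ?case using that[of n] by simp
    qed simp
    assume "0 < n" "f 0 = 2"
    then obtain k where "n = Suc k" by (cases n) auto
    moreover have "k < Suc k \<longrightarrow> Suc k < offs f (Suc k)"
    proof (induction k)
      case (Suc k)
      then show ?case using that[of "Suc k"] by simp
    qed (use \<open>f 0 = 2\<close> in simp)
    ultimately show "n < offs f n" by simp
  qed
  show "width w \<le> width (U.expand w)" "height w \<le> height (U.expand w)"
    using inflation_shape by (simp_all add: U.expand_def width_inflate height_inflate grow(1))
  show "width w < width (U.expand w)" if "uwidth ?a = 2"
    using that assms inflation_shape by (simp add: U.expand_def width_inflate grow(2))
  show "height w < height (U.expand w)" if "uheight ?a = 2"
    using that assms inflation_shape by (simp add: U.expand_def height_inflate grow(2))
qed

lemma expand_pow_grows: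
  assumes "0 < width w" "0 < height w"
  shows "m < width ((U.expand ^^ Suc m) w) \<and> m < height ((U.expand ^^ Suc m) w) \<and>
    uwidth (inv utile_code (entry ((U.expand ^^ Suc m) w) (0, 0))) = 2 \<and>
    uheight (inv utile_code (entry ((U.expand ^^ Suc m) w) (0, 0))) = 2"
proof (induction m)
  case 0
  then show ?case using expand_grows[OF assms] assms by simp
next
  case (Suc m)
  then show ?case using expand_grows[of "(U.expand ^^ Suc m) w"] by simp
qed

lemma self_similar_U: "self_similar (range utile_code) (wang_shift (range utile_code))"
  unfolding self_similar_def
proof (intro conjI exI[of _ U.expand] ballI)
  show "expansive (wang_shift (range utile_code)) U.expand"
    unfolding expansive_def
  proof (intro allI impI)
    fix a K
    show "\<exists>m. K < width ((U.expand ^^ m) (letter a)) \<and> K < height ((U.expand ^^ m) (letter a))"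
      using expand_pow_grows[of "letter a" K] by (intro exI[of _ "Suc K"]) (simp add: letter_def)
  qed
  show "wang_shift (range utile_code) = shift_closure (extend U.expand ` wang_shift (range utile_code))"
    using U.onto_expand by (simp add: onto_up_to_shift_def)
  show "range x \<subseteq> range utile_code" if "x \<in> wang_shift (range utile_code)" for x
    using that by (simp add: wang_shift_def)
qed (rule subshift_wang_shift U.morphism_on_expand)+

section \<open>Equivalence with the given set of 19 tiles\<close>

lemma equivalent_recolor:
  fixes f :: "'c \<Rightarrow> 'd"
  assumes "inj f" shows "equivalent_tiles (recolor f ` S) S"
  unfolding equivalent_tiles_def
proof (intro exI conjI)
  have inv: "inv f (f x) = x" for x using assms by simp
  have v: "vertical_colors (recolor f ` S) = f ` vertical_colors S"
    "horizontal_colors (recolor f ` S) = f ` horizontal_colors S"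
    by (auto simp: vertical_colors_def horizontal_colors_def image_Un image_image)
  show "bij_betw (inv f) (vertical_colors (recolor f ` S)) (vertical_colors S)"
    "bij_betw (inv f) (horizontal_colors (recolor f ` S)) (horizontal_colors S)"
    unfolding v by (auto intro!: bij_betw_imageI inj_on_inverseI[of _ f] simp: inv image_image)
  show "S = {(inv f a, inv f b, inv f c, inv f d) | a b c d. (a, b, c, d) \<in> recolor f ` S}"
    by (force simp: recolor_def inv)
qed

lemma range_utile_code: "range utile_code = recolor to_nat ` U_tiles"
proof -
  have "U_tiles = ucolors ` set utiles" by (simp add: U_tiles_def utiles_def)
  moreover have "range utile_code = recolor to_nat ` range ucolors"
    by (simp add: utile_code_def image_image)
  ultimately show ?thesis unfolding set_utiles by (simp only:)
qed

lemma equivalent_U: "equivalent_tiles (range utile_code) U_tiles"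
  unfolding range_utile_code by (intro equivalent_recolor inj_to_nat)

section \<open>Subdividing the tiles into cells\<close>

datatype jcolumn = C0 | C1 | C2 | C3 | C4 | C5 | C6 | C7 | C8 | C9 | C10 | C11 | C12 | C13 | C14 | C15 | C16 | C17 | C18 | C19 | C20 | C21 | C22 | C23 | C24 | C25 | C26 | C27

text \<open>Columns are listed from bottom to top.\<close>

primrec jcolumn_tiles :: "jcolumn \<Rightarrow> jcolor tile list" where
  "jcolumn_tiles C0 = [(L2,L4,L2,L1),(L1,L2,L1,L4),(L1,L2,L3,L2),(L3,L1,L0,L2)]"
| "jcolumn_tiles C1 = [(L2,L4,L2,L1),(L1,L2,L1,L4),(L3,L1,L0,L2),(L0,L1,L3,L1)]"
| "jcolumn_tiles C2 = [(L2,L4,L2,L1),(L1,L2,L1,L4),(L3,L3,L1,L2),(L3,L1,L3,L3)]"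
| "jcolumn_tiles C3 = [(L2,L2,L2,L0),(L1,L2,L3,L2),(L1,L2,L3,L2),(L3,L1,L0,L2)]"
| "jcolumn_tiles C4 = [(L2,L2,L2,L0),(L1,L2,L3,L2),(L3,L1,L0,L2),(L0,L0,L0,L1)]"
| "jcolumn_tiles C5 = [(L2,L2,L2,L0),(L1,L2,L3,L2),(L0,L2,L1,L2),(L3,L1,L0,L2)]"
| "jcolumn_tiles C6 = [(L2,L2,L2,L0),(L3,L1,L0,L2),(L1,L1,L3,L1),(L0,L1,L3,L1)]"
| "jcolumn_tiles C7 = [(L2,L2,L2,L0),(L3,L1,L0,L2),(L0,L1,L3,L1),(L0,L1,L3,L1)]"
| "jcolumn_tiles C8 = [(L2,L2,L2,L0),(L3,L1,L0,L2),(L0,L1,L3,L1),(L0,L0,L0,L1)]"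
| "jcolumn_tiles C9 = [(L2,L2,L2,L0),(L0,L2,L1,L2),(L3,L1,L0,L2),(L0,L1,L3,L1)]"
| "jcolumn_tiles C10 = [(L2,L2,L2,L0),(L0,L2,L1,L2),(L3,L3,L1,L2),(L3,L1,L3,L3)]"
| "jcolumn_tiles C11 = [(L2,L2,L2,L0),(L3,L3,L1,L2),(L3,L1,L3,L3),(L0,L1,L3,L1)]"
| "jcolumn_tiles C12 = [(L2,L2,L2,L0),(L3,L3,L1,L2),(L3,L1,L3,L3),(L0,L0,L0,L1)]"
| "jcolumn_tiles C13 = [(L2,L4,L2,L1),(L1,L2,L1,L4),(L1,L2,L3,L2),(L1,L2,L3,L2),(L3,L1,L0,L2)]"
| "jcolumn_tiles C14 = [(L2,L4,L2,L1),(L1,L2,L1,L4),(L1,L2,L3,L2),(L3,L1,L0,L2),(L0,L0,L0,L1)]"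
| "jcolumn_tiles C15 = [(L2,L4,L2,L1),(L1,L2,L1,L4),(L1,L2,L3,L2),(L0,L2,L1,L2),(L3,L1,L0,L2)]"
| "jcolumn_tiles C16 = [(L2,L4,L2,L1),(L1,L2,L1,L4),(L3,L1,L0,L2),(L1,L1,L3,L1),(L0,L1,L3,L1)]"
| "jcolumn_tiles C17 = [(L2,L4,L2,L1),(L1,L2,L1,L4),(L3,L1,L0,L2),(L1,L1,L3,L1),(L0,L0,L0,L1)]"
| "jcolumn_tiles C18 = [(L2,L4,L2,L1),(L1,L2,L1,L4),(L3,L1,L0,L2),(L0,L1,L3,L1),(L0,L1,L3,L1)]"
| "jcolumn_tiles C19 = [(L2,L4,L2,L1),(L1,L2,L1,L4),(L3,L1,L0,L2),(L0,L1,L3,L1),(L0,L0,L0,L1)]"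
| "jcolumn_tiles C20 = [(L2,L4,L2,L1),(L1,L2,L1,L4),(L0,L2,L1,L2),(L3,L1,L0,L2),(L0,L1,L3,L1)]"
| "jcolumn_tiles C21 = [(L2,L4,L2,L1),(L1,L2,L1,L4),(L0,L2,L1,L2),(L3,L3,L1,L2),(L3,L1,L3,L3)]"
| "jcolumn_tiles C22 = [(L2,L4,L2,L1),(L1,L2,L1,L4),(L3,L3,L1,L2),(L3,L1,L3,L3),(L0,L0,L0,L1)]"
| "jcolumn_tiles C23 = [(L2,L2,L2,L0),(L1,L2,L3,L2),(L1,L2,L3,L2),(L3,L1,L0,L2),(L0,L0,L0,L1)]"
| "jcolumn_tiles C24 = [(L2,L2,L2,L0),(L1,L2,L3,L2),(L0,L2,L1,L2),(L3,L1,L0,L2),(L0,L0,L0,L1)]"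
| "jcolumn_tiles C25 = [(L2,L2,L2,L0),(L3,L1,L0,L2),(L1,L1,L3,L1),(L0,L1,L3,L1),(L0,L0,L0,L1)]"
| "jcolumn_tiles C26 = [(L2,L2,L2,L0),(L0,L2,L1,L2),(L3,L3,L1,L2),(L3,L1,L3,L3),(L0,L0,L0,L1)]"
| "jcolumn_tiles C27 = [(L2,L2,L2,L0),(L3,L3,L1,L2),(L3,L1,L3,L3),(L0,L1,L3,L1),(L0,L0,L0,L1)]"

text \<open>The columns assigned to the cells of a tile, found by constraint solving and again listed column
  by column. In the tilings of the Jeandel-Rao tiles the rows of a block are sheared: moving up by one row
  of a block is moving by \<open>(1, 1)\<close> in the tiling by columns.\<close>

primrec jblock :: "utile \<Rightarrow> jcolumn list list" where
  "jblock U0 = [[C15,C0],[C20,C10],[C19,C6],[C14,C5],[C26,C9]]"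
| "jblock U1 = [[C14,C3],[C22,C10],[C27,C6],[C23,C5],[C26,C9]]"
| "jblock U2 = [[C25,C8],[C24,C4],[C19,C12],[C14,C3],[C26,C10],[C25,C6],[C24,C5],[C17,C1]]"
| "jblock U3 = [[C25,C8],[C24,C4],[C19,C12],[C14,C3],[C22,C10],[C27,C6],[C23,C5],[C22,C1]]"
| "jblock U4 = [[C15,C0],[C20,C10],[C19,C6],[C14,C5],[C26,C9],[C25,C8],[C24,C4],[C19,C12]]"
| "jblock U5 = [[C14,C3],[C22,C10],[C27,C6],[C23,C5],[C26,C9],[C25,C8],[C24,C4],[C19,C12]]"
| "jblock U6 = [[C25,C8],[C24,C4],[C19,C12],[C14,C3],[C26,C10],[C25,C7],[C24,C4],[C19,C12]]"
| "jblock U7 = [[C13,C0],[C21,C2],[C18,C11],[C14,C3],[C26,C10],[C25,C7],[C24,C4],[C19,C12]]"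
| "jblock U8 = [[C13,C0,C13],[C21,C2,C21],[C18,C11,C16],[C14,C3,C15],[C26,C10,C20]]"
| "jblock U9 = [[C15,C0,C13],[C20,C10,C21],[C19,C6,C18],[C14,C5,C14],[C26,C9,C26]]"
| "jblock U10 = [[C14,C3,C13],[C22,C10,C21],[C27,C6,C18],[C23,C5,C14],[C26,C9,C26]]"
| "jblock U11 = [[C13,C0,C13],[C21,C2,C21],[C18,C11,C18],[C14,C3,C14],[C26,C10,C22]]"
| "jblock U12 = [[C25,C8,C25],[C24,C4,C24],[C19,C12,C17],[C14,C3,C15],[C26,C10,C20],[C25,C6,C19],[C24,C5,C14],[C17,C1,C22]]"
| "jblock U13 = [[C13,C0,C13],[C21,C2,C21],[C18,C11,C16],[C14,C3,C15],[C26,C10,C20],[C25,C6,C19],[C24,C5,C14],[C17,C1,C22]]"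
| "jblock U14 = [[C25,C8,C25],[C24,C4,C24],[C19,C12,C17],[C14,C3,C15],[C22,C10,C20],[C27,C6,C19],[C23,C5,C14],[C22,C1,C22]]"
| "jblock U15 = [[C13,C0,C13],[C21,C2,C21],[C18,C11,C16],[C14,C3,C15],[C22,C10,C20],[C27,C6,C19],[C23,C5,C14],[C22,C1,C22]]"
| "jblock U16 = [[C25,C6,C19],[C24,C5,C14],[C17,C1,C22],[C15,C0,C13],[C20,C10,C21],[C19,C6,C18],[C14,C5,C14],[C22,C1,C22]]"
| "jblock U17 = [[C25,C7,C27],[C24,C4,C23],[C19,C12,C22],[C14,C3,C13],[C22,C10,C21],[C27,C6,C18],[C23,C5,C14],[C22,C1,C22]]"
| "jblock U18 = [[C13,C0,C13],[C21,C2,C21],[C18,C11,C18],[C14,C3,C14],[C26,C10,C22],[C25,C7,C27],[C24,C4,C23],[C19,C12,C22]]"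

definition bwidth :: "utile \<Rightarrow> nat" where
  "bwidth a = length (jblock a)"

definition bheight :: "utile \<Rightarrow> nat" where
  "bheight a = length (hd (jblock a))"

definition bheight_agree :: "utile \<Rightarrow> utile \<Rightarrow> bool" where
  "bheight_agree a b \<longleftrightarrow> (h_match a b \<longrightarrow> length (hd (jblock a)) = length (hd (jblock b))) \<and>
     (v_match a b \<longrightarrow> length (jblock a) = length (jblock b)) \<and> (jblock a = jblock b \<longrightarrow> a = b)"

lemma bheight_agree: "every (every_pair bheight_agree utiles) utiles"
  by code_simp

lemma block_agree:
  "h_match a b \<Longrightarrow> bheight a = bheight b" "v_match a b \<Longrightarrow> bwidth a = bwidth b" "jblock a = jblock b \<Longrightarrow> a = b"
  using utile_pairs[OF bheight_agree, of a b] by (simp_all add: bheight_agree_def bwidth_def bheight_def)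

lemma block_shape:
  "5 \<le> bwidth a" "bwidth a \<le> 8" "2 \<le> bheight a" "bheight a \<le> 3"
  "\<forall>c\<in>set (jblock a). length c = bheight a"
  by (cases a; simp add: bwidth_def bheight_def)+

lemma length_jblock_nth: "i < bwidth a \<Longrightarrow> length (jblock a ! i) = bheight a"
  using block_shape(5)[of a] by (simp add: bwidth_def)

instance utile :: countable
  by countable_datatype

type_synonym cell = "utile \<times> nat \<times> nat"

text \<open>A private color is named after the cell to the left of the edge or below it. One name
  may serve in both directions, since vertical and horizontal colors are never compared.\<close>

definition inner_edge :: "cell \<Rightarrow> nat" where
  "inner_edge c = to_nat (Inl c :: cell + (ucolor \<times> nat))"

definition outer_edge :: "ucolor \<Rightarrow> nat \<Rightarrow> nat" where
  "outer_edge x k = to_nat (Inr (x, k) :: cell + (ucolor \<times> nat))"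

lemma edge_eq_iff [simp]:
  "inner_edge c = inner_edge d \<longleftrightarrow> c = d" "outer_edge x k = outer_edge y l \<longleftrightarrow> x = y \<and> k = l"
  "inner_edge c \<noteq> outer_edge x k" "outer_edge x k \<noteq> inner_edge c"
  by (simp_all add: inner_edge_def outer_edge_def)

definition cell_tile :: "cell \<Rightarrow> nat tile" where
  "cell_tile = (\<lambda>(a, i, j).
    (if Suc i < bwidth a then inner_edge (a, i, j) else outer_edge (right_color (ucolors a)) j,
     if Suc j < bheight a then inner_edge (a, i, j) else outer_edge (top_color (ucolors a)) i,
     if i = 0 then outer_edge (left_color (ucolors a)) j else inner_edge (a, i - 1, j),
     if j = 0 then outer_edge (bottom_color (ucolors a)) i else inner_edge (a, i, j - 1)))"

definition cells :: "cell set" where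
  "cells = {(a, i, j). i < bwidth a \<and> j < bheight a}"

lemma cell_colors:
  "right_color (cell_tile (a, i, j)) = (if Suc i < bwidth a then inner_edge (a, i, j) else outer_edge (right_color (ucolors a)) j)"
  "top_color (cell_tile (a, i, j)) = (if Suc j < bheight a then inner_edge (a, i, j) else outer_edge (top_color (ucolors a)) i)"
  "left_color (cell_tile (a, i, j)) = (if i = 0 then outer_edge (left_color (ucolors a)) j else inner_edge (a, i - 1, j))"
  "bottom_color (cell_tile (a, i, j)) = (if j = 0 then outer_edge (bottom_color (ucolors a)) i else inner_edge (a, i, j - 1))"
  by (simp_all add: cell_tile_def)

lemma cell_right:
  assumes "right_color (cell_tile (a, i, j)) = left_color (cell_tile (b, k, l))" "i < bwidth a"
  shows "if Suc i < bwidth a then (b, k, l) = (a, Suc i, j) else k = 0 \<and> l = j \<and> h_match a b"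
  using assms by (auto simp: cell_colors h_match_def split: if_splits)

lemma cell_above:
  assumes "top_color (cell_tile (a, i, j)) = bottom_color (cell_tile (b, k, l))" "j < bheight a"
  shows "if Suc j < bheight a then (b, k, l) = (a, i, Suc j) else l = 0 \<and> k = i \<and> v_match a b"
  using assms by (auto simp: cell_colors v_match_def split: if_splits)

text \<open>As blocks are at least 5 cells wide, each cell has a private color on its left or right
  side, and this color names the cell.\<close>

lemma inj_cell_tile: "inj_on cell_tile cells"
proof (rule inj_onI)
  fix c d assume c: "c \<in> cells" and d: "d \<in> cells" and eq: "cell_tile c = cell_tile d"
  obtain a i j b k l where *: "c = (a, i, j)" "d = (b, k, l)" by (metis prod.collapse)
  have "i < bwidth a" "k < bwidth b" "5 \<le> bwidth a" "5 \<le> bwidth b"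
    using c d block_shape(1) by (auto simp: cells_def *)
  moreover have "right_color (cell_tile c) = right_color (cell_tile d)" "left_color (cell_tile c) = left_color (cell_tile d)"
    using eq by simp_all
  ultimately show "c = d" unfolding * by (auto simp: cell_colors split: if_splits)
qed

definition first_column :: "nat tile \<Rightarrow> bool" where
  "first_column r \<longleftrightarrow> (\<exists>a j. j < bheight a \<and> r = cell_tile (a, 0, j))"

definition first_row :: "nat tile \<Rightarrow> bool" where
  "first_row r \<longleftrightarrow> (\<exists>a i. i < bwidth a \<and> r = cell_tile (a, i, 0))"

lemma first_cell_tile:
  assumes "(a, i, j) \<in> cells"
  shows "first_column (cell_tile (a, i, j)) \<longleftrightarrow> i = 0" "first_row (cell_tile (a, i, j)) \<longleftrightarrow> j = 0"
proof -
  have "(b, 0, l) \<in> cells \<longleftrightarrow> l < bheight b" "(b, l, 0) \<in> cells \<longleftrightarrow> l < bwidth b" for b l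
    using block_shape(1,3)[of b] by (auto simp: cells_def)
  then have "i = 0" if "cell_tile (a, i, j) = cell_tile (b, 0, l)" "l < bheight b" for b l
    using inj_onD[OF inj_cell_tile that(1) assms] that(2) by simp
  moreover have "j = 0" if "cell_tile (a, i, j) = cell_tile (b, l, 0)" "l < bwidth b" for b l
    using inj_onD[OF inj_cell_tile that(1) assms] that(2) \<open>\<And>l b. (b, l, 0) \<in> cells \<longleftrightarrow> l < bwidth b\<close> by simp
  ultimately show "first_column (cell_tile (a, i, j)) \<longleftrightarrow> i = 0" "first_row (cell_tile (a, i, j)) \<longleftrightarrow> j = 0"
    unfolding first_column_def first_row_def using assms by (auto simp: cells_def)
qed

text \<open>Private colors force the cells of a block to follow one another to the right and
  upwards; past the last cell only an initial cell of a block fits.\<close>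

lemma cell_run:
  assumes y: "y \<in> wang_shift (cell_tile ` cells)" and c: "(a, i, j) \<in> cells" "y (m, n) = cell_tile (a, i, j)"
  shows "i + k < bwidth a \<Longrightarrow> y (m + int k, n) = cell_tile (a, i + k, j)"
    "j + l < bheight a \<Longrightarrow> y (m, n + int l) = cell_tile (a, i, j + l)"
    "first_column (y (m + int (bwidth a - i), n))" "first_row (y (m, n + int (bheight a - j)))"
proof -
  note yD = tilingsD[of y id, folded wang_shift_eq_tilings, OF y, simplified]
  have cell: "\<exists>a i j. (a, i, j) \<in> cells \<and> y (m, n) = cell_tile (a, i, j)" for m n
    using yD(1)[of "(m, n)"] by auto
  have right: "if Suc i < bwidth a then y (m + 1, n) = cell_tile (a, Suc i, j) else first_column (y (m + 1, n))"
    if "(a, i, j) \<in> cells" "y (m, n) = cell_tile (a, i, j)" for a i j m n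
  proof -
    obtain b k l where b: "(b, k, l) \<in> cells" "y (m + 1, n) = cell_tile (b, k, l)" using cell by blast
    show ?thesis using cell_right[of a i j b k l] yD(2)[of m n] b that first_cell_tile(1)[OF b(1)]
      by (auto simp: cells_def split: if_splits)
  qed
  have above: "if Suc j < bheight a then y (m, n + 1) = cell_tile (a, i, Suc j) else first_row (y (m, n + 1))"
    if "(a, i, j) \<in> cells" "y (m, n) = cell_tile (a, i, j)" for a i j m n
  proof -
    obtain b k l where b: "(b, k, l) \<in> cells" "y (m, n + 1) = cell_tile (b, k, l)" using cell by blast
    show ?thesis using cell_above[of a i j b k l] yD(3)[of m n] b that first_cell_tile(2)[OF b(1)]
      by (auto simp: cells_def split: if_splits)
  qed
  show k: "y (m + int k, n) = cell_tile (a, i + k, j)" if "i + k < bwidth a" for k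
    using that
  proof (induction k)
    case (Suc k)
    then show ?case using right[of a "i + k" j "m + int k" n] c(1) by (simp add: cells_def algebra_simps)
  qed (use c in simp)
  show l: "y (m, n + int l) = cell_tile (a, i, j + l)" if "j + l < bheight a" for l
    using that
  proof (induction l)
    case (Suc l)
    then show ?case using above[of a i "j + l" m "n + int l"] c(1) by (simp add: cells_def algebra_simps)
  qed (use c in simp)
  have ij: "i < bwidth a" "j < bheight a" using c(1) by (auto simp: cells_def)
  have "m + int (bwidth a - i) = m + int (bwidth a - i - 1) + 1" "n + int (bheight a - j) = n + int (bheight a - j - 1) + 1"
    using ij by (simp_all add: of_nat_diff)
  then show "first_column (y (m + int (bwidth a - i), n))" "first_row (y (m, n + int (bheight a - j)))"
    using right[of a "bwidth a - 1" j "m + int (bwidth a - i - 1)" n] k[of "bwidth a - i - 1"]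
      above[of a i "bheight a - 1" m "n + int (bheight a - j - 1)"] l[of "bheight a - j - 1"] ij
    by (simp_all add: cells_def)
qed

text \<open>The gap bound 9 comes from the maximal width 8: from any cell the next cut is at most 8
  steps away.\<close>

interpretation cell: wang_substitution UNIV utile_code "cell_tile ` cells" bwidth bheight
  "\<lambda>a i j. cell_tile (a, i, j)" first_column first_row 9
proof unfold_locales
  show "inj utile_code" by (rule inj_utile_code)
  have pos: "0 < bwidth a" "0 < bheight a" for a using block_shape(1,3)[of a] by simp_all
  show "0 < bwidth a" "0 < bheight a" for a by (rule pos)+
  show "cell_tile (a, i, j) \<in> cell_tile ` cells" if "i < bwidth a" "j < bheight a" for a i j
    using that by (auto simp: cells_def)
  show "right_color (cell_tile (a, i, j)) = left_color (cell_tile (a, Suc i, j))"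
    if "Suc i < bwidth a" "j < bheight a" for a i j
    using that by (simp add: cell_colors)
  show "top_color (cell_tile (a, i, j)) = bottom_color (cell_tile (a, i, Suc j))"
    if "i < bwidth a" "Suc j < bheight a" for a i j
    using that by (simp add: cell_colors)
  show "right_color (utile_code a) = left_color (utile_code b) \<longleftrightarrow> bheight a = bheight b \<and>
     (\<forall>j<bheight a. right_color (cell_tile (a, bwidth a - 1, j)) = left_color (cell_tile (b, 0, j)))" for a b
    using pos[of a] block_agree(1)[of a b] by (auto simp: cell_colors h_match_def utile_code_def)
  show "top_color (utile_code a) = bottom_color (utile_code b) \<longleftrightarrow> bwidth a = bwidth b \<and>
     (\<forall>i<bwidth a. top_color (cell_tile (a, i, bheight a - 1)) = bottom_color (cell_tile (b, i, 0)))" for a b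
    using pos[of a] block_agree(2)[of a b] by (auto simp: cell_colors v_match_def utile_code_def)
  show "first_column r = first_column s"
    if rs: "r \<in> cell_tile ` cells" "s \<in> cell_tile ` cells" and eq: "top_color r = bottom_color s" for r s
  proof -
    obtain a i j where r: "r = cell_tile (a, i, j)" "(a, i, j) \<in> cells" using rs(1) by (metis imageE prod.collapse)
    obtain b k l where s: "s = cell_tile (b, k, l)" "(b, k, l) \<in> cells" using rs(2) by (metis imageE prod.collapse)
    show ?thesis using cell_above[of a i j b k l] eq r s by (auto simp: first_cell_tile cells_def split: if_splits)
  qed
  show "first_row r = first_row s"
    if rs: "r \<in> cell_tile ` cells" "s \<in> cell_tile ` cells" and eq: "right_color r = left_color s" for r s
  proof -
    obtain a i j where r: "r = cell_tile (a, i, j)" "(a, i, j) \<in> cells" using rs(1) by (metis imageE prod.collapse)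
    obtain b k l where s: "s = cell_tile (b, k, l)" "(b, k, l) \<in> cells" using rs(2) by (metis imageE prod.collapse)
    show ?thesis using cell_right[of a i j b k l] eq r s by (auto simp: first_cell_tile cells_def split: if_splits)
  qed
  show "first_column (cell_tile (a, i, j)) = (i = 0)" "first_row (cell_tile (a, i, j)) = (j = 0)"
    if "i < bwidth a" "j < bheight a" for a i j
    using that by (simp_all add: first_cell_tile cells_def)
  show "a = b" if "\<forall>i<bwidth a. \<forall>j<bheight a. cell_tile (a, i, j) = cell_tile (b, i, j)" for a b
  proof -
    have "cell_tile (a, 0, 0) = cell_tile (b, 0, 0)" using that pos by blast
    then have "(a, 0 :: nat, 0 :: nat) = (b, 0, 0)"
      by (rule inj_onD[OF inj_cell_tile]) (simp_all add: cells_def pos)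
    then show ?thesis by simp
  qed
  fix y :: "nat tile config" assume y: "y \<in> wang_shift (cell_tile ` cells)"
  then have "y (0, 0) \<in> cell_tile ` cells" by (auto simp: wang_shift_def)
  then obtain a i j where a: "y (0, 0) = cell_tile (a, i, j)" "(a, i, j) \<in> cells" by (metis imageE prod.collapse)
  note run = cell_run[OF y a(2,1)]
  show "\<exists>i<9. first_column (y (int i, 0))"
    using run(3) block_shape(2)[of a] by (intro exI[of _ "bwidth a - i"]) auto
  show "\<exists>j<9. first_row (y (0, int j))"
    using run(4) block_shape(4)[of a] by (intro exI[of _ "bheight a - j"]) auto
  fix w h :: nat
  assume w: "0 < w" "\<forall>i<w. first_column (y (int i, 0)) = (i = 0)" "first_column (y (int w, 0))"
    and h: "0 < h" "\<forall>j<h. first_row (y (0, int j)) = (j = 0)" "first_row (y (0, int h))"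
  have "first_column (y (0, 0))" "first_row (y (0, 0))" using w(2)[rule_format, OF w(1)] h(2)[rule_format, OF h(1)] by simp_all
  then have ij: "i = 0" "j = 0" using first_cell_tile[OF a(2)] a(1) by simp_all
  have "\<not> bwidth a < w" using run(3) w(2) pos(1)[of a] ij by auto
  moreover have "\<not> w < bwidth a"
    using run(1)[of w] w(1,3) first_cell_tile(1)[of a w 0] pos(2)[of a] ij by (auto simp: cells_def)
  ultimately have W: "bwidth a = w" by simp
  have "\<not> bheight a < h" using run(4) h(2) pos(2)[of a] ij by auto
  moreover have "\<not> h < bheight a"
    using run(2)[of h] h(1,3) first_cell_tile(2)[of a 0 h] pos(1)[of a] ij by (auto simp: cells_def)
  ultimately have H: "bheight a = h" by simp
  have "y (int i', int j') = cell_tile (a, i', j')" if "i' < w" "j' < h" for i' j'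
  proof -
    have "y (int i', 0) = cell_tile (a, i', 0)" using run(1)[of i'] that ij W by simp
    moreover have "(a, i', 0) \<in> cells" using that W pos by (simp add: cells_def)
    ultimately show ?thesis using cell_run(2)[OF y, of a i' 0 "int i'" 0 j'] that H by simp
  qed
  then show "\<exists>a\<in>UNIV. bwidth a = w \<and> bheight a = h \<and> (\<forall>i<w. \<forall>j<h. y (int i, int j) = cell_tile (a, i, j))"
    using W H by (intro bexI[of _ a]) auto
qed

section \<open>Embedding the sheared cells into the Jeandel-Rao columns\<close>

definition beside_column :: "jcolumn \<Rightarrow> jcolumn \<Rightarrow> bool" where
  "beside_column c d \<longleftrightarrow> map right_color (jcolumn_tiles c) = map left_color (jcolumn_tiles d)"

definition below_column :: "jcolumn \<Rightarrow> jcolumn \<Rightarrow> bool" where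
  "below_column c d \<longleftrightarrow> top_color (last (jcolumn_tiles c)) = bottom_color (hd (jcolumn_tiles d))"

primrec all2 :: "('s \<Rightarrow> 't \<Rightarrow> bool) \<Rightarrow> 's list \<Rightarrow> 't list \<Rightarrow> bool" where
  "all2 R [] ys = (ys = [])"
| "all2 R (x # xs) ys = (case ys of [] \<Rightarrow> False | y # ys' \<Rightarrow> if R x y then all2 R xs ys' else False)"

lemma all2_iff: "all2 R xs ys \<longleftrightarrow> list_all2 R xs ys"
  by (induction xs arbitrary: ys) (auto split: list.splits)

text \<open>For neighboring columns of cells \<open>c\<close> and \<open>d\<close>, the second
  condition compares each cell of \<open>d\<close> with its upper left neighbor, the cell of
  \<open>c\<close> one place higher.\<close>

definition fitting :: "jcolumn list \<Rightarrow> jcolumn list \<Rightarrow> bool" where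
  "fitting c d = (if all2 beside_column c d then all2 below_column (butlast d) (tl c) else False)"

fun block_fits :: "jcolumn list list \<Rightarrow> bool" where
  "block_fits (c # d # cs) = (if fitting c d then block_fits (d # cs) else False)"
| "block_fits _ = True"

definition block_ok :: "utile \<Rightarrow> bool" where
  "block_ok a = block_fits (jblock a)"

text \<open>The last condition is the reason for working with patches: the top cell in the first
  column of \<open>b\<close> has its upper left neighbor in the diagonally adjacent
  \<open>c\<close>.\<close>

fun blocks_fit :: "upatch \<Rightarrow> bool" where
  "blocks_fit (a, b, c, d) =
     (if fitting (last (jblock a)) (hd (jblock b)) then
      if all2 below_column (map last (tl (jblock a))) (map hd (butlast (jblock c))) then
        below_column (last (hd (jblock b))) (hd (last (jblock c))) else False else False)"

lemma block_checks: "every block_ok utiles" "every blocks_fit patches"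
  by code_simp+

lemma block_fits_nth: "block_fits cs \<Longrightarrow> Suc i < length cs \<Longrightarrow> fitting (cs ! i) (cs ! Suc i)"
proof (induction cs arbitrary: i rule: block_fits.induct)
  case (1 c d cs)
  then show ?case by (cases i) (auto split: if_splits)
qed auto

lemma fitting_nth:
  assumes "fitting c d" "j < length c"
  shows "beside_column (c ! j) (d ! j)" "Suc j < length c \<Longrightarrow> below_column (d ! j) (c ! Suc j)"
  using assms by (auto simp: fitting_def all2_iff list_all2_conv_all_nth nth_butlast nth_tl split: if_splits)

abbreviation block_covers :: "utile config \<Rightarrow> (int \<Rightarrow> int) \<Rightarrow> (int \<Rightarrow> int) \<Rightarrow> jcolumn config \<Rightarrow> bool" where
  "block_covers \<equiv> covers bwidth bheight (\<lambda>a i j. jblock a ! i ! j)"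

lemma block_covers_adjacent:
  assumes u: "u \<in> utilings" and c: "block_covers u P Q z"
  shows "beside_column (z (p, q)) (z (p + 1, q))" "below_column (z (p, q)) (z (p - 1, q + 1))"
proof -
  have comp: "compatible bwidth bheight u" by (rule cell.tilings_compatible[OF u])
  obtain m n i j where *: "p = P m + int i" "q = Q n + int j" "i < bwidth (u (m, n))" "j < bheight (u (m, n))"
    "z (p, q) = jblock (u (m, n)) ! i ! j"
    using covers_cell[OF c comp] by metis
  have pos: "0 < bwidth a" "0 < bheight a" "jblock a \<noteq> []" for a
    using block_shape(1,3)[of a] by (auto simp: bwidth_def)
  have ends: "last (jblock a) = jblock a ! (bwidth a - 1)" "hd (jblock a) = jblock a ! 0" for a
    using pos by (simp_all add: bwidth_def last_conv_nth hd_conv_nth)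
  have ends': "last (jblock a ! i) = jblock a ! i ! (bheight a - 1)" "hd (jblock a ! i) = jblock a ! i ! 0"
    if "i < bwidth a" for a i
  proof -
    have "jblock a ! i \<noteq> []" using length_jblock_nth[OF that] pos(2)[of a] by force
    then show "last (jblock a ! i) = jblock a ! i ! (bheight a - 1)" "hd (jblock a ! i) = jblock a ! i ! 0"
      using length_jblock_nth[OF that] by (simp_all add: last_conv_nth hd_conv_nth)
  qed
  have inner: "fitting (jblock a ! i) (jblock a ! Suc i)" if "Suc i < bwidth a" for a i
    using that block_checks(1) block_fits_nth[of "jblock a" i] set_utiles
    by (auto simp: every_iff block_ok_def bwidth_def)
  have patch: "blocks_fit (u (m, n), u (m + 1, n), u (m, n + 1), u (m + 1, n + 1))" for m n
    using patch_at_patches[OF u, of m n] block_checks(2) unfolding every_iff patch_at_def by blast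
  have W: "bwidth (u (m, n + 1)) = bwidth (u (m, n))" "bheight (u (m + 1, n)) = bheight (u (m, n))" for m n
    using comp by (auto simp: compatible_def)
  have cross: "fitting (jblock (u (m, n)) ! (bwidth (u (m, n)) - 1)) (jblock (u (m + 1, n)) ! 0)" for m n
    using patch[of m n] ends by (simp split: if_splits)
  have up: "below_column (jblock (u (m, n)) ! Suc i ! (bheight (u (m, n)) - 1)) (jblock (u (m, n + 1)) ! i ! 0)"
    if i: "Suc i < bwidth (u (m, n))" for m n i
  proof -
    have "list_all2 below_column (map last (tl (jblock (u (m, n))))) (map hd (butlast (jblock (u (m, n + 1)))))"
      using patch[of m n] by (simp add: all2_iff split: if_splits)
    then have "below_column (map last (tl (jblock (u (m, n)))) ! i) (map hd (butlast (jblock (u (m, n + 1)))) ! i)"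
      by (rule list_all2_nthD) (use i in \<open>simp add: bwidth_def\<close>)
    then show ?thesis
      using i W(1)[of m n] ends'(1)[OF i] ends'(2)[of i "u (m, n + 1)"]
      by (simp add: bwidth_def nth_tl nth_butlast)
  qed
  have corner: "below_column (jblock (u (m + 1, n)) ! 0 ! (bheight (u (m + 1, n)) - 1))
      (jblock (u (m, n + 1)) ! (bwidth (u (m, n + 1)) - 1) ! 0)" for m n
    using patch[of m n] ends ends' pos by (simp split: if_splits)
  show "beside_column (z (p, q)) (z (p + 1, q))"
  proof (cases "Suc i < bwidth (u (m, n))")
    case True
    then show ?thesis using covers_next(1)[OF c comp *(3,4)] fitting_nth(1)[OF inner[OF True]] *
      by (simp add: length_jblock_nth)
  next
    case False
    then have i: "i = bwidth (u (m, n)) - 1" using *(3) by simp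
    then show ?thesis using covers_next(1)[OF c comp *(3,4)] False fitting_nth(1)[OF cross[of m n]] *
      by (simp add: length_jblock_nth)
  qed
  show "below_column (z (p, q)) (z (p - 1, q + 1))"
  proof (cases i)
    case (Suc i')
    then have i': "Suc i' < bwidth (u (m, n))" "p - 1 = P m + int i'" using * by simp_all
    show ?thesis
    proof (cases "Suc j < bheight (u (m, n))")
      case True
      then show ?thesis
        using covers_next(2)[OF c comp _ *(4), of i'] fitting_nth(2)[OF inner[OF i'(1)], of j] * i' Suc
        by (simp add: length_jblock_nth)
    next
      case False
      then have "j = bheight (u (m, n)) - 1" using *(4) by simp
      then show ?thesis using covers_next(2)[OF c comp _ *(4), of i'] False up[OF i'(1)] * i' Suc by simp
    qed
  next
    case 0
    \<comment> \<open>The cell is in the first column of its block, so its upper left neighbor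
      belongs to the preceding block column. The patch that controls both starts at
      \<open>l\<close>.\<close>
    define l where "l = m - 1"
    have m: "m = l + 1" by (simp add: l_def)
    have p: "p - 1 = P l + int (bwidth (u (l, n)) - 1)"
      using coversD(1)[OF c, of l n] *(1) 0 pos(1)[of "u (l, n)"] by (simp add: m of_nat_diff)
    have H: "bheight (u (m, n)) = bheight (u (l, n))" using W(2)[of l n] m by simp
    have z: "z (p - 1, q + 1) = (if Suc j < bheight (u (l, n)) then jblock (u (l, n)) ! (bwidth (u (l, n)) - 1) ! Suc j
        else jblock (u (l, n + 1)) ! (bwidth (u (l, n)) - 1) ! 0)"
      using covers_next(2)[OF c comp, of "bwidth (u (l, n)) - 1" l n j] pos(1) *(2,4) H p by simp
    show ?thesis
    proof (cases "Suc j < bheight (u (l, n))")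
      case True
      then show ?thesis using z fitting_nth(2)[OF cross[of l n], of j] *(5) 0 m pos(1)
        by (simp add: length_jblock_nth)
    next
      case False
      then have "j = bheight (u (m, n)) - 1" using *(4) H by simp
      then show ?thesis using z False corner[of l n] W(1)[of l n] *(5) 0 m by simp
    qed
  qed
qed

text \<open>Columns of height 4 make up the second rows of the blocks. In these rows the next eight columns
  decide whether a block starts.\<close>

definition cut_windows :: "jcolumn list list" where
  "cut_windows = [
     [C0,C2,C11,C3,C10,C6,C5,C1], [C0,C2,C11,C3,C10,C7,C4,C12],
     [C0,C10,C6,C5,C9,C8,C4,C12], [C3,C10,C6,C5,C9,C8,C4,C12],
     [C6,C5,C1,C0,C10,C6,C5,C1], [C7,C4,C12,C3,C10,C6,C5,C1],
     [C8,C4,C12,C3,C10,C6,C5,C1], [C8,C4,C12,C3,C10,C7,C4,C12]]"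

definition second_row :: "utile \<Rightarrow> jcolumn list" where
  "second_row a = map (\<lambda>c. c ! 1) (jblock a)"

primrec no_cuts :: "nat \<Rightarrow> jcolumn list \<Rightarrow> bool" where
  "no_cuts 0 s = True"
| "no_cuts (Suc k) s = (if memb cut_windows (take 8 s) then False else no_cuts k (tl s))"

text \<open>Three tiles suffice and may be needed: with widths from 5 to 8, a window of eight
  columns starting in \<open>a\<close> can extend past \<open>b\<close> but not past
  \<open>c\<close>.\<close>

definition decodable3 :: "utile \<Rightarrow> utile \<Rightarrow> utile \<Rightarrow> bool" where
  "decodable3 a b c =
     (if memb cut_windows (take 8 (second_row a @ second_row b @ second_row c)) then
        no_cuts (length (tl (jblock a))) (tl (second_row a @ second_row b @ second_row c)) else False)"

definition decodable2 :: "utile \<Rightarrow> utile \<Rightarrow> bool" where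
  "decodable2 a b = every (decodable3 a b) (h_next2 b)"

definition decodable :: "utile \<Rightarrow> bool" where
  "decodable a = every (decodable2 a) (h_next2 a)"

lemma decodable: "every decodable utiles"
  by code_simp

lemma no_cuts_iff: "no_cuts k s \<longleftrightarrow> (\<forall>i<k. take 8 (drop i s) \<notin> set cut_windows)"
proof (induction k arbitrary: s)
  case (Suc k)
  have "(\<forall>i<Suc k. take 8 (drop i s) \<notin> set cut_windows) \<longleftrightarrow>
      take 8 s \<notin> set cut_windows \<and> (\<forall>i<k. take 8 (drop (Suc i) s) \<notin> set cut_windows)"
    by (auto simp: less_Suc_eq_0_disj)
  then show ?case using Suc by (simp add: memb_iff drop_Suc)
qed simp

lemma window_cut_iff:
  assumes "b \<in> set (h_next2 a)" "c \<in> set (h_next2 b)" "i < bwidth a"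
  shows "take 8 (drop i (second_row a @ second_row b @ second_row c)) \<in> set cut_windows \<longleftrightarrow> i = 0"
proof -
  define s where "s = second_row a @ second_row b @ second_row c"
  have "decodable3 a b c"
    using decodable assms(1,2) set_utiles by (auto simp: every_iff decodable_def decodable2_def)
  then have s: "take 8 s \<in> set cut_windows" "no_cuts (bwidth a - 1) (tl s)"
    by (simp_all add: decodable3_def memb_iff bwidth_def s_def split: if_splits)
  have "take 8 (drop i s) \<notin> set cut_windows" if "i = Suc k" for k
    using s(2) that assms(3) unfolding no_cuts_iff by (simp add: drop_Suc)
  then show ?thesis using s(1) unfolding s_def[symmetric] by (cases i) auto
qed

lemma utilings_h_next:
  assumes "u \<in> utilings" shows "u (m + 1, n) \<in> set (h_next2 (u (m, n)))"
  using patch_at_surviving[OF assms, of m n]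
  by (auto simp: patch_at_def surviving_def surviving1_def surviving2_def surviving3_def)

definition tall :: "jcolumn \<Rightarrow> bool" where
  "tall c \<longleftrightarrow> length (jcolumn_tiles c) = 5"

lemma tall_jblock:
  assumes "i < bwidth a" "j < bheight a" shows "tall (jblock a ! i ! j) \<longleftrightarrow> j \<noteq> 1"
proof -
  have "\<forall>c\<in>set (jblock a). tall (c ! 0) \<and> \<not> tall (c ! 1) \<and> (length c = 3 \<longrightarrow> tall (c ! 2))"
    by (cases a; simp add: tall_def)
  then have c: "tall (jblock a ! i ! 0)" "\<not> tall (jblock a ! i ! 1)" "bheight a = 3 \<Longrightarrow> tall (jblock a ! i ! 2)"
    using assms(1) length_jblock_nth[OF assms(1)] by (auto simp: bwidth_def)
  have "j = 0 \<or> j = 1 \<or> (j = 2 \<and> bheight a = 3)" using assms(2) block_shape(4)[of a] by linarith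
  then show ?thesis using c by auto
qed

text \<open>Going up through a block, the heights of the columns are 5, 4 and possibly 5 again. So a
  row of blocks starts exactly where a tall column has a short one above it, and a single abscissa
  suffices to see this.\<close>

lemma range_rows:
  assumes u: "u \<in> utilings" and c: "block_covers u P Q z"
  shows "range Q = {q. tall (z (p, q)) \<and> \<not> tall (z (p, q + 1))}"
proof -
  have comp: "compatible bwidth bheight u" by (rule cell.tilings_compatible[OF u])
  have "q \<in> range Q \<longleftrightarrow> tall (z (p, q)) \<and> \<not> tall (z (p, q + 1))" for q
  proof -
    obtain m n i j where *: "p = P m + int i" "q = Q n + int j" "i < bwidth (u (m, n))" "j < bheight (u (m, n))"
      "z (p, q) = jblock (u (m, n)) ! i ! j"
      using covers_cell[OF c comp] by metis
    have i: "i < bwidth (u (m, n + 1))" "0 < bheight (u (m, n + 1))"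
      using comp *(3) by (auto simp: compatible_def)
    have "tall (z (p, q + 1)) \<longleftrightarrow> j \<noteq> 0"
      using covers_next(2)[OF c comp *(3,4)] tall_jblock[OF *(3), of "Suc j"] tall_jblock[OF i]
        block_shape(3)[of "u (m, n)"] * by auto
    moreover have "q \<in> range Q \<longleftrightarrow> j = 0"
      unfolding *(2) by (rule covers_in_range(2)[OF c comp *(4)])
    ultimately show ?thesis using tall_jblock[OF *(3,4)] *(5) by auto
  qed
  then show ?thesis by blast
qed

text \<open>The line \<open>Q n + 1\<close> is the second row of a row of blocks, the one in which
  \<open>cut_windows\<close> detects the starts of blocks.\<close>

lemma range_columns:
  assumes u: "u \<in> utilings" and c: "block_covers u P Q z"
  shows "range P = {p. map (\<lambda>k. z (p + int k, Q n + 1)) [0..<8] \<in> set cut_windows}"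
proof -
  have comp: "compatible bwidth bheight u" by (rule cell.tilings_compatible[OF u])
  have row: "second_row (u (m, n)) = map (\<lambda>k. z (P m + int k, Q n + 1)) [0..<bwidth (u (m, n))]" for m
  proof (rule nth_equalityI)
    fix k assume "k < length (second_row (u (m, n)))"
    then have "k < bwidth (u (m, n))" by (simp add: second_row_def bwidth_def)
    then show "second_row (u (m, n)) ! k = map (\<lambda>k. z (P m + int k, Q n + 1)) [0..<bwidth (u (m, n))] ! k"
      using coversD(3)[OF c, of k m n 1] block_shape(3)[of "u (m, n)"] by (simp add: second_row_def bwidth_def)
  qed (simp add: second_row_def bwidth_def)
  have "p \<in> range P \<longleftrightarrow> map (\<lambda>k. z (p + int k, Q n + 1)) [0..<8] \<in> set cut_windows" for p
  proof -
    obtain m where m: "P m \<le> p" "p < P (m + 1)" using steps_cover covers_steps(1)[OF c comp] by metis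
    define i where "i = nat (p - P m)"
    have i: "p = P m + int i" "i < bwidth (u (m, n))"
      using m coversD(1)[OF c, of m n] by (auto simp: i_def)
    let ?a = "u (m, n)" and ?b = "u (m + 1, n)" and ?c = "u (m + 1 + 1, n)"
    define s where "s = second_row ?a @ second_row ?b @ second_row ?c"
    have len: "length (second_row a) = bwidth a" for a by (simp add: second_row_def bwidth_def)
    have s: "s ! k = z (P m + int k, Q n + 1)" if "k < bwidth ?a + bwidth ?b + bwidth ?c" for k
      using that coversD(1)[OF c, of m n] coversD(1)[OF c, of "m + 1" n]
      by (auto simp: s_def nth_append len of_nat_diff row)
    have "length s = bwidth ?a + bwidth ?b + bwidth ?c" by (simp add: s_def len)
    then have "take 8 (drop i s) = map (\<lambda>k. z (p + int k, Q n + 1)) [0..<8]"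
      using block_shape(1)[of ?b] block_shape(1)[of ?c] i(2)
      by (intro nth_equalityI) (auto simp: s i(1) add.assoc)
    moreover have "p \<in> range P \<longleftrightarrow> i = 0" unfolding i(1) by (rule covers_in_range(1)[OF c comp i(2)])
    ultimately show ?thesis
      using window_cut_iff[OF utilings_h_next[OF u, of m n] utilings_h_next[OF u, of "m + 1" n] i(2)]
      unfolding s_def by simp
  qed
  then show ?thesis by blast
qed

text \<open>The row lines are recovered before the column lines. A row line common to both coverings
  provides a second row in which the column lines of both can be read.\<close>

lemma block_covers_unique:
  assumes u: "u \<in> utilings" and c: "block_covers u P Q z"
    and u': "u' \<in> utilings" and c': "block_covers u' P' Q' z"
  obtains a b :: int where "\<And>m. P' m = P (m + a)" "\<And>n. Q' n = Q (n + b)" "u' = shift (a, b) u"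
proof (rule covers_translate[OF c cell.tilings_compatible[OF u] c' cell.tilings_compatible[OF u']])
  show Q: "range Q = range Q'" using range_rows[OF u c, of 0] range_rows[OF u' c', of 0] by simp
  then obtain b where "Q' 0 = Q b" by (metis rangeE rangeI)
  then show "range P = range P'"
    using range_columns[OF u c, of b] range_columns[OF u' c', of 0] by simp
  show "u' p = u q" if "bwidth (u' p) = bwidth (u q)" "bheight (u' p) = bheight (u q)"
    "\<forall>i<bwidth (u' p). \<forall>j<bheight (u' p). jblock (u' p) ! i ! j = jblock (u q) ! i ! j" for p q
    using that length_jblock_nth
    by (intro block_agree(3) nth_nth_eqI) (auto simp: bwidth_def)
qed blast

section \<open>The letter map from sheared cells to columns\<close>

definition column_at :: "nat tile \<Rightarrow> jcolumn" where
  "column_at r = (case inv_into cells cell_tile r of (a, i, j) \<Rightarrow> jblock a ! i ! j)"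

definition jr_column :: "jcolumn \<Rightarrow> nat tile list" where
  "jr_column c = map (recolor jcode) (jcolumn_tiles c)"

text \<open>The right color of a domino encodes its right component, which is the cell that the
  shear has moved to this position.\<close>

definition column_tile :: "nat tile \<Rightarrow> nat tile" where
  "column_tile r = fused (jr_column (column_at (from_nat (right_color r))))"

lemma jr_column_in: "jr_column c \<in> jr_columns"
  by (cases c; auto simp: jr_column_def jr_columns_def stacked_def jr_start_def jeandel_rao_def recolor_def less_Suc_eq)

lemma jr_column_eq_iff: "jr_column c = jr_column d \<longleftrightarrow> c = d"
proof
  assume "jr_column c = jr_column d"
  moreover have "inj (recolor jcode)"
    by (rule injI) (auto simp: recolor_def jcode_eq_iff)
  ultimately have "jcolumn_tiles c = jcolumn_tiles d" by (simp add: jr_column_def inj_map_eq_map)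
  then show "c = d" by (cases c; cases d) simp_all
qed simp

lemma fused_jr_column:
  "fused (jr_column c) = fused (jr_column d) \<longleftrightarrow> c = d"
  "beside_column c d \<Longrightarrow> right_color (fused (jr_column c)) = left_color (fused (jr_column d))"
  "below_column c d \<Longrightarrow> top_color (fused (jr_column c)) = bottom_color (fused (jr_column d))"
proof -
  show "fused (jr_column c) = fused (jr_column d) \<longleftrightarrow> c = d"
    using inj_onD[OF jr.inj _ jr_column_in jr_column_in, of c d] jr_column_eq_iff by auto
  show "right_color (fused (jr_column c)) = left_color (fused (jr_column d))" if "beside_column c d"
  proof -
    have "map right_color (jr_column c) = map left_color (jr_column d)"
      using arg_cong[OF that[unfolded beside_column_def], of "map jcode"] by (simp add: jr_column_def comp_def)
    then show ?thesis by (simp add: fused_def)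
  qed
  have ne: "jcolumn_tiles e \<noteq> []" for e by (cases e) simp_all
  show "top_color (fused (jr_column c)) = bottom_color (fused (jr_column d))" if "below_column c d"
    using that ne by (simp add: fused_def jr_column_def below_column_def last_map hd_map)
qed

abbreviation cell_tiles :: "nat tile set" where
  "cell_tiles \<equiv> cell_tile ` cells"

abbreviation cell_covers :: "utile config \<Rightarrow> (int \<Rightarrow> int) \<Rightarrow> (int \<Rightarrow> int) \<Rightarrow> nat tile config \<Rightarrow> bool" where
  "cell_covers \<equiv> covers bwidth bheight (\<lambda>a i j. cell_tile (a, i, j))"

lemma block_covers_column_at:
  assumes "cell_covers u P Q x" shows "block_covers u P Q (\<lambda>p. column_at (x p))"
proof -
  have "column_at (cell_tile (a, i, j)) = jblock a ! i ! j" if "i < bwidth a" "j < bheight a" for a i j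
    using inv_into_f_f[OF inj_cell_tile, of "(a, i, j)"] that by (simp add: column_at_def cells_def)
  then show ?thesis using assms by (simp add: covers_def)
qed

lemma column_tile_shear: "column_tile (shear x (m, n)) = fused (jr_column (column_at (x (m - n, n))))"
  by (simp add: column_tile_def shear_def)

lemma column_tile_wang_shift:
  assumes "y \<in> wang_shift (shear_tiles cell_tiles)"
  shows "column_tile \<circ> y \<in> wang_shift (fused ` jr_columns)"
proof -
  have y: "y = shear (unshear y)" using shear_unshear[OF assms] by simp
  obtain u P Q where u: "u \<in> utilings" "cell_covers u P Q (unshear y)"
    using cell.desubstitute[OF unshear_wang_shift[OF assms]] by metis
  note adj = block_covers_adjacent[OF u(1) block_covers_column_at[OF u(2)]]
  show ?thesis
    unfolding wang_shift_eq_tilings tilings_def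
  proof (intro CollectI conjI allI)
    fix p show "(column_tile \<circ> y) p \<in> fused ` jr_columns"
      using jr_column_in by (simp add: column_tile_def)
  next
    fix m n
    \<comment> \<open>In these coordinates a step up in the sheared tiling is a step to the upper
      left among the cells, which \<open>adj(2)\<close> controls.\<close>
    have "(column_tile \<circ> y) (k, l) = fused (jr_column (column_at (unshear y (k - l, l))))" for k l
      by (subst y) (simp add: column_tile_shear)
    then show "right_color (id ((column_tile \<circ> y) (m, n))) = left_color (id ((column_tile \<circ> y) (m + 1, n)))"
      "top_color (id ((column_tile \<circ> y) (m, n))) = bottom_color (id ((column_tile \<circ> y) (m, n + 1)))"
      using fused_jr_column(2)[OF adj(1)[of "m - n" n]] fused_jr_column(3)[OF adj(2)[of "m - n" n]]
      by (simp_all add: algebra_simps)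
  qed
qed

text \<open>Two tilings by cells with equal columns give two block coverings of one configuration of
  columns. These have the same lines and tiles up to reindexing, and lines and tiles determine the
  cells.\<close>

lemma column_tile_inj:
  assumes y: "y \<in> wang_shift (shear_tiles cell_tiles)" and y': "y' \<in> wang_shift (shear_tiles cell_tiles)"
    and eq: "column_tile \<circ> y = column_tile \<circ> y'"
  shows "y = y'"
proof -
  let ?x = "unshear y" and ?x' = "unshear y'"
  have shear: "y = shear ?x" "y' = shear ?x'" using shear_unshear y y' by auto
  obtain u P Q where u: "u \<in> utilings" "cell_covers u P Q ?x"
    using cell.desubstitute[OF unshear_wang_shift[OF y]] by metis
  obtain u' P' Q' where u': "u' \<in> utilings" "cell_covers u' P' Q' ?x'"
    using cell.desubstitute[OF unshear_wang_shift[OF y']] by metis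
  have "column_at (?x' (m, n)) = column_at (?x (m, n))" for m n
  proof -
    have "column_tile (shear ?x (m + n, n)) = column_tile (shear ?x' (m + n, n))"
      using fun_cong[OF eq, of "(m + n, n)"] shear by simp
    then show ?thesis unfolding column_tile_shear fused_jr_column(1) by simp
  qed
  then have "(\<lambda>p. column_at (?x' p)) = (\<lambda>p. column_at (?x p))" by auto
  then have "block_covers u' P' Q' (\<lambda>p. column_at (?x p))"
    using block_covers_column_at[OF u'(2)] by simp
  then obtain a b where ab: "\<And>m. P' m = P (m + a)" "\<And>n. Q' n = Q (n + b)" "u' = shift (a, b) u"
    using block_covers_unique[OF u(1) block_covers_column_at[OF u(2)] u'(1)] by metis
  have "?x (p, q) = ?x' (p, q)" for p q
  proof -
    obtain m n i j where *: "p = P m + int i" "q = Q n + int j" "i < bwidth (u (m, n))" "j < bheight (u (m, n))"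
      "?x (p, q) = cell_tile (u (m, n), i, j)"
      using covers_cell[OF u(2) cell.tilings_compatible[OF u(1)]] by metis
    have "u' (m - a, n - b) = u (m, n)" by (simp add: ab(3) shift_def)
    then show ?thesis using coversD(3)[OF u'(2), of i "m - a" "n - b" j] * ab(1,2) by simp
  qed
  then have "?x = ?x'" by auto
  then show ?thesis using shear by simp
qed

theorem theorem3:
  shows "\<exists>T :: nat \<Rightarrow> nat tile set.
    T 0 = jeandel_rao \<and> (\<forall>i\<in>{1..12}. finite (T i)) \<and>
    (let \<Omega> = (\<lambda>i. wang_shift (T i)) in
      (\<forall>i\<in>{0,1,2,3}. \<exists>\<omega>.
         morphism_on (\<Omega> (i + 1)) (T i) \<omega> \<and> extend \<omega> \<in> \<Omega> (i + 1) \<rightarrow> \<Omega> i \<and>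
         recognizable (\<Omega> (i + 1)) \<omega> \<and> onto_up_to_shift (\<Omega> (i + 1)) (\<Omega> i) \<omega>) \<and>
      (\<exists>f. embedding (\<Omega> 5) (\<Omega> 4) f \<and> topological_conjugacy (\<Omega> 5) (f ` \<Omega> 5) f) \<and>
      (\<exists>\<eta>. shear_conjugacy (vector [vector [1, 1], vector [0, 1]]) (\<Omega> 6) (\<Omega> 5) \<eta>) \<and>
      (\<forall>i\<in>{6,7,8,9,10,11}. \<exists>\<omega>.
         morphism_on (\<Omega> (i + 1)) (T i) \<omega> \<and> extend \<omega> \<in> \<Omega> (i + 1) \<rightarrow> \<Omega> i \<and>
         recognizable (\<Omega> (i + 1)) \<omega> \<and> onto_up_to_shift (\<Omega> (i + 1)) (\<Omega> i) \<omega>) \<and>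
      equivalent_tiles (T 12) U_tiles \<and>
      self_similar (T 12) (\<Omega> 12) \<and> aperiodic (\<Omega> 12) \<and> minimal_subshift (\<Omega> 12))"
proof -
  define T :: "nat \<Rightarrow> nat tile set" where "T i = (if i = 0 then jeandel_rao else if i \<le> 4 then fused ` jr_columns
    else if i = 5 then shear_tiles cell_tiles else if i = 6 then cell_tiles else range utile_code)" for i
  have "cells \<subseteq> set utiles \<times> {..8} \<times> {..3}"
  proof
    fix c assume "c \<in> cells"
    moreover obtain a i j where "c = (a, i, j)" by (metis prod.collapse)
    ultimately show "c \<in> set utiles \<times> {..8} \<times> {..3}"
      using block_shape(2,4)[of a] by (simp add: cells_def set_utiles)
  qed
  then have fin: "finite cells" by (rule finite_subset) simp
  have "range utile_code = utile_code ` set utiles" by (simp add: set_utiles)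
  then have finite: "\<forall>i\<in>{1..12}. finite (T i)"
    using fin by (simp add: T_def finite_jr_columns finite_shear_tiles)
  have factor: "\<forall>i\<in>{0,1,2,3} \<union> {6,7,8,9,10,11}. wang_factor (T (i + 1)) (T i)"
    by (simp add: T_def jr.wang_factor cell.wang_factor wang_factor_refl)
  have T: "T 4 = fused ` jr_columns" "T 5 = shear_tiles cell_tiles" "T 6 = cell_tiles" "T 12 = range utile_code"
    by (simp_all add: T_def)
  have emb: "embedding (wang_shift (T 5)) (wang_shift (T 4)) ((\<circ>) column_tile)"
    "topological_conjugacy (wang_shift (T 5)) ((\<circ>) column_tile ` wang_shift (T 5)) ((\<circ>) column_tile)"
    unfolding T
    by (rule embedding_letter_map[OF compactin_wang_shift[OF finite_shear_tiles[OF finite_imageI[OF fin]]]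
        column_tile_wang_shift column_tile_inj]; assumption)+
  show ?thesis
    unfolding Let_def
  proof (intro exI[of _ T] conjI ballI)
    show "T 0 = jeandel_rao" by (simp add: T_def)
    show "finite (T i)" if "i \<in> {1..12}" for i using finite that by blast
    show "\<exists>\<omega>. morphism_on (wang_shift (T (i + 1))) (T i) \<omega> \<and>
        extend \<omega> \<in> wang_shift (T (i + 1)) \<rightarrow> wang_shift (T i) \<and> recognizable (wang_shift (T (i + 1))) \<omega> \<and>
        onto_up_to_shift (wang_shift (T (i + 1))) (wang_shift (T i)) \<omega>" if "i \<in> {0,1,2,3}" for i
      using factor that unfolding wang_factor_def by blast
    show "\<exists>\<omega>. morphism_on (wang_shift (T (i + 1))) (T i) \<omega> \<and>
        extend \<omega> \<in> wang_shift (T (i + 1)) \<rightarrow> wang_shift (T i) \<and> recognizable (wang_shift (T (i + 1))) \<omega> \<and>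
        onto_up_to_shift (wang_shift (T (i + 1))) (wang_shift (T i)) \<omega>" if "i \<in> {6,7,8,9,10,11}" for i
      using factor that unfolding wang_factor_def by blast
    show "\<exists>f. embedding (wang_shift (T 5)) (wang_shift (T 4)) f \<and>
        topological_conjugacy (wang_shift (T 5)) (f ` wang_shift (T 5)) f"
      using emb by blast
    show "\<exists>\<eta>. shear_conjugacy (vector [vector [1, 1], vector [0, 1]]) (wang_shift (T 6)) (wang_shift (T 5)) \<eta>"
      unfolding T using shear_conjugacy_shear by blast
  qed (simp_all only: T equivalent_U self_similar_U aperiodic_U minimal_U)
qed

end
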